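(* Let $P\in M_n(\Bbbk)$ be of Cartan type, $\mathcal R=(\mathfrak h,\Pi,\Pi^\vee)$ a realization of $P$ over $\Bbbk$ of rank $t$, $\{H_g\}_{g\in\mathcal G}$ a $\Bbbk$-basis of $\mathfrak h$, and $\mathfrak g^{\mathcal R}_P$ the associated multiparameter Lie bialgebra (MpLbA). Let $\Theta=(\theta_{gk})_{g,k\in\mathcal G}\in\mathfrak{so}_t(\Bbbk)$ be antisymmetric, $j_\Theta=\sum_{g,k}\theta_{gk}H_g\otimes H_k$ the associated toral twist, and $P_\Theta$, $\mathcal R_\Theta$ the twist deformations of $P$ and $\mathcal R$ by $\Theta$. Then there exists a Lie bialgebra isomorphism $$f^\Theta_P:\;\mathfrak g^{\mathcal R_\Theta}_{P_\Theta}\;\xrightarrow{\ \cong\ }\;\big(\mathfrak g^{\mathcal R}_P\big)^{j_\Theta},\qquad E_i\mapsto E_i,\quad T\mapsto T,\quad F_i\mapsto F_i\qquad(i\in I,\ T\in\mathfrak h).$$ In particular, the class of all MpLbA's of any fixed Cartan type and of fixed rank is stable by toral twist deformations. Moreover, inside it the subclass of all such MpLbA's associated with straight, resp. small, realizations is stable as well.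
   Context: $\Bbbk$ is a field of characteristic zero, $n\ge1$, $I=\{1,\dots,n\}$. $A=(a_{ij})$ is a symmetrizable generalized Cartan matrix, $D=\mathrm{diag}(d_i)$ the unique diagonal matrix with coprime positive integer entries such that $DA$ is symmetric. $P=(p_{ij})\in M_n(\Bbbk)$ is of Cartan type with Cartan matrix $A$ if $P+P^T=2DA$. A realization of $P$ over $\Bbbk$ is a triple $\mathcal R=(\mathfrak h,\Pi,\Pi^\vee)$ with $\mathfrak h$ a finite-dimensional $\Bbbk$-vector space (its dimension is the rank), $\Pi^\vee=\{T_i^\pm\}_{i\in I}\subseteq\mathfrak h$, $\Pi=\{\alpha_i\}_{i\in I}\subseteq\mathfrak h^*$, $\alpha_j(T_i^+)=p_{ij}$, $\alpha_j(T_i^-)=p_{ji}$, and $\{S_i=\frac12(T_i^++T_i^-)\}_{i\in I}$ linearly independent. It is straight if $\Pi$ is linearly independent; it is small if $\mathrm{Span}\{S_i\}_{i\in I}=\mathrm{Span}\{T_i^+,T_i^-\}_{i\in I}$. The MpLbA $\mathfrak g^{\mathcal R}_P$ is the Lie bialgebra generated as a Lie algebra by the vector space $\mathfrak h$ and elements $E_i,F_i$ ($i\in I$) with relations $[T',T'']=0$, $[T,E_j]=\alpha_j(T)E_j$, $[T,F_j]=-\alpha_j(T)F_j$, $[E_i,F_j]=\delta_{ij}\frac{T_i^++T_i^-}{2d_i}$, and $\mathrm{ad}(E_i)^{1-a_{ij}}(E_j)=0=\mathrm{ad}(F_i)^{1-a_{ij}}(F_j)$ for $i\neq j$, with Lie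 cobracket determined by $\delta(T)=0$, $\delta(E_i)=T_i^+\otimes E_i-E_i\otimes T_i^+$, $\delta(F_i)=T_i^-\otimes F_i-F_i\otimes T_i^-$ (this is well defined). A MpLbA has the rank, and is straight, small, etc., according to its realization. Twist deformation of a Lie bialgebra $(\mathfrak g,[\ ,\ ],\delta)$ by a twist $c\in\mathfrak g\otimes\mathfrak g$ (here toral twists $j_\Theta$, which satisfy the twist conditions): $\mathfrak g^c=(\mathfrak g,[\ ,\ ],\delta^c)$ with $\delta^c(x)=\delta(x)-\mathrm{ad}_x(c)$, $\mathrm{ad}_x(a\otimes b)=[x,a]\otimes b+a\otimes[x,b]$. Twist deformation of realizations: $T^\pm_{\Theta,\ell}=T^\pm_\ell\pm\sum_{g,k}\alpha_\ell(H_g)\theta_{kg}H_k$; $\mathcal R_\Theta=(\mathfrak h,\Pi,\{T^\pm_{\Theta,i}\}_{i\in I})$ is a realization of $P_\Theta=P-\mathfrak A\Theta\mathfrak A^T$, where $\mathfrak A=(\alpha_\ell(H_g))_{\ell\in I,g\in\mathcal G}$; $P_\Theta$ is of Cartan type with the same Cartan matrix.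
   Formalization: Stability of the small subclass fails as stated (n=1, P=(2), t=2, T^±=H_1, α(H_1)=2, α(H_2)=0, θ_12=1); it is asserted only for twists with every Σ_{g,k} α_ℓ(H_g)θ_{kg}H_k in Span{S_i}, i.e. exactly when R_Θ is again small. *)

theory Defs
  imports
    "HOL-Algebra.Module"
    "HOL-Algebra.AbelCoset"
    "HOL-Library.Poly_Mapping"
    "HOL-Library.Function_Algebras"
    "HOL-Analysis.Cartesian_Space"
begin

section \<open>Vector spaces on carrier sets and their tensor products\<close>

text \<open>
  The Lie algebra defined below by generators and relations depends on the matrix and the
  realization, so it cannot be a type; it is a module record over the ground field, the latter
  being the record of a type of class \<^class>\<open>field\<close>. The fields \<open>mult\<close> and \<open>one\<close> of a module record
  play no role.
\<close>

definition field_ring :: "'k::field ring" where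
  "field_ring = \<lparr>carrier = UNIV, mult = (*), one = 1, zero = 0, add = (+)\<rparr>"

definition mod_hom :: "('k::field, 'a, 'm) module_scheme \<Rightarrow> ('k, 'b, 'n) module_scheme \<Rightarrow> ('a \<Rightarrow> 'b) set" where
  "mod_hom M N = {f \<in> carrier M \<rightarrow> carrier N.
     (\<forall>x \<in> carrier M. \<forall>y \<in> carrier M. f (x \<oplus>\<^bsub>M\<^esub> y) = f x \<oplus>\<^bsub>N\<^esub> f y) \<and>
     (\<forall>c. \<forall>x \<in> carrier M. f (c \<odot>\<^bsub>M\<^esub> x) = c \<odot>\<^bsub>N\<^esub> f x)}"

definition quotient_module :: "('k::field, 'a, 'm) module_scheme \<Rightarrow> 'a set \<Rightarrow> ('k, 'a set) module" where
  "quotient_module M W = \<lparr>carrier = a_rcosets\<^bsub>M\<^esub> W, mult = undefined, one = undefined,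
     zero = W, add = set_add M, smult = (\<lambda>c X. \<Union>x \<in> X. W +>\<^bsub>M\<^esub> (c \<odot>\<^bsub>M\<^esub> x))\<rparr>"

definition free_scale :: "'k::field \<Rightarrow> ('x \<Rightarrow>\<^sub>0 'k) \<Rightarrow> ('x \<Rightarrow>\<^sub>0 'k)" where
  "free_scale c = Poly_Mapping.map ((*) c)"

definition free_module :: "'x set \<Rightarrow> ('k::field, 'x \<Rightarrow>\<^sub>0 'k) module" where
  "free_module X = \<lparr>carrier = {u. Poly_Mapping.keys u \<subseteq> X}, mult = undefined, one = undefined,
     zero = 0, add = (+), smult = free_scale\<rparr>"

abbreviation basis_vector :: "'x \<Rightarrow> ('x \<Rightarrow>\<^sub>0 'k::field)" where
  "basis_vector x \<equiv> Poly_Mapping.single x 1"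

definition tensor_relators ::
    "('k::field, 'a, 'm) module_scheme \<Rightarrow> ('k, 'b, 'n) module_scheme \<Rightarrow> ('a \<times> 'b \<Rightarrow>\<^sub>0 'k) set" where
  "tensor_relators M N =
     {basis_vector (x \<oplus>\<^bsub>M\<^esub> x', y) - basis_vector (x, y) - basis_vector (x', y) | x x' y.
        x \<in> carrier M \<and> x' \<in> carrier M \<and> y \<in> carrier N} \<union>
     {basis_vector (x, y \<oplus>\<^bsub>N\<^esub> y') - basis_vector (x, y) - basis_vector (x, y') | x y y'.
        x \<in> carrier M \<and> y \<in> carrier N \<and> y' \<in> carrier N} \<union>
     {basis_vector (c \<odot>\<^bsub>M\<^esub> x, y) - free_scale c (basis_vector (x, y)) | c x y.
        x \<in> carrier M \<and> y \<in> carrier N} \<union>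
     {basis_vector (x, c \<odot>\<^bsub>N\<^esub> y) - free_scale c (basis_vector (x, y)) | c x y.
        x \<in> carrier M \<and> y \<in> carrier N}"

definition tensor_kernel ::
    "('k::field, 'a, 'm) module_scheme \<Rightarrow> ('k, 'b, 'n) module_scheme \<Rightarrow> ('a \<times> 'b \<Rightarrow>\<^sub>0 'k) set" where
  "tensor_kernel M N = module.span free_scale (tensor_relators M N)"

definition tensor ::
    "('k::field, 'a, 'm) module_scheme \<Rightarrow> ('k, 'b, 'n) module_scheme \<Rightarrow> ('k, ('a \<times> 'b \<Rightarrow>\<^sub>0 'k) set) module" where
  "tensor M N = quotient_module (free_module (carrier M \<times> carrier N)) (tensor_kernel M N)"

definition pure_tensor ::
    "('k::field, 'a, 'm) module_scheme \<Rightarrow> ('k, 'b, 'n) module_scheme \<Rightarrow> 'a \<Rightarrow> 'b \<Rightarrow> ('a \<times> 'b \<Rightarrow>\<^sub>0 'k) set" where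
  "pure_tensor M N x y =
     tensor_kernel M N +>\<^bsub>free_module (carrier M \<times> carrier N)\<^esub> basis_vector (x, y)"

text \<open>
  The linear map \<open>M \<otimes> N \<rightarrow> W\<close> induced by \<open>\<beta>\<close>, computed on a representative; for bilinear \<open>\<beta>\<close> (the
  only case in which it is used) the choice does not matter.
\<close>

definition tensor_lift ::
    "('k::field, 'a, 'm) module_scheme \<Rightarrow> ('k, 'b, 'n) module_scheme \<Rightarrow> ('k, 'c, 'l) module_scheme \<Rightarrow>
     ('a \<Rightarrow> 'b \<Rightarrow> 'c) \<Rightarrow> ('a \<times> 'b \<Rightarrow>\<^sub>0 'k) set \<Rightarrow> 'c" where
  "tensor_lift M N W \<beta> X = (let u = (SOME u. u \<in> X) in
     \<Oplus>\<^bsub>W\<^esub>p \<in> Poly_Mapping.keys u. Poly_Mapping.lookup u p \<odot>\<^bsub>W\<^esub> \<beta> (fst p) (snd p))"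


section \<open>Lie bialgebras\<close>

record ('k, 'a) lie = "('k, 'a) module" +
  bracket :: "'a \<Rightarrow> 'a \<Rightarrow> 'a"

record (overloaded) ('k, 'a) lie_bialg = "('k, 'a) lie" +
  cobracket :: "'a \<Rightarrow> ('a \<times> 'a \<Rightarrow>\<^sub>0 'k) set"

definition lie_algebra :: "('k::field, 'a, 'm) lie_scheme \<Rightarrow> bool" where
  "lie_algebra L \<longleftrightarrow>
     Module.module field_ring L \<and>
     (\<forall>x \<in> carrier L. bracket L x \<in> mod_hom L L) \<and>
     (\<forall>y \<in> carrier L. (\<lambda>x. bracket L x y) \<in> mod_hom L L) \<and>
     (\<forall>x \<in> carrier L. bracket L x x = \<zero>\<^bsub>L\<^esub>) \<and>
     (\<forall>x \<in> carrier L. \<forall>y \<in> carrier L. \<forall>z \<in> carrier L.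
        bracket L x (bracket L y z) \<oplus>\<^bsub>L\<^esub> bracket L y (bracket L z x) \<oplus>\<^bsub>L\<^esub> bracket L z (bracket L x y) = \<zero>\<^bsub>L\<^esub>)"

definition tensor_ad ::
    "('k::field, 'a, 'm) lie_scheme \<Rightarrow> 'a \<Rightarrow> ('a \<times> 'a \<Rightarrow>\<^sub>0 'k) set \<Rightarrow> ('a \<times> 'a \<Rightarrow>\<^sub>0 'k) set" where
  "tensor_ad L x = tensor_lift L L (tensor L L)
     (\<lambda>a b. pure_tensor L L (bracket L x a) b \<oplus>\<^bsub>tensor L L\<^esub> pure_tensor L L a (bracket L x b))"

definition tensor_flip ::
    "('k::field, 'a, 'm) lie_scheme \<Rightarrow> ('a \<times> 'a \<Rightarrow>\<^sub>0 'k) set \<Rightarrow> ('a \<times> 'a \<Rightarrow>\<^sub>0 'k) set" where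
  "tensor_flip L = tensor_lift L L (tensor L L) (\<lambda>a b. pure_tensor L L b a)"

definition tensor_map ::
    "('k::field, 'a, 'm) lie_scheme \<Rightarrow> ('k, 'b, 'n) lie_scheme \<Rightarrow> ('a \<Rightarrow> 'b) \<Rightarrow>
     ('a \<times> 'a \<Rightarrow>\<^sub>0 'k) set \<Rightarrow> ('b \<times> 'b \<Rightarrow>\<^sub>0 'k) set" where
  "tensor_map L L' f = tensor_lift L L (tensor L' L') (\<lambda>a b. pure_tensor L' L' (f a) (f b))"

abbreviation tensor3 where
  "tensor3 L \<equiv> tensor (tensor L L) L"

definition pure_tensor3 where
  "pure_tensor3 L a b c = pure_tensor (tensor L L) L (pure_tensor L L a b) c"

text \<open>\<open>(a \<otimes> b) \<otimes> c \<mapsto> (b \<otimes> c) \<otimes> a\<close>\<close>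

definition tensor3_cycle where
  "tensor3_cycle L = tensor_lift (tensor L L) L (tensor3 L)
     (\<lambda>u c. tensor_lift L L (tensor3 L) (\<lambda>a b. pure_tensor3 L b c a) u)"

definition cobracket_left where
  "cobracket_left L = tensor_lift L L (tensor3 L)
     (\<lambda>a b. pure_tensor (tensor L L) L (cobracket L a) b)"

definition lie_bialgebra :: "('k::field, 'a, 'm) lie_bialg_scheme \<Rightarrow> bool" where
  "lie_bialgebra L \<longleftrightarrow>
     lie_algebra L \<and>
     cobracket L \<in> mod_hom L (tensor L L) \<and>
     (\<forall>x \<in> carrier L. tensor_flip L (cobracket L x) = \<ominus>\<^bsub>tensor L L\<^esub> cobracket L x) \<and>
     (\<forall>x \<in> carrier L. let w = cobracket_left L (cobracket L x) in
        w \<oplus>\<^bsub>tensor3 L\<^esub> tensor3_cycle L w \<oplus>\<^bsub>tensor3 L\<^esub> tensor3_cycle L (tensor3_cycle L w) = \<zero>\<^bsub>tensor3 L\<^esub>) \<and>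
     (\<forall>x \<in> carrier L. \<forall>y \<in> carrier L. cobracket L (bracket L x y) =
        tensor_ad L x (cobracket L y) \<ominus>\<^bsub>tensor L L\<^esub> tensor_ad L y (cobracket L x))"

definition lie_bialgebra_iso ::
    "('a \<Rightarrow> 'b) \<Rightarrow> ('k::field, 'a, 'm) lie_bialg_scheme \<Rightarrow> ('k, 'b, 'n) lie_bialg_scheme \<Rightarrow> bool" where
  "lie_bialgebra_iso f L L' \<longleftrightarrow>
     lie_bialgebra L \<and> lie_bialgebra L' \<and>
     f \<in> mod_hom L L' \<and> bij_betw f (carrier L) (carrier L') \<and>
     (\<forall>x \<in> carrier L. \<forall>y \<in> carrier L. f (bracket L x y) = bracket L' (f x) (f y)) \<and>
     (\<forall>x \<in> carrier L. cobracket L' (f x) = tensor_map L L' f (cobracket L x))"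

definition twist_bialgebra ::
    "('k::field, 'a) lie_bialg \<Rightarrow> ('a \<times> 'a \<Rightarrow>\<^sub>0 'k) set \<Rightarrow> ('k, 'a) lie_bialg" where
  "twist_bialgebra L c =
     L\<lparr>cobracket := (\<lambda>x. cobracket L x \<ominus>\<^bsub>tensor L L\<^esub> tensor_ad L x c)\<rparr>"


section \<open>Cartan matrices and realizations\<close>

definition gen_cartan_matrix :: "int^'n^'n \<Rightarrow> bool" where
  "gen_cartan_matrix A \<longleftrightarrow> (\<forall>i. A $ i $ i = 2) \<and>
     (\<forall>i j. i \<noteq> j \<longrightarrow> A $ i $ j \<le> 0 \<and> (A $ i $ j = 0 \<longleftrightarrow> A $ j $ i = 0))"

text \<open>
  The diagonal matrix \<open>D\<close> is given by its diagonal \<open>d\<close>. It is determined by an indecomposable \<open>A\<close>;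
  for a decomposable one it is a choice, hence a parameter everywhere below.
\<close>

definition symmetrizer :: "int^'n^'n \<Rightarrow> ('n::finite \<Rightarrow> nat) \<Rightarrow> bool" where
  "symmetrizer A d \<longleftrightarrow> (\<forall>i. d i > 0) \<and> Gcd (range d) = 1 \<and>
     (\<forall>i j. int (d i) * A $ i $ j = int (d j) * A $ j $ i)"

definition cartan_type :: "int^'n^'n \<Rightarrow> ('n::finite \<Rightarrow> nat) \<Rightarrow> 'k::field_char_0^'n^'n \<Rightarrow> bool" where
  "cartan_type A d P \<longleftrightarrow>
     P + transpose P = (\<chi> i j. 2 * (of_nat (d i) * of_int (A $ i $ j)))"

text \<open>The vector space \<open>\<hh>\<close> is the type \<open>'h\<close> with the scalar multiplication \<open>hscale\<close>.\<close>

record ('k, 'h, 'n) realization =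
  hscale :: "'k \<Rightarrow> 'h \<Rightarrow> 'h"
  root :: "'n \<Rightarrow> 'h \<Rightarrow> 'k"
  coroot_plus :: "'n \<Rightarrow> 'h"
  coroot_minus :: "'n \<Rightarrow> 'h"

definition coroot_mean ::
    "('k::field_char_0, 'h::ab_group_add, 'n) realization \<Rightarrow> 'n \<Rightarrow> 'h" where
  "coroot_mean R i = hscale R (1 / 2) (coroot_plus R i + coroot_minus R i)"

definition indep_family ::
    "('k::field \<Rightarrow> 'v::ab_group_add \<Rightarrow> 'v) \<Rightarrow> ('i \<Rightarrow> 'v) \<Rightarrow> bool" where
  "indep_family s v \<longleftrightarrow> inj v \<and> \<not> module.dependent s (range v)"

definition is_realization ::
    "'k::field_char_0^'n^'n \<Rightarrow> ('k, 'h::ab_group_add, 'n::finite) realization \<Rightarrow> bool" where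
  "is_realization P R \<longleftrightarrow>
     vector_space (hscale R) \<and>
     (\<exists>B. finite B \<and> module.span (hscale R) B = UNIV) \<and>
     (\<forall>i. Vector_Spaces.linear (hscale R) (*) (root R i)) \<and>
     (\<forall>i j. root R j (coroot_plus R i) = P $ i $ j) \<and>
     (\<forall>i j. root R j (coroot_minus R i) = P $ j $ i) \<and>
     indep_family (hscale R) (coroot_mean R)"

definition realization_rank :: "('k::field_char_0, 'h::ab_group_add, 'n) realization \<Rightarrow> nat" where
  "realization_rank R = vector_space.dim (hscale R) UNIV"

definition straight :: "('k::field_char_0, 'h::ab_group_add, 'n) realization \<Rightarrow> bool" where
  "straight R \<longleftrightarrow> indep_family (\<lambda>c \<phi> x. c * \<phi> x) (root R)"

definition small :: "('k::field_char_0, 'h::ab_group_add, 'n) realization \<Rightarrow> bool" where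
  "small R \<longleftrightarrow> module.span (hscale R) (range (coroot_mean R)) =
     module.span (hscale R) (range (coroot_plus R) \<union> range (coroot_minus R))"

definition basis_family ::
    "('k::field_char_0, 'h::ab_group_add, 'n) realization \<Rightarrow> ('g \<Rightarrow> 'h) \<Rightarrow> bool" where
  "basis_family R H \<longleftrightarrow>
     indep_family (hscale R) H \<and> module.span (hscale R) (range H) = UNIV"


section \<open>Multiparameter Lie bialgebras\<close>

datatype ('k, 'h, 'n) lie_term =
    GenT 'h | GenE 'n | GenF 'n
  | Zero
  | Plus "('k, 'h, 'n) lie_term" "('k, 'h, 'n) lie_term"
  | Scal 'k "('k, 'h, 'n) lie_term"
  | Brk "('k, 'h, 'n) lie_term" "('k, 'h, 'n) lie_term"

text \<open>
  The least congruence that contains the Lie algebra laws, the linearity of \<open>\<hh> \<rightarrow> \<gg>\<close> and the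
  defining relations.
\<close>

inductive mp_eq ::
    "int^'n^'n \<Rightarrow> ('n::finite \<Rightarrow> nat) \<Rightarrow> ('k::field_char_0, 'h::ab_group_add, 'n) realization \<Rightarrow>
     ('k, 'h, 'n) lie_term \<Rightarrow> ('k, 'h, 'n) lie_term \<Rightarrow> bool"
  for A :: "int^'n^'n" and d :: "'n \<Rightarrow> nat" and R :: "('k, 'h, 'n) realization"
where
  refl: "mp_eq A d R x x"
| sym: "mp_eq A d R x y \<Longrightarrow> mp_eq A d R y x"
| trans: "mp_eq A d R x y \<Longrightarrow> mp_eq A d R y z \<Longrightarrow> mp_eq A d R x z"
| plus_cong: "mp_eq A d R x x' \<Longrightarrow> mp_eq A d R y y' \<Longrightarrow> mp_eq A d R (Plus x y) (Plus x' y')"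
| scal_cong: "mp_eq A d R x x' \<Longrightarrow> mp_eq A d R (Scal c x) (Scal c x')"
| brk_cong: "mp_eq A d R x x' \<Longrightarrow> mp_eq A d R y y' \<Longrightarrow> mp_eq A d R (Brk x y) (Brk x' y')"

| plus_assoc: "mp_eq A d R (Plus (Plus x y) z) (Plus x (Plus y z))"
| plus_comm: "mp_eq A d R (Plus x y) (Plus y x)"
| plus_zero: "mp_eq A d R (Plus Zero x) x"
| plus_minus: "mp_eq A d R (Plus (Scal (- 1) x) x) Zero"
| scal_plus_right: "mp_eq A d R (Scal c (Plus x y)) (Plus (Scal c x) (Scal c y))"
| scal_plus_left: "mp_eq A d R (Scal (b + c) x) (Plus (Scal b x) (Scal c x))"
| scal_scal: "mp_eq A d R (Scal b (Scal c x)) (Scal (b * c) x)"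
| scal_one: "mp_eq A d R (Scal 1 x) x"

| brk_plus_left: "mp_eq A d R (Brk (Plus x y) z) (Plus (Brk x z) (Brk y z))"
| brk_plus_right: "mp_eq A d R (Brk x (Plus y z)) (Plus (Brk x y) (Brk x z))"
| brk_scal_left: "mp_eq A d R (Brk (Scal c x) y) (Scal c (Brk x y))"
| brk_scal_right: "mp_eq A d R (Brk x (Scal c y)) (Scal c (Brk x y))"
| brk_self: "mp_eq A d R (Brk x x) Zero"
| jacobi: "mp_eq A d R (Plus (Plus (Brk x (Brk y z)) (Brk y (Brk z x))) (Brk z (Brk x y))) Zero"

| gen_plus: "mp_eq A d R (GenT (S + T)) (Plus (GenT S) (GenT T))"
| gen_scal: "mp_eq A d R (GenT (hscale R c T)) (Scal c (GenT T))"

| rel_TT: "mp_eq A d R (Brk (GenT S) (GenT T)) Zero"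
| rel_TE: "mp_eq A d R (Brk (GenT T) (GenE j)) (Scal (root R j T) (GenE j))"
| rel_TF: "mp_eq A d R (Brk (GenT T) (GenF j)) (Scal (- root R j T) (GenF j))"
| rel_EF_same: "mp_eq A d R (Brk (GenE i) (GenF i))
    (Scal (1 / (2 * of_nat (d i))) (Plus (GenT (coroot_plus R i)) (GenT (coroot_minus R i))))"
| rel_EF_diff: "i \<noteq> j \<Longrightarrow> mp_eq A d R (Brk (GenE i) (GenF j)) Zero"
| serre_E: "i \<noteq> j \<Longrightarrow> mp_eq A d R ((Brk (GenE i) ^^ nat (1 - A $ i $ j)) (GenE j)) Zero"
| serre_F: "i \<noteq> j \<Longrightarrow> mp_eq A d R ((Brk (GenF i) ^^ nat (1 - A $ i $ j)) (GenF j)) Zero"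

type_synonym ('k, 'h, 'n) mp_elem = "('k, 'h, 'n) lie_term set"

definition mp_class where
  "mp_class A d R x = {y. mp_eq A d R x y}"

definition mp_lie ::
    "int^'n^'n \<Rightarrow> ('n::finite \<Rightarrow> nat) \<Rightarrow> ('k::field_char_0, 'h::ab_group_add, 'n) realization \<Rightarrow>
     ('k, ('k, 'h, 'n) mp_elem) lie" where
  "mp_lie A d R = \<lparr>carrier = range (mp_class A d R), mult = undefined, one = undefined,
     zero = mp_class A d R Zero,
     add = (\<lambda>X Y. \<Union>x \<in> X. \<Union>y \<in> Y. mp_class A d R (Plus x y)),
     smult = (\<lambda>c X. \<Union>x \<in> X. mp_class A d R (Scal c x)),
     bracket = (\<lambda>X Y. \<Union>x \<in> X. \<Union>y \<in> Y. mp_class A d R (Brk x y))\<rparr>"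

definition elT where "elT A d R T = mp_class A d R (GenT T)"
definition elE where "elE A d R i = mp_class A d R (GenE i)"
definition elF where "elF A d R i = mp_class A d R (GenF i)"

definition wedge where
  "wedge L x y = pure_tensor L L x y \<ominus>\<^bsub>tensor L L\<^esub> pure_tensor L L y x"

definition mp_with ::
    "int^'n^'n \<Rightarrow> ('n::finite \<Rightarrow> nat) \<Rightarrow> ('k::field_char_0, 'h::ab_group_add, 'n) realization \<Rightarrow>
     (('k, 'h, 'n) mp_elem \<Rightarrow> (('k, 'h, 'n) mp_elem \<times> ('k, 'h, 'n) mp_elem \<Rightarrow>\<^sub>0 'k) set) \<Rightarrow>
     ('k, ('k, 'h, 'n) mp_elem) lie_bialg" where
  "mp_with A d R \<delta> = lie.extend (mp_lie A d R) (lie_bialg.fields \<delta>)"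

text \<open>
  The matrix \<open>P\<close> is not an argument, its entries being the values of the roots of \<open>R\<close> on the
  coroots of \<open>R\<close>.
\<close>

definition mplba ::
    "int^'n^'n \<Rightarrow> ('n::finite \<Rightarrow> nat) \<Rightarrow> ('k::field_char_0, 'h::ab_group_add, 'n) realization \<Rightarrow>
     ('k, ('k, 'h, 'n) mp_elem) lie_bialg" where
  "mplba A d R = mp_with A d R (THE \<delta>.
     \<delta> \<in> extensional (carrier (mp_lie A d R)) \<and>
     lie_bialgebra (mp_with A d R \<delta>) \<and>
     (\<forall>T. \<delta> (elT A d R T) = \<zero>\<^bsub>tensor (mp_lie A d R) (mp_lie A d R)\<^esub>) \<and>
     (\<forall>i. \<delta> (elE A d R i) = wedge (mp_lie A d R) (elT A d R (coroot_plus R i)) (elE A d R i)) \<and>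
     (\<forall>i. \<delta> (elF A d R i) = wedge (mp_lie A d R) (elT A d R (coroot_minus R i)) (elF A d R i)))"

text \<open>\<open>L\<close> is, up to isomorphism, the Lie bialgebra of a realization of rank \<open>t\<close> with property \<open>Q\<close>
  of some matrix of Cartan type \<open>A\<close>.\<close>

definition in_mplba_class ::
    "int^'n^'n \<Rightarrow> ('n::finite \<Rightarrow> nat) \<Rightarrow> nat \<Rightarrow>
     (('k::field_char_0, 'h::ab_group_add, 'n) realization \<Rightarrow> bool) \<Rightarrow>
     ('k, ('k, 'h, 'n) mp_elem) lie_bialg \<Rightarrow> bool" where
  "in_mplba_class A d t Q L \<longleftrightarrow>
     (\<exists>P' R' f. cartan_type A d P' \<and> is_realization P' R' \<and> realization_rank R' = t \<and> Q R' \<and>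
        lie_bialgebra_iso f (mplba A d R') L)"


section \<open>Toral twists\<close>

definition toral_twist ::
    "int^'n^'n \<Rightarrow> ('n::finite \<Rightarrow> nat) \<Rightarrow> ('k::field_char_0, 'h::ab_group_add, 'n) realization \<Rightarrow>
     ('g::finite \<Rightarrow> 'h) \<Rightarrow> 'k^'g^'g \<Rightarrow> (('k, 'h, 'n) mp_elem \<times> ('k, 'h, 'n) mp_elem \<Rightarrow>\<^sub>0 'k) set" where
  "toral_twist A d R H \<Theta> = (let L = mplba A d R in
     \<Oplus>\<^bsub>tensor L L\<^esub>p \<in> UNIV. (\<Theta> $ fst p $ snd p) \<odot>\<^bsub>tensor L L\<^esub>
        pure_tensor L L (elT A d R (H (fst p))) (elT A d R (H (snd p))))"

definition root_matrix ::
    "('k::field_char_0, 'h::ab_group_add, 'n) realization \<Rightarrow> ('g \<Rightarrow> 'h) \<Rightarrow> 'k^'g^'n" where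
  "root_matrix R H = (\<chi> l g. root R l (H g))"

definition twist_matrix ::
    "('k::field_char_0, 'h::ab_group_add, 'n::finite) realization \<Rightarrow> ('g::finite \<Rightarrow> 'h) \<Rightarrow> 'k^'g^'g \<Rightarrow>
     'k^'n^'n \<Rightarrow> 'k^'n^'n" where
  "twist_matrix R H \<Theta> P = P - root_matrix R H ** \<Theta> ** transpose (root_matrix R H)"

definition coroot_shift ::
    "('k::field_char_0, 'h::ab_group_add, 'n) realization \<Rightarrow> ('g::finite \<Rightarrow> 'h) \<Rightarrow> 'k^'g^'g \<Rightarrow> 'n \<Rightarrow> 'h" where
  "coroot_shift R H \<Theta> l =
     (\<Sum>g \<in> UNIV. \<Sum>k \<in> UNIV. hscale R (root R l (H g) * \<Theta> $ k $ g) (H k))"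

definition twist_realization ::
    "('k::field_char_0, 'h::ab_group_add, 'n) realization \<Rightarrow> ('g::finite \<Rightarrow> 'h) \<Rightarrow> 'k^'g^'g \<Rightarrow>
     ('k, 'h, 'n) realization" where
  "twist_realization R H \<Theta> = R\<lparr>
     coroot_plus := (\<lambda>l. coroot_plus R l + coroot_shift R H \<Theta> l),
     coroot_minus := (\<lambda>l. coroot_minus R l - coroot_shift R H \<Theta> l)\<rparr>"

text \<open>
  Straightness is kept by every toral twist, since the roots do not change. Smallness is not: the
  shift of the coroots must stay in the span of the \<open>S\<^sub>i\<close>.
\<close>

lemma small_iff:
  assumes "vector_space (hscale R)"
  shows "small R \<longleftrightarrow> (\<forall>l. coroot_plus R l \<in> module.span (hscale R) (range (coroot_mean R)))"
proof -
  interpret V: vector_space "hscale R" by (rule assms)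
  let ?S = "V.span (range (coroot_mean R))"
  let ?T = "V.span (range (coroot_plus R) \<union> range (coroot_minus R))"
  have two: "coroot_plus R l + coroot_minus R l = hscale R 2 (coroot_mean R l)" for l
    by (simp add: coroot_mean_def)
  have S_T: "?S \<subseteq> ?T"
  proof (rule V.span_minimal)
    have "coroot_mean R l \<in> ?T" for l
      unfolding coroot_mean_def by (intro V.span_scale V.span_add V.span_base) auto
    then show "range (coroot_mean R) \<subseteq> ?T" by auto
  qed (rule V.subspace_span)
  show ?thesis
  proof
    assume "small R"
    then have "?S = ?T" by (simp add: small_def)
    then show "\<forall>l. coroot_plus R l \<in> ?S" by (auto intro: V.span_base)
  next
    assume plus: "\<forall>l. coroot_plus R l \<in> ?S"
    have "coroot_minus R l \<in> ?S" for l
    proof -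
      have "coroot_minus R l = hscale R 2 (coroot_mean R l) - coroot_plus R l"
        by (simp flip: two)
      moreover have "hscale R 2 (coroot_mean R l) \<in> ?S"
        by (rule V.span_scale) (simp add: V.span_base)
      ultimately show ?thesis
        using plus V.span_diff by metis
    qed
    with plus have "?T \<subseteq> ?S" by (intro V.span_minimal V.subspace_span) auto
    with S_T show "small R" by (simp add: small_def)
  qed
qed

lemma small_twist_iff:
  assumes "vector_space (hscale R)" and "small R"
  shows "small (twist_realization R H \<Theta>) \<longleftrightarrow>
    (\<forall>l. coroot_shift R H \<Theta> l \<in> module.span (hscale R) (range (coroot_mean R)))"
proof -
  interpret V: vector_space "hscale R" by (rule assms)
  let ?S = "V.span (range (coroot_mean R))"
  have mean: "coroot_mean (twist_realization R H \<Theta>) = coroot_mean R"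
    by (simp add: fun_eq_iff coroot_mean_def twist_realization_def algebra_simps)
  have plus: "coroot_plus R l \<in> ?S" for l
    using assms small_iff by blast
  have "small (twist_realization R H \<Theta>) \<longleftrightarrow>
      (\<forall>l. coroot_plus R l + coroot_shift R H \<Theta> l \<in> ?S)"
    using small_iff[of "twist_realization R H \<Theta>"] assms(1)
    by (simp add: mean) (simp add: twist_realization_def)
  then show ?thesis
    using plus by (simp add: V.span_add_eq)
qed

lemma small_not_twist_stable:
  shows "\<exists>(A :: int^1^1) d (P :: 'k::field_char_0^1^1) (R :: ('k, 'k^2, 1) realization)
    (H :: 2 \<Rightarrow> 'k^2) (\<Theta> :: 'k^2^2).
    gen_cartan_matrix A \<and> symmetrizer A d \<and> cartan_type A d P \<and> is_realization P R \<and>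
    basis_family R H \<and> transpose \<Theta> = - \<Theta> \<and> small R \<and> straight R \<and>
    \<not> small (twist_realization R H \<Theta>)"
proof -
  define A :: "int^1^1" where "A = (\<chi> i j. 2)"
  define d :: "1 \<Rightarrow> nat" where "d = (\<lambda>_. 1)"
  define P :: "'k^1^1" where "P = (\<chi> i j. 2)"
  define R :: "('k, 'k^2, 1) realization" where
    "R = \<lparr>hscale = (*s), root = (\<lambda>_ x. 2 * x $ 1),
      coroot_plus = (\<lambda>_. axis 1 1), coroot_minus = (\<lambda>_. axis 1 1)\<rparr>"
  define H :: "2 \<Rightarrow> 'k^2" where "H = (\<lambda>g. axis g 1)"
  define \<Theta> :: "'k^2^2" where
    "\<Theta> = (\<chi> i j. if i = j then 0 else if i = 1 then 1 else - 1)"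
  have mean: "coroot_mean R = (\<lambda>_. axis 1 1)"
    by (simp add: fun_eq_iff coroot_mean_def R_def vec_eq_iff axis_def)
  have inj1: "inj (f :: 1 \<Rightarrow> 'x)" for f by (auto intro!: injI)
  have "gen_cartan_matrix A" by (auto simp: gen_cartan_matrix_def A_def)
  moreover have "symmetrizer A d" by (auto simp: symmetrizer_def A_def d_def)
  moreover have "cartan_type A d P"
    by (simp add: cartan_type_def A_def d_def P_def vec_eq_iff transpose_def)
  moreover have "is_realization P R"
  proof -
    have "vec.independent {axis 1 1 :: 'k^2}"
      by (simp add: vec.dependent_single axis_eq_0_iff)
    then have "indep_family (hscale R) (coroot_mean R)"
      unfolding mean indep_family_def using inj1 by (simp add: R_def)
    moreover have "Vector_Spaces.linear (*s) (*) (\<lambda>x :: 'k^2. 2 * x $ 1)"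
      by (unfold_locales) (simp_all add: algebra_simps)
    moreover have "\<exists>B. finite B \<and> vec.span B = (UNIV :: ('k^2) set)"
      using finite_cart_basis span_cart_basis by blast
    ultimately show ?thesis
      by (simp add: is_realization_def R_def P_def vec.vector_space_axioms)
  qed
  moreover have "basis_family R H"
  proof -
    have "inj H" by (auto intro!: injI simp: H_def axis_eq_axis)
    moreover have "range H = cart_basis" by (auto simp: H_def cart_basis_def)
    ultimately show ?thesis
      by (simp add: basis_family_def indep_family_def R_def independent_cart_basis span_cart_basis)
  qed
  moreover have "transpose \<Theta> = - \<Theta>"
    by (auto simp: \<Theta>_def vec_eq_iff transpose_def forall_2)
  moreover have "small R" by (simp add: small_def mean) (simp add: R_def)
  moreover have "straight R"
  proof -
    have "Vector_Spaces.vector_space (\<lambda>c (\<phi> :: 'k^2 \<Rightarrow> 'k) x. c * \<phi> x)"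
      by unfold_locales (simp_all add: fun_eq_iff algebra_simps)
    then interpret F: vector_space "\<lambda>c (\<phi> :: 'k^2 \<Rightarrow> 'k) x. c * \<phi> x" .
    have "(\<lambda>x :: 'k^2. 2 * x $ 1) \<noteq> 0"
      by (auto simp: fun_eq_iff intro!: exI[of _ "axis 1 1"])
    then show ?thesis
      unfolding straight_def indep_family_def using inj1 by (simp add: R_def F.dependent_single)
  qed
  moreover have "\<not> small (twist_realization R H \<Theta>)"
  proof
    have vs: "vector_space (hscale R)" by (simp add: R_def vec.vector_space_axioms)
    assume "small (twist_realization R H \<Theta>)"
    then have "coroot_shift R H \<Theta> 1 \<in> vec.span {axis 1 1}"
      using small_twist_iff[OF vs \<open>small R\<close>, of H \<Theta>] by (simp add: mean) (simp add: R_def)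
    then obtain c where "coroot_shift R H \<Theta> 1 = c *s axis 1 1"
      by (auto simp: vec.span_singleton)
    then have "coroot_shift R H \<Theta> 1 $ 2 = 0" by (simp add: axis_def)
    moreover have "coroot_shift R H \<Theta> 1 $ 2 = - 2"
      by (simp add: coroot_shift_def R_def H_def \<Theta>_def sum_2 axis_def)
    ultimately show False by simp
  qed
  ultimately show ?thesis by blast
qed

end

theory Submission
  imports Defs
begin

text \<open>
  The coroots of \<open>R\<close> enter the Lie algebra only through the sums \<open>T\<^sub>i\<^sup>+ + T\<^sub>i\<^sup>-\<close>, which a toral twist does
  not change: \<open>R\<close> and its twist have the same Lie algebra, and the isomorphism is the identity. Both
  cobrackets are 1-cocycles with values in the tensor square, hence determined by their values on
  generators, and there \<open>- ad\<^sub>x(j\<^sub>\<Theta>)\<close> is exactly the shift of the coroots.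

  The point is that the cobracket of an MpLbA exists. It is defined on terms by the cocycle rule.
  It kills the Serre relations because, with \<open>x\<^sub>k = ad(E\<^sub>i)\<^sup>k(E\<^sub>j)\<close>,
  \<open>\<delta>(x\<^sub>k) = (k T\<^sub>i\<^sup>+ + T\<^sub>j\<^sup>+) \<and> x\<^sub>k - 2 d\<^sub>i k (k - 1 + a\<^sub>i\<^sub>j) E\<^sub>i \<and> x\<^sub>k\<^sub>-\<^sub>1\<close>, where both terms vanish for
  \<open>k = 1 - a\<^sub>i\<^sub>j\<close>. Its values are sums of wedges, hence antisymmetric, and for such a cocycle the
  co-Jacobi expression is again a cocycle, which vanishes on generators.
\<close>

section \<open>Vector spaces on carrier sets\<close>

text \<open>\<open>mplba\<close> is given by a definite description, so it means something only once
  exactly one cobracket fits. Uniqueness then does a second service: it identifies the twisted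
  cobracket with that of \<open>twist_realization\<close>, from which the twist inherits the Lie
  bialgebra axioms. No equation of Yang-Baxter type is verified for j_\<Theta>. The factor in
  \<delta>(x_k) arises as k ((k - 1) p_ii + p_ij + p_ji): besides p_ii only the symmetric part of P
  enters, and Cartan type fixes both. That the co-Jacobi expression is a cocycle rests on a
  symmetry. \<delta> \<otimes> id fails to commute with the action by a term built from two
  cobrackets, and after the cyclic sum this term is symmetric in the two. The symmetry is checked on
  wedges, which is why decompositions into wedges are carried along instead of mere antisymmetry
  under the flip. Two obstacles of form remain: a tensor is a coset, with maps out of it computed on
  a chosen representative, and one Lie algebra occurs in records of several types.\<close>

abbreviation vspace :: "('k::field, 'a, 'm) module_scheme \<Rightarrow> bool" where
  "vspace M \<equiv> Module.module field_ring M"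

lemma field_ring_simps [simp]:
  "carrier field_ring = UNIV" "mult field_ring = (*)" "one field_ring = 1"
  "zero field_ring = 0" "add field_ring = (+)"
  by (simp_all add: field_ring_def)

lemma cring_field_ring: "cring (field_ring :: 'k::field ring)"
proof (rule cringI)
  show "abelian_group (field_ring :: 'k ring)"
    by (rule abelian_groupI) (auto simp: algebra_simps intro: exI[of _ "- x" for x])
  show "comm_monoid (field_ring :: 'k ring)"
    by unfold_locales (auto simp: algebra_simps)
qed (simp add: algebra_simps)

text \<open>HOL-Algebra asks for additive inverses by existence; the scalar -1 supplies them, and
  the spaces built here come with that law instead of a minus operation.\<close>

lemma vspaceI:
  assumes "\<zero>\<^bsub>M\<^esub> \<in> carrier M"
    and "\<And>x y. x \<in> carrier M \<Longrightarrow> y \<in> carrier M \<Longrightarrow> x \<oplus>\<^bsub>M\<^esub> y \<in> carrier M"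
    and "\<And>c x. x \<in> carrier M \<Longrightarrow> c \<odot>\<^bsub>M\<^esub> x \<in> carrier M"
    and "\<And>x y z. x \<in> carrier M \<Longrightarrow> y \<in> carrier M \<Longrightarrow> z \<in> carrier M \<Longrightarrow>
      (x \<oplus>\<^bsub>M\<^esub> y) \<oplus>\<^bsub>M\<^esub> z = x \<oplus>\<^bsub>M\<^esub> (y \<oplus>\<^bsub>M\<^esub> z)"
    and "\<And>x y. x \<in> carrier M \<Longrightarrow> y \<in> carrier M \<Longrightarrow> x \<oplus>\<^bsub>M\<^esub> y = y \<oplus>\<^bsub>M\<^esub> x"
    and "\<And>x. x \<in> carrier M \<Longrightarrow> \<zero>\<^bsub>M\<^esub> \<oplus>\<^bsub>M\<^esub> x = x"
    and "\<And>x. x \<in> carrier M \<Longrightarrow> ((- 1) \<odot>\<^bsub>M\<^esub> x) \<oplus>\<^bsub>M\<^esub> x = \<zero>\<^bsub>M\<^esub>"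
    and "\<And>c x y. x \<in> carrier M \<Longrightarrow> y \<in> carrier M \<Longrightarrow>
      c \<odot>\<^bsub>M\<^esub> (x \<oplus>\<^bsub>M\<^esub> y) = (c \<odot>\<^bsub>M\<^esub> x) \<oplus>\<^bsub>M\<^esub> (c \<odot>\<^bsub>M\<^esub> y)"
    and "\<And>b c x. x \<in> carrier M \<Longrightarrow> (b + c) \<odot>\<^bsub>M\<^esub> x = (b \<odot>\<^bsub>M\<^esub> x) \<oplus>\<^bsub>M\<^esub> (c \<odot>\<^bsub>M\<^esub> x)"
    and "\<And>b c x. x \<in> carrier M \<Longrightarrow> (b * c) \<odot>\<^bsub>M\<^esub> x = b \<odot>\<^bsub>M\<^esub> (c \<odot>\<^bsub>M\<^esub> x)"
    and "\<And>x. x \<in> carrier M \<Longrightarrow> 1 \<odot>\<^bsub>M\<^esub> x = x"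
  shows "vspace (M :: ('k::field, 'a, 'm) module_scheme)"
proof (rule Module.moduleI)
  show "abelian_group M"
  proof (rule abelian_groupI)
    show "\<exists>y\<in>carrier M. y \<oplus>\<^bsub>M\<^esub> x = \<zero>\<^bsub>M\<^esub>" if "x \<in> carrier M" for x
      using assms(3,7) that by blast
  qed (use assms in \<open>simp_all\<close>)
qed (use assms in \<open>simp_all add: cring_field_ring\<close>)

context
  fixes M :: "('k::field, 'a, 'm) module_scheme"
  assumes M: "vspace M"
begin

interpretation M: Module.module field_ring M by (rule M)

lemma vs_closed [simp]:
  "\<zero>\<^bsub>M\<^esub> \<in> carrier M"
  "x \<in> carrier M \<Longrightarrow> y \<in> carrier M \<Longrightarrow> x \<oplus>\<^bsub>M\<^esub> y \<in> carrier M"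
  "x \<in> carrier M \<Longrightarrow> y \<in> carrier M \<Longrightarrow> x \<ominus>\<^bsub>M\<^esub> y \<in> carrier M"
  "x \<in> carrier M \<Longrightarrow> \<ominus>\<^bsub>M\<^esub> x \<in> carrier M"
  "x \<in> carrier M \<Longrightarrow> c \<odot>\<^bsub>M\<^esub> x \<in> carrier M"
  "(\<And>i. i \<in> I \<Longrightarrow> f i \<in> carrier M) \<Longrightarrow> finsum M f I \<in> carrier M"
  by (auto intro: M.finsum_closed)

lemma vs_one_smult: "x \<in> carrier M \<Longrightarrow> 1 \<odot>\<^bsub>M\<^esub> x = x"
  using M.smult_one by simp

lemma vs_smult_zero: "x \<in> carrier M \<Longrightarrow> 0 \<odot>\<^bsub>M\<^esub> x = \<zero>\<^bsub>M\<^esub>"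
  using M.smult_l_null by simp

lemma vs_zero_smult: "c \<odot>\<^bsub>M\<^esub> \<zero>\<^bsub>M\<^esub> = \<zero>\<^bsub>M\<^esub>"
  using M.smult_r_null by simp

end

lemma mod_hom_closed: "f \<in> mod_hom M N \<Longrightarrow> x \<in> carrier M \<Longrightarrow> f x \<in> carrier N"
  and mod_hom_add: "f \<in> mod_hom M N \<Longrightarrow> x \<in> carrier M \<Longrightarrow> y \<in> carrier M \<Longrightarrow>
    f (x \<oplus>\<^bsub>M\<^esub> y) = f x \<oplus>\<^bsub>N\<^esub> f y"
  and mod_hom_smult: "f \<in> mod_hom M N \<Longrightarrow> x \<in> carrier M \<Longrightarrow> f (c \<odot>\<^bsub>M\<^esub> x) = c \<odot>\<^bsub>N\<^esub> f x"
  by (auto simp: mod_hom_def)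

lemma mod_homI:
  assumes "\<And>x. x \<in> carrier M \<Longrightarrow> f x \<in> carrier N"
    and "\<And>x y. x \<in> carrier M \<Longrightarrow> y \<in> carrier M \<Longrightarrow> f (x \<oplus>\<^bsub>M\<^esub> y) = f x \<oplus>\<^bsub>N\<^esub> f y"
    and "\<And>c x. x \<in> carrier M \<Longrightarrow> f (c \<odot>\<^bsub>M\<^esub> x) = c \<odot>\<^bsub>N\<^esub> f x"
  shows "f \<in> mod_hom M N"
  using assms by (auto simp: mod_hom_def)

lemma mod_hom_zero:
  assumes "vspace M" "vspace N" "f \<in> mod_hom M N"
  shows "f \<zero>\<^bsub>M\<^esub> = \<zero>\<^bsub>N\<^esub>"
proof -
  have "f \<zero>\<^bsub>M\<^esub> = f (0 \<odot>\<^bsub>M\<^esub> \<zero>\<^bsub>M\<^esub>)" using assms by (simp add: vs_zero_smult)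
  also have "\<dots> = 0 \<odot>\<^bsub>N\<^esub> f \<zero>\<^bsub>M\<^esub>" using assms by (simp add: mod_hom_smult)
  also have "\<dots> = \<zero>\<^bsub>N\<^esub>" using assms by (simp add: vs_smult_zero mod_hom_closed)
  finally show ?thesis .
qed

section \<open>Free vector spaces and linear extension from a basis\<close>

lemma lookup_free_scale [simp]: "Poly_Mapping.lookup (free_scale c u) x = c * Poly_Mapping.lookup u x"
  by (simp add: free_scale_def Poly_Mapping.map.rep_eq when_def)

text \<open>The free space fills a whole type, so spans, bases and basis extension are available for
  it without carrier conditions.\<close>

global_interpretation free: vector_space "free_scale :: 'k::field \<Rightarrow> ('x \<Rightarrow>\<^sub>0 'k) \<Rightarrow> _"
  by unfold_locales (auto intro!: poly_mapping_eqI simp: lookup_add algebra_simps)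

lemma keys_free_scale: "Poly_Mapping.keys (free_scale c u) \<subseteq> Poly_Mapping.keys u"
  by (auto simp: in_keys_iff)

lemma free_module_simps [simp]:
  "carrier (free_module X) = {u. Poly_Mapping.keys u \<subseteq> X}"
  "zero (free_module X) = 0" "add (free_module X) = (+)"
  "smult (free_module X) = free_scale"
  by (simp_all add: free_module_def)

lemma subspace_free_module: "free.subspace {u. Poly_Mapping.keys u \<subseteq> X}"
  unfolding free.subspace_def mem_Collect_eq
  by (simp add: order_trans[OF keys_add] order_trans[OF keys_free_scale])

text \<open>The linear extension of \<beta> from basis vectors: the sum that
  \<open>tensor_lift\<close> evaluates at its representative, and for \<beta> = \<open>id\<close>
  the evaluation of a formal combination.\<close>

definition lincomb :: "('k::field, 'w, 'l) module_scheme \<Rightarrow> ('x \<Rightarrow> 'w) \<Rightarrow> ('x \<Rightarrow>\<^sub>0 'k) \<Rightarrow> 'w" where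
  "lincomb W \<beta> u = (\<Oplus>\<^bsub>W\<^esub>p \<in> Poly_Mapping.keys u. Poly_Mapping.lookup u p \<odot>\<^bsub>W\<^esub> \<beta> p)"

context
  fixes W :: "('k::field, 'w, 'l) module_scheme" and X :: "'x set" and \<beta> :: "'x \<Rightarrow> 'w"
  assumes W: "vspace W" and \<beta>: "\<And>p. p \<in> X \<Longrightarrow> \<beta> p \<in> carrier W"
begin

interpretation W: Module.module field_ring W by (rule W)

text \<open>Additivity compares u, v and u + v, which have different supports, so the sums must run
  over a common set; off the support the summands are zero.\<close>

lemma lincomb_superset:
  assumes "finite S" "Poly_Mapping.keys u \<subseteq> S" "S \<subseteq> X"
  shows "lincomb W \<beta> u = (\<Oplus>\<^bsub>W\<^esub>p \<in> S. Poly_Mapping.lookup u p \<odot>\<^bsub>W\<^esub> \<beta> p)"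
  unfolding lincomb_def
proof (rule W.add.finprod_mono_neutral_cong_left)
  show "\<And>p. p \<in> S - Poly_Mapping.keys u \<Longrightarrow> Poly_Mapping.lookup u p \<odot>\<^bsub>W\<^esub> \<beta> p = \<zero>\<^bsub>W\<^esub>"
    using assms \<beta> W by (auto simp: in_keys_iff vs_smult_zero)
qed (use assms \<beta> W in auto)

lemma lincomb_hom: "lincomb W \<beta> \<in> mod_hom (free_module X) W"
proof (rule mod_homI)
  fix u :: "'x \<Rightarrow>\<^sub>0 'k" assume u: "u \<in> carrier (free_module X)"
  then show "lincomb W \<beta> u \<in> carrier W"
    unfolding lincomb_def using W \<beta> by (intro vs_closed) auto
  fix c :: 'k
  have "lincomb W \<beta> (free_scale c u) =
      (\<Oplus>\<^bsub>W\<^esub>p \<in> Poly_Mapping.keys u. Poly_Mapping.lookup (free_scale c u) p \<odot>\<^bsub>W\<^esub> \<beta> p)"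
    using u keys_free_scale[of c u] by (intro lincomb_superset) auto
  also have "\<dots> = (\<Oplus>\<^bsub>W\<^esub>p \<in> Poly_Mapping.keys u. c \<odot>\<^bsub>W\<^esub> (Poly_Mapping.lookup u p \<odot>\<^bsub>W\<^esub> \<beta> p))"
    using u W \<beta> W.smult_assoc1 by (intro W.finsum_cong') auto
  also have "\<dots> = c \<odot>\<^bsub>W\<^esub> lincomb W \<beta> u"
    unfolding lincomb_def using u W \<beta> by (intro W.finsum_smult_ldistr[symmetric]) auto
  finally show "lincomb W \<beta> (c \<odot>\<^bsub>free_module X\<^esub> u) = c \<odot>\<^bsub>W\<^esub> lincomb W \<beta> u" by simp
next
  fix u v :: "'x \<Rightarrow>\<^sub>0 'k" assume uv: "u \<in> carrier (free_module X)" "v \<in> carrier (free_module X)"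
  define S where "S = Poly_Mapping.keys u \<union> Poly_Mapping.keys v"
  have S: "finite S" "S \<subseteq> X" "Poly_Mapping.keys u \<subseteq> S" "Poly_Mapping.keys v \<subseteq> S"
    "Poly_Mapping.keys (u + v) \<subseteq> S"
    using uv keys_add[of u v] by (auto simp: S_def)
  have \<beta>S: "\<beta> p \<in> carrier W" if "p \<in> S" for p using that S \<beta> by auto
  have "lincomb W \<beta> (u + v) =
    (\<Oplus>\<^bsub>W\<^esub>p \<in> S. Poly_Mapping.lookup u p \<odot>\<^bsub>W\<^esub> \<beta> p \<oplus>\<^bsub>W\<^esub> Poly_Mapping.lookup v p \<odot>\<^bsub>W\<^esub> \<beta> p)"
    unfolding lincomb_superset[OF S(1,5,2)]
    using W \<beta>S W.smult_l_distr by (intro W.finsum_cong') (auto simp: lookup_add)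
  also have "\<dots> = lincomb W \<beta> u \<oplus>\<^bsub>W\<^esub> lincomb W \<beta> v"
    unfolding lincomb_superset[OF S(1,3,2)] lincomb_superset[OF S(1,4,2)]
    using W \<beta>S by (intro W.finsum_addf) auto
  finally show "lincomb W \<beta> (u \<oplus>\<^bsub>free_module X\<^esub> v) = lincomb W \<beta> u \<oplus>\<^bsub>W\<^esub> lincomb W \<beta> v"
    by simp
qed

lemma lincomb_basis_vector: "p \<in> X \<Longrightarrow> lincomb W \<beta> (basis_vector p) = \<beta> p"
  using lincomb_superset[of "{p}" "basis_vector p"] W \<beta> by (simp add: W.add.finprod_singleton_swap vs_one_smult)

text \<open>Stated as a subspace of the whole type, so that choice of bases and minimality of spans
  apply: the first is used for the embedding below, the second for the relators of the tensor
  product.\<close>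

lemma lincomb_kernel: "free.subspace {u. Poly_Mapping.keys u \<subseteq> X \<and> lincomb W \<beta> u = \<zero>\<^bsub>W\<^esub>}"
proof -
  have "lincomb W \<beta> 0 = \<zero>\<^bsub>W\<^esub>" by (simp add: lincomb_def)
  moreover have "lincomb W \<beta> (u + v) = lincomb W \<beta> u \<oplus>\<^bsub>W\<^esub> lincomb W \<beta> v"
    if "Poly_Mapping.keys u \<subseteq> X" "Poly_Mapping.keys v \<subseteq> X" for u v :: "'x \<Rightarrow>\<^sub>0 'k"
    using mod_hom_add[OF lincomb_hom] that by simp
  moreover have "lincomb W \<beta> (free_scale c u) = c \<odot>\<^bsub>W\<^esub> lincomb W \<beta> u"
    if "Poly_Mapping.keys u \<subseteq> X" for u and c :: 'k
    using mod_hom_smult[OF lincomb_hom] that by simp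
  ultimately show ?thesis
    using W subspace_free_module[of X] unfolding free.subspace_def mem_Collect_eq
    by (simp add: vs_zero_smult) blast
qed

end

lemma lincomb_diff:
  assumes "vspace W" "\<And>p. p \<in> X \<Longrightarrow> \<beta> p \<in> carrier W"
    and "Poly_Mapping.keys u \<subseteq> X" "Poly_Mapping.keys v \<subseteq> X"
  shows "lincomb W \<beta> (u - v) = \<zero>\<^bsub>W\<^esub> \<longleftrightarrow> lincomb W \<beta> u = lincomb W \<beta> v"
proof -
  interpret W: Module.module field_ring W by fact
  have uv: "Poly_Mapping.keys (u - v) \<subseteq> X" using keys_diff[of u v] assms by blast
  note h = lincomb_hom[of W X \<beta>, OF assms(1,2)]
  have eq: "lincomb W \<beta> u = lincomb W \<beta> (u - v) \<oplus>\<^bsub>W\<^esub> lincomb W \<beta> v"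
    using mod_hom_add[OF h, of "u - v" v] uv assms by simp
  have "lincomb W \<beta> (u - v) \<in> carrier W" "lincomb W \<beta> v \<in> carrier W"
    using mod_hom_closed[OF h] uv assms by auto
  then show ?thesis by (metis eq W.add.r_cancel_one' W.add.l_one)
qed

text \<open>
  Complementing the kernel of \<open>('a \<Rightarrow>\<^sub>0 'k) \<rightarrow> M\<close> inside the type \<open>'a \<Rightarrow>\<^sub>0 'k\<close> embeds a vector space on a
  carrier set into a type, where identities are decided by the simplifier without side conditions.
\<close>

lemma vspace_embedding:
  fixes M :: "('k::field, 'a, 'm) module_scheme"
  assumes M: "vspace M"
  shows "\<exists>\<iota> :: 'a \<Rightarrow> ('a \<Rightarrow>\<^sub>0 'k). inj_on \<iota> (carrier M) \<and>
    (\<forall>x \<in> carrier M. \<forall>y \<in> carrier M. \<iota> (x \<oplus>\<^bsub>M\<^esub> y) = \<iota> x + \<iota> y) \<and>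
    (\<forall>c. \<forall>x \<in> carrier M. \<iota> (c \<odot>\<^bsub>M\<^esub> x) = free_scale c (\<iota> x))"
proof -
  interpret M: Module.module field_ring M by (rule M)
  interpret VP: vector_space_pair "free_scale :: 'k \<Rightarrow> ('a \<Rightarrow>\<^sub>0 'k) \<Rightarrow> _" "free_scale :: 'k \<Rightarrow> ('a \<Rightarrow>\<^sub>0 'k) \<Rightarrow> _"
    by unfold_locales
  \<comment> \<open>K is the kernel of evaluation of formal combinations in M. Combinations on the
    carrier modulo K are a copy of M, which a projection with kernel K realizes inside the
    type.\<close>
  define K where "K = {u. Poly_Mapping.keys u \<subseteq> carrier M \<and> lincomb M id u = \<zero>\<^bsub>M\<^esub>}"
  have K: "free.subspace K" unfolding K_def by (rule lincomb_kernel[OF M]) simp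
  obtain B where B: "B \<subseteq> K" "free.independent B" "K \<subseteq> free.span B"
    using free.maximal_independent_subset by blast
  have span_B: "free.span B = K" using B K free.span_minimal by blast
  define C where "C = free.extend_basis B"
  have C: "B \<subseteq> C" "free.independent C" "free.span C = UNIV"
    using B by (simp_all add: C_def free.extend_basis_superset free.independent_extend_basis)
  \<comment> \<open>\<open>g\<close> kills the basis of K and fixes the vectors that extend it to a
    basis of the whole type.\<close>
  define g where "g = VP.construct C (\<lambda>b. if b \<in> B then 0 else b)"
  have g: "Vector_Spaces.linear free_scale free_scale g"
    unfolding g_def by (rule VP.linear_construct[OF C(2)])
  have gC: "g b = (if b \<in> B then 0 else b)" if "b \<in> C" for b
    unfolding g_def by (rule VP.construct_basis[OF C(2) that])
  interpret g: Vector_Spaces.linear free_scale free_scale g by (rule g)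
  have gK: "g u = 0" if "u \<in> K" for u
  proof -
    have "u \<in> free.span B" using that span_B by simp
    then show ?thesis
    proof (induction rule: free.span_induct_alt)
      case (step c x y)
      then show ?case using gC C by (auto simp: g.add g.scale)
    qed simp
  qed
  \<comment> \<open>\<open>g\<close> moves every vector by an element of K, so whatever it kills
    lies in K; this gives injectivity.\<close>
  have "u - g u \<in> K" for u
  proof -
    have "u \<in> free.span C" using C by simp
    then show ?thesis
    proof (induction rule: free.span_induct_alt)
      case base
      show ?case using free.subspace_0[OF K] by simp
    next
      case (step c x y)
      have "x - g x \<in> K" using gC[OF step(1)] B free.subspace_0[OF K] by auto
      then have "free_scale c (x - g x) + (y - g y) \<in> K"
        using step(2) by (intro free.subspace_add[OF K] free.subspace_scale[OF K])
      then show ?case by (simp add: g.add g.scale free.scale_right_diff_distrib algebra_simps)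
    qed
  qed
  then have ker: "u \<in> K" if "g u = 0" for u using that by (metis diff_zero)
  have in_K: "basis_vector x - u \<in> K \<longleftrightarrow> x = lincomb M id u"
    if "x \<in> carrier M" "Poly_Mapping.keys u \<subseteq> carrier M" for x u
    using that keys_diff[of "basis_vector x" u] lincomb_diff[of M "carrier M" id "basis_vector x" u]
      lincomb_basis_vector[of M "carrier M" id x] M
    by (auto simp: K_def)
  note lc = lincomb_hom[of M "carrier M" id, OF M] lincomb_basis_vector[of M "carrier M" id, OF M]
  \<comment> \<open>Combinations with the same value in M differ by an element of K; additivity and
    homogeneity of the embedding are instances.\<close>
  have eq: "g (basis_vector x) = g u" if "x = lincomb M id u" "x \<in> carrier M"
    "Poly_Mapping.keys u \<subseteq> carrier M" for x u
    using gK[of "basis_vector x - u"] in_K that by (simp add: g.diff)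
  show ?thesis
  proof (intro exI[of _ "\<lambda>x. g (basis_vector x)"] conjI ballI allI)
    show "inj_on (\<lambda>x. g (basis_vector x)) (carrier M)"
    proof (rule inj_onI)
      fix x y assume xy: "x \<in> carrier M" "y \<in> carrier M" "g (basis_vector x) = g (basis_vector y)"
      then have "basis_vector x - basis_vector y \<in> K" by (intro ker) (simp add: g.diff)
      then show "x = y" using in_K[of x "basis_vector y"] lc xy by simp
    qed
  next
    fix x y assume xy: "x \<in> carrier M" "y \<in> carrier M"
    have "Poly_Mapping.keys (basis_vector x + basis_vector y :: 'a \<Rightarrow>\<^sub>0 'k) \<subseteq> carrier M"
      using keys_add[of "basis_vector x :: 'a \<Rightarrow>\<^sub>0 'k" "basis_vector y"] xy by auto
    moreover have "lincomb M id (basis_vector x + basis_vector y) = x \<oplus>\<^bsub>M\<^esub> y"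
      using mod_hom_add[OF lc(1), of "basis_vector x" "basis_vector y"] lc(2) xy by simp
    ultimately have "g (basis_vector (x \<oplus>\<^bsub>M\<^esub> y)) = g (basis_vector x + basis_vector y)"
      using xy M by (intro eq) auto
    then show "g (basis_vector (x \<oplus>\<^bsub>M\<^esub> y)) = g (basis_vector x) + g (basis_vector y)"
      by (simp add: g.add)
  next
    fix c :: 'k and x assume x: "x \<in> carrier M"
    have "Poly_Mapping.keys (free_scale c (basis_vector x)) \<subseteq> carrier M"
      using keys_free_scale[of c "basis_vector x"] x by auto
    moreover have "lincomb M id (free_scale c (basis_vector x)) = c \<odot>\<^bsub>M\<^esub> x"
      using mod_hom_smult[OF lc(1), of "basis_vector x" c] lc(2) x by simp
    ultimately have "g (basis_vector (c \<odot>\<^bsub>M\<^esub> x)) = g (free_scale c (basis_vector x))"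
      using x M by (intro eq) auto
    then show "g (basis_vector (c \<odot>\<^bsub>M\<^esub> x)) = free_scale c (g (basis_vector x))"
      by (simp add: g.scale)
  qed
qed

text \<open>A fixed choice among the embeddings just obtained; nothing is known about it outside the
  carrier.\<close>

definition emb :: "('k::field, 'a, 'm) module_scheme \<Rightarrow> 'a \<Rightarrow> ('a \<Rightarrow>\<^sub>0 'k)" where
  "emb M = (SOME \<iota>. inj_on \<iota> (carrier M) \<and>
    (\<forall>x \<in> carrier M. \<forall>y \<in> carrier M. \<iota> (x \<oplus>\<^bsub>M\<^esub> y) = \<iota> x + \<iota> y) \<and>
    (\<forall>c. \<forall>x \<in> carrier M. \<iota> (c \<odot>\<^bsub>M\<^esub> x) = free_scale c (\<iota> x)))"

context
  fixes M :: "('k::field, 'a, 'm) module_scheme"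
  assumes M: "vspace M"
begin

interpretation M: Module.module field_ring M by (rule M)

lemma emb_inject: "x \<in> carrier M \<Longrightarrow> y \<in> carrier M \<Longrightarrow> emb M x = emb M y \<longleftrightarrow> x = y"
  and emb_add: "x \<in> carrier M \<Longrightarrow> y \<in> carrier M \<Longrightarrow> emb M (x \<oplus>\<^bsub>M\<^esub> y) = emb M x + emb M y"
  and emb_smult: "x \<in> carrier M \<Longrightarrow> emb M (c \<odot>\<^bsub>M\<^esub> x) = free_scale c (emb M x)"
  using someI_ex[OF vspace_embedding[OF M], folded emb_def] by (auto dest: inj_onD)

lemma emb_zero: "emb M \<zero>\<^bsub>M\<^esub> = 0"
  using emb_smult[of "\<zero>\<^bsub>M\<^esub>" 0] vs_zero_smult[OF M, of 0] by simp

lemma emb_minus: "x \<in> carrier M \<Longrightarrow> emb M (\<ominus>\<^bsub>M\<^esub> x) = - emb M x"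
  using emb_add[of "\<ominus>\<^bsub>M\<^esub> x" x] emb_zero by (simp add: M.l_neg M eq_neg_iff_add_eq_0)

lemma emb_diff: "x \<in> carrier M \<Longrightarrow> y \<in> carrier M \<Longrightarrow> emb M (x \<ominus>\<^bsub>M\<^esub> y) = emb M x - emb M y"
  by (simp add: a_minus_def emb_add emb_minus M)

lemma emb_finsum:
  "finite I \<Longrightarrow> (\<And>i. i \<in> I \<Longrightarrow> f i \<in> carrier M) \<Longrightarrow> emb M (finsum M f I) = (\<Sum>i \<in> I. emb M (f i))"
  by (induction I rule: finite_induct) (simp_all add: emb_zero emb_add M Pi_def)

text \<open>The way in which identities in carrier sets are proved from here on: \<open>emb\<close>
  is pushed to the leaves, where normalization in a type decides, and membership is settled once for
  each side.\<close>

lemma vs_eqI: "emb M x = emb M y \<Longrightarrow> x \<in> carrier M \<Longrightarrow> y \<in> carrier M \<Longrightarrow> x = y"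
  using emb_inject by blast

end

lemmas emb_simps = emb_zero emb_add emb_smult emb_minus emb_diff

section \<open>Tensor products\<close>

text \<open>\<open>mod_hom\<close> speaks of sums and scalars, so the negative is read as
  multiplication by -1.\<close>

lemma mod_hom_minus:
  assumes "vspace M" "vspace N" "f \<in> mod_hom M N" "x \<in> carrier M"
  shows "f (\<ominus>\<^bsub>M\<^esub> x) = \<ominus>\<^bsub>N\<^esub> f x"
proof -
  have eq: "\<ominus>\<^bsub>M\<^esub> x = (- 1) \<odot>\<^bsub>M\<^esub> x" if "vspace M" "x \<in> carrier M"
    for M :: "('z::field, 'x, 'y) module_scheme" and x
    using that by (intro vs_eqI[OF that(1)]) (simp_all add: emb_simps)
  show ?thesis using assms by (simp add: eq mod_hom_smult mod_hom_closed)
qed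

lemma mod_hom_diff:
  assumes "vspace M" "vspace N" "f \<in> mod_hom M N" "x \<in> carrier M" "y \<in> carrier M"
  shows "f (x \<ominus>\<^bsub>M\<^esub> y) = f x \<ominus>\<^bsub>N\<^esub> f y"
  using assms by (simp add: a_minus_def mod_hom_add mod_hom_minus)

definition bilinear_on ::
    "('k::field, 'a, 'm) module_scheme \<Rightarrow> ('k, 'b, 'n) module_scheme \<Rightarrow> ('k, 'c, 'l) module_scheme \<Rightarrow>
     ('a \<Rightarrow> 'b \<Rightarrow> 'c) \<Rightarrow> bool" where
  "bilinear_on M N W \<beta> \<longleftrightarrow>
     (\<forall>x \<in> carrier M. \<beta> x \<in> mod_hom N W) \<and> (\<forall>y \<in> carrier N. (\<lambda>x. \<beta> x y) \<in> mod_hom M W)"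

lemma bilinear_onD:
  assumes "bilinear_on M N W \<beta>" "x \<in> carrier M" "y \<in> carrier N"
  shows "\<beta> x y \<in> carrier W"
    and "x' \<in> carrier M \<Longrightarrow> \<beta> (x \<oplus>\<^bsub>M\<^esub> x') y = \<beta> x y \<oplus>\<^bsub>W\<^esub> \<beta> x' y"
    and "y' \<in> carrier N \<Longrightarrow> \<beta> x (y \<oplus>\<^bsub>N\<^esub> y') = \<beta> x y \<oplus>\<^bsub>W\<^esub> \<beta> x y'"
    and "\<beta> (c \<odot>\<^bsub>M\<^esub> x) y = c \<odot>\<^bsub>W\<^esub> \<beta> x y"
    and "\<beta> x (c \<odot>\<^bsub>N\<^esub> y) = c \<odot>\<^bsub>W\<^esub> \<beta> x y"
  using assms by (auto simp: bilinear_on_def mod_hom_def Pi_iff)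

lemma bilinear_onI:
  assumes "\<And>x y. x \<in> carrier M \<Longrightarrow> y \<in> carrier N \<Longrightarrow> \<beta> x y \<in> carrier W"
    and "\<And>x x' y. x \<in> carrier M \<Longrightarrow> x' \<in> carrier M \<Longrightarrow> y \<in> carrier N \<Longrightarrow>
      \<beta> (x \<oplus>\<^bsub>M\<^esub> x') y = \<beta> x y \<oplus>\<^bsub>W\<^esub> \<beta> x' y"
    and "\<And>x y y'. x \<in> carrier M \<Longrightarrow> y \<in> carrier N \<Longrightarrow> y' \<in> carrier N \<Longrightarrow>
      \<beta> x (y \<oplus>\<^bsub>N\<^esub> y') = \<beta> x y \<oplus>\<^bsub>W\<^esub> \<beta> x y'"
    and "\<And>c x y. x \<in> carrier M \<Longrightarrow> y \<in> carrier N \<Longrightarrow> \<beta> (c \<odot>\<^bsub>M\<^esub> x) y = c \<odot>\<^bsub>W\<^esub> \<beta> x y"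
    and "\<And>c x y. x \<in> carrier M \<Longrightarrow> y \<in> carrier N \<Longrightarrow> \<beta> x (c \<odot>\<^bsub>N\<^esub> y) = c \<odot>\<^bsub>W\<^esub> \<beta> x y"
  shows "bilinear_on M N W \<beta>"
  using assms by (auto simp: bilinear_on_def mod_hom_def)

definition free_tensor ::
    "('k::field, 'a, 'm) module_scheme \<Rightarrow> ('k, 'b, 'n) module_scheme \<Rightarrow> ('a \<times> 'b \<Rightarrow>\<^sub>0 'k) \<Rightarrow>
     ('a \<times> 'b \<Rightarrow>\<^sub>0 'k) set" where
  "free_tensor M N u = tensor_kernel M N +>\<^bsub>free_module (carrier M \<times> carrier N)\<^esub> u"

lemma pure_tensor_free: "pure_tensor M N x y = free_tensor M N (basis_vector (x, y))"
  by (simp add: pure_tensor_def free_tensor_def)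

lemma free_tensor_eq: "free_tensor M N u = (\<lambda>k. k + u) ` tensor_kernel M N"
  by (auto simp: free_tensor_def a_r_coset_def')

lemma subspace_tensor_kernel: "free.subspace (tensor_kernel M N)"
  by (simp add: tensor_kernel_def free.subspace_span)

lemma mem_free_tensor: "v \<in> free_tensor M N u \<longleftrightarrow> v - u \<in> tensor_kernel M N"
  by (force simp: free_tensor_eq image_iff algebra_simps)

lemma free_tensor_eq_iff: "free_tensor M N u = free_tensor M N v \<longleftrightarrow> u - v \<in> tensor_kernel M N"
proof
  assume "free_tensor M N u = free_tensor M N v"
  moreover have "u \<in> free_tensor M N u"
    by (simp add: mem_free_tensor free.subspace_0[OF subspace_tensor_kernel])
  ultimately show "u - v \<in> tensor_kernel M N" by (simp add: mem_free_tensor)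
next
  note K = subspace_tensor_kernel[of M N]
  assume uv: "u - v \<in> tensor_kernel M N"
  have "w - u \<in> tensor_kernel M N \<longleftrightarrow> w - v \<in> tensor_kernel M N" for w
    using free.subspace_add[OF K uv, of "w - u"] free.subspace_diff[OF K, of "w - v" "u - v"] uv
    by (auto simp: algebra_simps)
  then show "free_tensor M N u = free_tensor M N v" by (auto simp: mem_free_tensor)
qed

context
  fixes M :: "('k::field, 'a, 'm) module_scheme" and N :: "('k, 'b, 'n) module_scheme"
  assumes M: "vspace M" and N: "vspace N"
begin

lemma carrier_tensor: "carrier (tensor M N) = free_tensor M N ` {u. Poly_Mapping.keys u \<subseteq> carrier M \<times> carrier N}"
  by (auto simp: tensor_def quotient_module_def free_tensor_def A_RCOSETS_def')

lemma free_tensor_closed: "Poly_Mapping.keys u \<subseteq> carrier M \<times> carrier N \<Longrightarrow> free_tensor M N u \<in> carrier (tensor M N)"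
  by (simp add: carrier_tensor)

lemma zero_tensor: "\<zero>\<^bsub>tensor M N\<^esub> = free_tensor M N 0"
  by (simp add: tensor_def quotient_module_def free_tensor_eq)

lemma add_tensor:
  "free_tensor M N u \<oplus>\<^bsub>tensor M N\<^esub> free_tensor M N v = free_tensor M N (u + v)"
proof -
  note K = subspace_tensor_kernel[of M N]
  have "\<exists>h \<in> tensor_kernel M N. \<exists>k \<in> tensor_kernel M N. w = h + u + (k + v)"
    if "w - (u + v) \<in> tensor_kernel M N" for w
    using that free.subspace_0[OF K]
    by (intro bexI[of _ "w - (u + v)"] bexI[of _ 0]) (auto simp: algebra_simps)
  moreover have "(h + u + (k + v)) - (u + v) \<in> tensor_kernel M N"
    if "h \<in> tensor_kernel M N" "k \<in> tensor_kernel M N" for h k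
    using free.subspace_add[OF K that] by (simp add: algebra_simps)
  ultimately show ?thesis
    unfolding set_eq_iff mem_free_tensor
    by (auto simp: tensor_def quotient_module_def set_add_def' free_tensor_eq)
qed

lemma smult_tensor: "c \<odot>\<^bsub>tensor M N\<^esub> free_tensor M N u = free_tensor M N (free_scale c u)"
proof -
  note K = subspace_tensor_kernel[of M N]
  have "free_tensor M N (free_scale c v) = free_tensor M N (free_scale c u)"
    if "v \<in> free_tensor M N u" for v
    using free.subspace_scale[OF K, of "v - u" c] that
    by (simp add: free_tensor_eq_iff mem_free_tensor free.scale_right_diff_distrib)
  moreover have "u \<in> free_tensor M N u"
    by (simp add: mem_free_tensor free.subspace_0[OF K])
  ultimately have "(\<Union>v \<in> free_tensor M N u. free_tensor M N (free_scale c v)) = free_tensor M N (free_scale c u)"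
    by blast
  then show ?thesis by (simp add: tensor_def quotient_module_def free_tensor_def)
qed

lemma tensor_cases:
  assumes "U \<in> carrier (tensor M N)"
  obtains u where "U = free_tensor M N u" "Poly_Mapping.keys u \<subseteq> carrier M \<times> carrier N"
  using assms by (auto simp: carrier_tensor)

lemma vspace_tensor [simp]: "vspace (tensor M N)"
  by (rule vspaceI; (elim tensor_cases)?; hypsubst?)
    (simp_all add: zero_tensor add_tensor smult_tensor free_tensor_closed algebra_simps
      order_trans[OF keys_add] order_trans[OF keys_free_scale]
      free.scale_right_distrib free.scale_left_distrib)

lemma pure_tensor_closed [simp]:
  "x \<in> carrier M \<Longrightarrow> y \<in> carrier N \<Longrightarrow> pure_tensor M N x y \<in> carrier (tensor M N)"
  by (simp add: pure_tensor_free free_tensor_closed)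

text \<open>Modulo the kernel each identity is one of the four families of relators, up to
  rebracketing a difference of three basis vectors.\<close>

lemma pure_tensor_bilinear:
  "x \<in> carrier M \<Longrightarrow> x' \<in> carrier M \<Longrightarrow> y \<in> carrier N \<Longrightarrow>
    pure_tensor M N (x \<oplus>\<^bsub>M\<^esub> x') y = pure_tensor M N x y \<oplus>\<^bsub>tensor M N\<^esub> pure_tensor M N x' y"
  "x \<in> carrier M \<Longrightarrow> y \<in> carrier N \<Longrightarrow> y' \<in> carrier N \<Longrightarrow>
    pure_tensor M N x (y \<oplus>\<^bsub>N\<^esub> y') = pure_tensor M N x y \<oplus>\<^bsub>tensor M N\<^esub> pure_tensor M N x y'"
  "x \<in> carrier M \<Longrightarrow> y \<in> carrier N \<Longrightarrow>
    pure_tensor M N (c \<odot>\<^bsub>M\<^esub> x) y = c \<odot>\<^bsub>tensor M N\<^esub> pure_tensor M N x y"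
  "x \<in> carrier M \<Longrightarrow> y \<in> carrier N \<Longrightarrow>
    pure_tensor M N x (c \<odot>\<^bsub>N\<^esub> y) = c \<odot>\<^bsub>tensor M N\<^esub> pure_tensor M N x y"
  unfolding pure_tensor_free add_tensor smult_tensor free_tensor_eq_iff tensor_kernel_def
  by (rule free.span_base; unfold tensor_relators_def diff_diff_eq[symmetric]; blast)+

lemma pure_tensor_homs:
  "y \<in> carrier N \<Longrightarrow> (\<lambda>x. pure_tensor M N x y) \<in> mod_hom M (tensor M N)"
  "x \<in> carrier M \<Longrightarrow> pure_tensor M N x \<in> mod_hom N (tensor M N)"
  by (rule mod_homI; simp add: pure_tensor_bilinear)+

lemma pure_tensor_group:
  "y \<in> carrier N \<Longrightarrow> pure_tensor M N \<zero>\<^bsub>M\<^esub> y = \<zero>\<^bsub>tensor M N\<^esub>"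
  "x \<in> carrier M \<Longrightarrow> pure_tensor M N x \<zero>\<^bsub>N\<^esub> = \<zero>\<^bsub>tensor M N\<^esub>"
  "x \<in> carrier M \<Longrightarrow> y \<in> carrier N \<Longrightarrow> pure_tensor M N (\<ominus>\<^bsub>M\<^esub> x) y = \<ominus>\<^bsub>tensor M N\<^esub> pure_tensor M N x y"
  "x \<in> carrier M \<Longrightarrow> y \<in> carrier N \<Longrightarrow> pure_tensor M N x (\<ominus>\<^bsub>N\<^esub> y) = \<ominus>\<^bsub>tensor M N\<^esub> pure_tensor M N x y"
  "x \<in> carrier M \<Longrightarrow> x' \<in> carrier M \<Longrightarrow> y \<in> carrier N \<Longrightarrow>
    pure_tensor M N (x \<ominus>\<^bsub>M\<^esub> x') y = pure_tensor M N x y \<ominus>\<^bsub>tensor M N\<^esub> pure_tensor M N x' y"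
  "x \<in> carrier M \<Longrightarrow> y \<in> carrier N \<Longrightarrow> y' \<in> carrier N \<Longrightarrow>
    pure_tensor M N x (y \<ominus>\<^bsub>N\<^esub> y') = pure_tensor M N x y \<ominus>\<^bsub>tensor M N\<^esub> pure_tensor M N x y'"
  using mod_hom_zero[OF _ _ pure_tensor_homs(1)] mod_hom_zero[OF _ _ pure_tensor_homs(2)]
    mod_hom_minus[OF _ _ pure_tensor_homs(1)] mod_hom_minus[OF _ _ pure_tensor_homs(2)]
    mod_hom_diff[OF _ _ pure_tensor_homs(1)] mod_hom_diff[OF _ _ pure_tensor_homs(2)] M N
  by auto

lemma bilinear_pure_tensor: "bilinear_on M N (tensor M N) (pure_tensor M N)"
  by (rule bilinear_onI) (simp_all add: pure_tensor_bilinear)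

text \<open>Sums of pure tensors reach everything: a scalar is absorbed into the first factor, and
  the empty combination is the pure tensor of two zeros.\<close>

lemma tensor_induct [consumes 1, case_names pure add]:
  assumes "U \<in> carrier (tensor M N)"
    and pure: "\<And>x y. x \<in> carrier M \<Longrightarrow> y \<in> carrier N \<Longrightarrow> Q (pure_tensor M N x y)"
    and add: "\<And>U V. U \<in> carrier (tensor M N) \<Longrightarrow> V \<in> carrier (tensor M N) \<Longrightarrow> Q U \<Longrightarrow> Q V \<Longrightarrow>
      Q (U \<oplus>\<^bsub>tensor M N\<^esub> V)"
  shows "Q U"
proof -
  have "Poly_Mapping.keys u \<subseteq> carrier M \<times> carrier N \<longrightarrow> Q (free_tensor M N u)" for u
  proof (induction u rule: update_induct)
    case const
    have "Q (pure_tensor M N \<zero>\<^bsub>M\<^esub> \<zero>\<^bsub>N\<^esub>)" using M N pure by simp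
    moreover have "pure_tensor M N \<zero>\<^bsub>M\<^esub> \<zero>\<^bsub>N\<^esub> = free_tensor M N 0"
      using M N pure_tensor_bilinear(3)[of "\<zero>\<^bsub>M\<^esub>" "\<zero>\<^bsub>N\<^esub>" 0]
      by (simp add: vs_smult_zero vs_zero_smult flip: zero_tensor)
    ultimately show ?case by simp
  next
    case (update f a b)
    show ?case
    proof
      assume sub: "Poly_Mapping.keys (Poly_Mapping.update a b f) \<subseteq> carrier M \<times> carrier N"
      have keys: "Poly_Mapping.keys (Poly_Mapping.update a b f) = insert a (Poly_Mapping.keys f)"
        using update by (auto simp: in_keys_iff lookup_update split: if_splits)
      obtain x y where a: "a = (x, y)" "x \<in> carrier M" "y \<in> carrier N"
        using sub keys by (cases a) auto
      have split: "Poly_Mapping.update a b f = free_scale b (basis_vector a) + f"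
        using update(1) by (auto intro!: poly_mapping_eqI simp: lookup_update lookup_add lookup_single when_def in_keys_iff)
      have "free_tensor M N (free_scale b (basis_vector a)) = pure_tensor M N (b \<odot>\<^bsub>M\<^esub> x) y"
        using a pure_tensor_bilinear(3)[of x y b] by (simp add: pure_tensor_free smult_tensor)
      then have "Q (free_tensor M N (free_scale b (basis_vector a)) \<oplus>\<^bsub>tensor M N\<^esub> free_tensor M N f)"
        using update(3) sub keys a M by (intro add) (auto simp: pure free_tensor_closed)
      then show "Q (free_tensor M N (Poly_Mapping.update a b f))"
        by (simp add: split add_tensor)
    qed
  qed
  then show ?thesis using assms(1) by (auto elim: tensor_cases)
qed

text \<open>Independence of the chosen representative: the combinations sent to zero form a subspace
  that contains every relator, by bilinearity of \<beta>, and hence the tensor kernel.\<close>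

lemma tensor_lift_free_tensor:
  fixes W :: "('k, 'c, 'l) module_scheme"
  assumes W: "vspace W" and \<beta>: "bilinear_on M N W \<beta>" and u: "Poly_Mapping.keys u \<subseteq> carrier M \<times> carrier N"
  shows "tensor_lift M N W \<beta> (free_tensor M N u) = lincomb W (\<lambda>p. \<beta> (fst p) (snd p)) u"
proof -
  define b where "b = (\<lambda>p. \<beta> (fst p) (snd p))"
  have b: "p \<in> carrier M \<times> carrier N \<Longrightarrow> b p \<in> carrier W" for p
    using bilinear_onD(1)[OF \<beta>] by (auto simp: b_def)
  define Z where "Z = {u. Poly_Mapping.keys u \<subseteq> carrier M \<times> carrier N \<and> lincomb W b u = \<zero>\<^bsub>W\<^esub>}"
  have Z: "free.subspace Z" unfolding Z_def by (rule lincomb_kernel[where X="carrier M \<times> carrier N" and \<beta>=b, OF W b])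
  note hom = lincomb_hom[where X="carrier M \<times> carrier N" and \<beta>=b, OF W b]
  have add: "lincomb W b (v + w) = lincomb W b v \<oplus>\<^bsub>W\<^esub> lincomb W b w"
    if "Poly_Mapping.keys v \<subseteq> carrier M \<times> carrier N" "Poly_Mapping.keys w \<subseteq> carrier M \<times> carrier N" for v w
    using mod_hom_add[OF hom] that by simp
  have smult: "lincomb W b (free_scale c v) = c \<odot>\<^bsub>W\<^esub> lincomb W b v"
    if "Poly_Mapping.keys v \<subseteq> carrier M \<times> carrier N" for c v
    using mod_hom_smult[OF hom] that by simp
  have bv: "lincomb W b (basis_vector (x, y)) = \<beta> x y" if "x \<in> carrier M" "y \<in> carrier N" for x y
    using lincomb_basis_vector[where X="carrier M \<times> carrier N" and \<beta>=b, OF W b, where p="(x, y)"] that by (simp add: b_def)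
  have inZ: "v - w \<in> Z" if "Poly_Mapping.keys v \<subseteq> carrier M \<times> carrier N" "Poly_Mapping.keys w \<subseteq> carrier M \<times> carrier N"
    "lincomb W b v = lincomb W b w" for v w
    using lincomb_diff[where X="carrier M \<times> carrier N" and \<beta>=b, OF W b, where u=v and v=w] that order_trans[OF keys_diff[of v w]] by (auto simp: Z_def)
  have key: "Poly_Mapping.keys (basis_vector (x, y) :: 'a \<times> 'b \<Rightarrow>\<^sub>0 'k) \<subseteq> carrier M \<times> carrier N"
    if "x \<in> carrier M" "y \<in> carrier N" for x y
    using that by simp
  have key_add: "Poly_Mapping.keys (v + w) \<subseteq> carrier M \<times> carrier N"
    if "Poly_Mapping.keys v \<subseteq> carrier M \<times> carrier N" "Poly_Mapping.keys w \<subseteq> carrier M \<times> carrier N" for v w :: "'a \<times> 'b \<Rightarrow>\<^sub>0 'k"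
    using that by (simp add: order_trans[OF keys_add])
  have key_scale: "Poly_Mapping.keys (free_scale c v) \<subseteq> carrier M \<times> carrier N"
    if "Poly_Mapping.keys v \<subseteq> carrier M \<times> carrier N" for v :: "'a \<times> 'b \<Rightarrow>\<^sub>0 'k" and c
    using that by (simp add: order_trans[OF keys_free_scale])
  have \<beta>_add: "\<beta> (x \<oplus>\<^bsub>M\<^esub> x') y = \<beta> x y \<oplus>\<^bsub>W\<^esub> \<beta> x' y" "\<beta> (c \<odot>\<^bsub>M\<^esub> x) y = c \<odot>\<^bsub>W\<^esub> \<beta> x y"
    "\<beta> x (y \<oplus>\<^bsub>N\<^esub> y') = \<beta> x y \<oplus>\<^bsub>W\<^esub> \<beta> x y'" "\<beta> x (c \<odot>\<^bsub>N\<^esub> y) = c \<odot>\<^bsub>W\<^esub> \<beta> x y"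
    if "x \<in> carrier M" "x' \<in> carrier M" "y \<in> carrier N" "y' \<in> carrier N" for x x' y y' c
    using bilinear_onD[OF \<beta>] that by auto
  have "tensor_relators M N \<subseteq> Z"
    unfolding tensor_relators_def
    by (intro Un_least subsetI; elim CollectE exE conjE; hypsubst;
        (subst diff_diff_eq)?; rule inZ)
      (simp_all add: M N add smult bv \<beta>_add key_add key_scale)
  then have KZ: "tensor_kernel M N \<subseteq> Z"
    unfolding tensor_kernel_def using Z by (rule free.span_minimal)
  define v where "v = (SOME v. v \<in> free_tensor M N u)"
  have "v \<in> free_tensor M N u"
    unfolding v_def by (rule someI[of _ u])
      (simp add: mem_free_tensor free.subspace_0[OF subspace_tensor_kernel])
  then have vu: "v - u \<in> Z" using KZ by (auto simp: mem_free_tensor)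
  then have "lincomb W b ((v - u) + u) = lincomb W b (v - u) \<oplus>\<^bsub>W\<^esub> lincomb W b u"
    using u by (intro add) (auto simp: Z_def)
  also have "\<dots> = lincomb W b u"
  proof -
    interpret W: Module.module field_ring W by (rule W)
    show ?thesis using vu mod_hom_closed[OF lincomb_hom[where X="carrier M \<times> carrier N" and \<beta>=b, OF W b]] u by (simp add: Z_def)
  qed
  finally show ?thesis
    by (simp add: tensor_lift_def Let_def v_def[symmetric] lincomb_def b_def)
qed

lemma tensor_lift_hom:
  fixes W :: "('k, 'c, 'l) module_scheme"
  assumes W: "vspace W" and \<beta>: "bilinear_on M N W \<beta>"
  shows "tensor_lift M N W \<beta> \<in> mod_hom (tensor M N) W"
proof -
  have b: "p \<in> carrier M \<times> carrier N \<Longrightarrow> \<beta> (fst p) (snd p) \<in> carrier W" for p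
    using bilinear_onD(1)[OF \<beta>] by auto
  note hom = lincomb_hom[where X="carrier M \<times> carrier N" and \<beta>="\<lambda>p. \<beta> (fst p) (snd p)", OF W b]
  show ?thesis
  proof (rule mod_homI; elim tensor_cases; hypsubst)
  qed (use mod_hom_add[OF hom] mod_hom_smult[OF hom] mod_hom_closed[OF hom] in
      \<open>simp_all add: add_tensor smult_tensor tensor_lift_free_tensor[OF W \<beta>]
        order_trans[OF keys_add] order_trans[OF keys_free_scale]\<close>)
qed

lemma tensor_lift_pure:
  fixes W :: "('k, 'c, 'l) module_scheme"
  assumes W: "vspace W" and \<beta>: "bilinear_on M N W \<beta>" and "x \<in> carrier M" "y \<in> carrier N"
  shows "tensor_lift M N W \<beta> (pure_tensor M N x y) = \<beta> x y"
proof -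
  have b: "p \<in> carrier M \<times> carrier N \<Longrightarrow> \<beta> (fst p) (snd p) \<in> carrier W" for p
    using bilinear_onD(1)[OF \<beta>] by auto
  show ?thesis
    using lincomb_basis_vector[where X="carrier M \<times> carrier N" and \<beta>="\<lambda>p. \<beta> (fst p) (snd p)", OF W b, where p="(x, y)"] assms
    by (simp add: pure_tensor_free tensor_lift_free_tensor[OF W \<beta>])
qed

lemma tensor_hom_eqI:
  assumes "f \<in> mod_hom (tensor M N) W" "g \<in> mod_hom (tensor M N) W"
    and "\<And>x y. x \<in> carrier M \<Longrightarrow> y \<in> carrier N \<Longrightarrow> f (pure_tensor M N x y) = g (pure_tensor M N x y)"
    and "U \<in> carrier (tensor M N)"
  shows "f U = g U"
  using assms(4) by (induction rule: tensor_induct) 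
    (simp_all add: assms(3) mod_hom_add[OF assms(1)] mod_hom_add[OF assms(2)])

end

section \<open>The adjoint action on the tensor square\<close>

context
  fixes L :: "('k::field, 'a, 'm) lie_scheme"
  assumes L: "lie_algebra L"
begin

lemma lie_vspace: "vspace L"
  using L by (simp add: lie_algebra_def)

interpretation L: Module.module field_ring L by (rule lie_vspace)

lemma bracket_homs:
  "x \<in> carrier L \<Longrightarrow> bracket L x \<in> mod_hom L L"
  "y \<in> carrier L \<Longrightarrow> (\<lambda>x. bracket L x y) \<in> mod_hom L L"
  using L by (simp_all add: lie_algebra_def)

lemma bracket_closed: "x \<in> carrier L \<Longrightarrow> y \<in> carrier L \<Longrightarrow> bracket L x y \<in> carrier L"
  by (rule mod_hom_closed[OF bracket_homs(1)])

lemma bracket_bilinear: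
  "x \<in> carrier L \<Longrightarrow> x' \<in> carrier L \<Longrightarrow> y \<in> carrier L \<Longrightarrow>
    bracket L (x \<oplus>\<^bsub>L\<^esub> x') y = bracket L x y \<oplus>\<^bsub>L\<^esub> bracket L x' y"
  "x \<in> carrier L \<Longrightarrow> y \<in> carrier L \<Longrightarrow> y' \<in> carrier L \<Longrightarrow>
    bracket L x (y \<oplus>\<^bsub>L\<^esub> y') = bracket L x y \<oplus>\<^bsub>L\<^esub> bracket L x y'"
  "x \<in> carrier L \<Longrightarrow> y \<in> carrier L \<Longrightarrow> bracket L (c \<odot>\<^bsub>L\<^esub> x) y = c \<odot>\<^bsub>L\<^esub> bracket L x y"
  "x \<in> carrier L \<Longrightarrow> y \<in> carrier L \<Longrightarrow> bracket L x (c \<odot>\<^bsub>L\<^esub> y) = c \<odot>\<^bsub>L\<^esub> bracket L x y"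
  using mod_hom_add[OF bracket_homs(1)] mod_hom_add[OF bracket_homs(2)]
    mod_hom_smult[OF bracket_homs(1)] mod_hom_smult[OF bracket_homs(2)] by auto

lemma bracket_anti:
  assumes "x \<in> carrier L" "y \<in> carrier L"
  shows "bracket L x y = \<ominus>\<^bsub>L\<^esub> bracket L y x"
proof -
  have self: "bracket L z z = \<zero>\<^bsub>L\<^esub>" if "z \<in> carrier L" for z
    using L that by (simp add: lie_algebra_def)
  have "0 = emb L (bracket L (x \<oplus>\<^bsub>L\<^esub> y) (x \<oplus>\<^bsub>L\<^esub> y))"
    using assms by (simp add: self lie_vspace emb_zero)
  also have "\<dots> = emb L (bracket L y x) + emb L (bracket L x y)"
    using assms by (subst bracket_bilinear)
      (simp_all add: bracket_bilinear bracket_closed emb_simps lie_vspace self)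
  finally have "emb L (bracket L y x) + emb L (bracket L x y) = 0" by simp
  then show ?thesis
    using assms by (intro vs_eqI[OF lie_vspace])
      (simp_all add: bracket_closed emb_minus lie_vspace eq_neg_iff_add_eq_0 add.commute)
qed

text \<open>The Jacobi identity oriented as a rewrite rule that removes brackets nested on the left:
  ad of a bracket is the commutator of the ads.\<close>

lemma bracket_jacobi:
  assumes "x \<in> carrier L" "y \<in> carrier L" "z \<in> carrier L"
  shows "bracket L (bracket L x y) z =
    bracket L x (bracket L y z) \<ominus>\<^bsub>L\<^esub> bracket L y (bracket L x z)"
proof -
  have *: "bracket L y (bracket L z x) = \<ominus>\<^bsub>L\<^esub> bracket L y (bracket L x z)"
    using bracket_anti[of z x] mod_hom_minus[OF lie_vspace lie_vspace bracket_homs(1)] assms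
    by (simp add: bracket_closed)
  have "bracket L x (bracket L y z) \<oplus>\<^bsub>L\<^esub> bracket L y (bracket L z x) \<oplus>\<^bsub>L\<^esub>
      bracket L z (bracket L x y) = \<zero>\<^bsub>L\<^esub>"
    using L assms by (simp add: lie_algebra_def)
  then have "emb L (bracket L x (bracket L y z) \<oplus>\<^bsub>L\<^esub> (\<ominus>\<^bsub>L\<^esub> bracket L y (bracket L x z)) \<oplus>\<^bsub>L\<^esub>
      (\<ominus>\<^bsub>L\<^esub> bracket L (bracket L x y) z)) = 0"
    using * bracket_anti[of z "bracket L x y"] assms by (simp add: bracket_closed lie_vspace emb_zero)
  then show ?thesis
    using assms by (intro vs_eqI[OF lie_vspace])
      (simp_all add: bracket_closed emb_simps lie_vspace algebra_simps)
qed

lemma vspace_tensor2: "vspace (tensor L L)"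
  by (simp add: lie_vspace)

lemmas tensor_rules = lie_vspace bracket_closed bracket_bilinear pure_tensor_bilinear pure_tensor_group

lemma tensor_ad_bilinear:
  "x \<in> carrier L \<Longrightarrow>
    bilinear_on L L (tensor L L) (\<lambda>a b. pure_tensor L L (bracket L x a) b \<oplus>\<^bsub>tensor L L\<^esub> pure_tensor L L a (bracket L x b))"
  by (rule bilinear_onI; (rule vs_eqI[OF vspace_tensor2])?)
    (simp_all add: tensor_rules emb_simps free.scale_right_distrib)

lemma tensor_ad_hom: "x \<in> carrier L \<Longrightarrow> tensor_ad L x \<in> mod_hom (tensor L L) (tensor L L)"
  unfolding tensor_ad_def
  by (rule tensor_lift_hom[OF lie_vspace lie_vspace vspace_tensor2 tensor_ad_bilinear])

lemma tensor_ad_pure: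
  "x \<in> carrier L \<Longrightarrow> a \<in> carrier L \<Longrightarrow> b \<in> carrier L \<Longrightarrow> tensor_ad L x (pure_tensor L L a b) =
    pure_tensor L L (bracket L x a) b \<oplus>\<^bsub>tensor L L\<^esub> pure_tensor L L a (bracket L x b)"
  unfolding tensor_ad_def
  by (rule tensor_lift_pure[OF lie_vspace lie_vspace vspace_tensor2 tensor_ad_bilinear])

lemma tensor_ad_closed:
  "x \<in> carrier L \<Longrightarrow> U \<in> carrier (tensor L L) \<Longrightarrow> tensor_ad L x U \<in> carrier (tensor L L)"
  by (rule mod_hom_closed[OF tensor_ad_hom])

lemma tensor_ad_linear:
  assumes "x \<in> carrier L" "U \<in> carrier (tensor L L)"
  shows "V \<in> carrier (tensor L L) \<Longrightarrow> tensor_ad L x (U \<oplus>\<^bsub>tensor L L\<^esub> V) = tensor_ad L x U \<oplus>\<^bsub>tensor L L\<^esub> tensor_ad L x V"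
    and "V \<in> carrier (tensor L L) \<Longrightarrow> tensor_ad L x (U \<ominus>\<^bsub>tensor L L\<^esub> V) = tensor_ad L x U \<ominus>\<^bsub>tensor L L\<^esub> tensor_ad L x V"
    and "tensor_ad L x (\<ominus>\<^bsub>tensor L L\<^esub> U) = \<ominus>\<^bsub>tensor L L\<^esub> tensor_ad L x U"
    and "tensor_ad L x (c \<odot>\<^bsub>tensor L L\<^esub> U) = c \<odot>\<^bsub>tensor L L\<^esub> tensor_ad L x U"
  using mod_hom_add[OF tensor_ad_hom] mod_hom_diff[OF vspace_tensor2 vspace_tensor2 tensor_ad_hom]
    mod_hom_minus[OF vspace_tensor2 vspace_tensor2 tensor_ad_hom] mod_hom_smult[OF tensor_ad_hom] assms
  by auto

lemma tensor_ad_add_left: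
  assumes "U \<in> carrier (tensor L L)" "x \<in> carrier L" "y \<in> carrier L"
  shows "tensor_ad L (x \<oplus>\<^bsub>L\<^esub> y) U = tensor_ad L x U \<oplus>\<^bsub>tensor L L\<^esub> tensor_ad L y U"
  using assms(1)
  by (induction rule: tensor_induct[OF lie_vspace lie_vspace, consumes 1]; intro vs_eqI[OF vspace_tensor2])
    (simp_all add: assms tensor_rules tensor_ad_pure tensor_ad_linear tensor_ad_closed emb_simps)

lemma tensor_ad_smult_left:
  assumes "U \<in> carrier (tensor L L)" "x \<in> carrier L"
  shows "tensor_ad L (c \<odot>\<^bsub>L\<^esub> x) U = c \<odot>\<^bsub>tensor L L\<^esub> tensor_ad L x U"
  using assms(1)
  by (induction rule: tensor_induct[OF lie_vspace lie_vspace, consumes 1]; intro vs_eqI[OF vspace_tensor2])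
    (simp_all add: assms tensor_rules tensor_ad_pure tensor_ad_linear tensor_ad_closed emb_simps
      free.scale_right_distrib)

lemma tensor_ad_left_hom: "U \<in> carrier (tensor L L) \<Longrightarrow> (\<lambda>x. tensor_ad L x U) \<in> mod_hom L (tensor L L)"
  by (rule mod_homI) (simp_all add: tensor_ad_closed tensor_ad_add_left tensor_ad_smult_left)

lemma tensor_ad_zero_left: "U \<in> carrier (tensor L L) \<Longrightarrow> tensor_ad L \<zero>\<^bsub>L\<^esub> U = \<zero>\<^bsub>tensor L L\<^esub>"
  using mod_hom_zero[OF lie_vspace vspace_tensor2 tensor_ad_left_hom] .

text \<open>On a pure tensor the mixed terms, with x acting on one factor and y on the other, cancel
  in the commutator; \<open>bracket_jacobi\<close> in each factor does the rest.\<close>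

lemma tensor_ad_bracket:
  assumes "U \<in> carrier (tensor L L)" "x \<in> carrier L" "y \<in> carrier L"
  shows "tensor_ad L (bracket L x y) U =
    tensor_ad L x (tensor_ad L y U) \<ominus>\<^bsub>tensor L L\<^esub> tensor_ad L y (tensor_ad L x U)"
  using assms(1)
  by (induction rule: tensor_induct[OF lie_vspace lie_vspace, consumes 1]; intro vs_eqI[OF vspace_tensor2])
    (simp_all add: assms tensor_rules tensor_ad_pure tensor_ad_linear tensor_ad_closed emb_simps
      bracket_jacobi)

lemma wedge_closed:
  "x \<in> carrier L \<Longrightarrow> y \<in> carrier L \<Longrightarrow> wedge L x y \<in> carrier (tensor L L)"
  by (simp add: wedge_def lie_vspace)

lemma tensor_ad_wedge:
  assumes "x \<in> carrier L" "a \<in> carrier L" "b \<in> carrier L"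
  shows "tensor_ad L x (wedge L a b) = wedge L (bracket L x a) b \<oplus>\<^bsub>tensor L L\<^esub> wedge L a (bracket L x b)"
  by (rule vs_eqI[OF vspace_tensor2])
    (simp_all add: assms wedge_def tensor_rules tensor_ad_pure tensor_ad_linear tensor_ad_closed emb_simps)

lemma wedge_bilinear:
  assumes "x \<in> carrier L" "y \<in> carrier L"
  shows "x' \<in> carrier L \<Longrightarrow> wedge L (x \<oplus>\<^bsub>L\<^esub> x') y = wedge L x y \<oplus>\<^bsub>tensor L L\<^esub> wedge L x' y"
    and "y' \<in> carrier L \<Longrightarrow> wedge L x (y \<oplus>\<^bsub>L\<^esub> y') = wedge L x y \<oplus>\<^bsub>tensor L L\<^esub> wedge L x y'"
    and "wedge L (c \<odot>\<^bsub>L\<^esub> x) y = c \<odot>\<^bsub>tensor L L\<^esub> wedge L x y"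
    and "wedge L x (c \<odot>\<^bsub>L\<^esub> y) = c \<odot>\<^bsub>tensor L L\<^esub> wedge L x y"
  by (rule vs_eqI[OF vspace_tensor2];
      simp add: assms wedge_def tensor_rules emb_simps free.scale_right_diff_distrib)+

lemma wedge_anti:
  assumes "x \<in> carrier L" "y \<in> carrier L"
  shows "wedge L y x = \<ominus>\<^bsub>tensor L L\<^esub> wedge L x y"
  by (rule vs_eqI[OF vspace_tensor2]) (simp_all add: assms wedge_def lie_vspace emb_simps)

lemma tensor_flip_hom: "tensor_flip L \<in> mod_hom (tensor L L) (tensor L L)"
  and tensor_flip_pure: "x \<in> carrier L \<Longrightarrow> y \<in> carrier L \<Longrightarrow>
    tensor_flip L (pure_tensor L L x y) = pure_tensor L L y x"
proof -
  have b: "bilinear_on L L (tensor L L) (\<lambda>a b. pure_tensor L L b a)"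
    by (rule bilinear_onI) (simp_all add: tensor_rules)
  show "tensor_flip L \<in> mod_hom (tensor L L) (tensor L L)"
    unfolding tensor_flip_def by (rule tensor_lift_hom[OF lie_vspace lie_vspace vspace_tensor2 b])
  show "x \<in> carrier L \<Longrightarrow> y \<in> carrier L \<Longrightarrow> tensor_flip L (pure_tensor L L x y) = pure_tensor L L y x"
    unfolding tensor_flip_def by (rule tensor_lift_pure[OF lie_vspace lie_vspace vspace_tensor2 b])
qed

text \<open>Given by wedges and sums, and not by a condition on the flip, to allow induction down to
  wedges. A scalar can be moved into a wedge, so closure under sums already yields a
  subspace.\<close>

inductive_set alternating :: "('a \<times> 'a \<Rightarrow>\<^sub>0 'k) set set" where
  wedge: "x \<in> carrier L \<Longrightarrow> y \<in> carrier L \<Longrightarrow> wedge L x y \<in> alternating"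
| add: "U \<in> alternating \<Longrightarrow> V \<in> alternating \<Longrightarrow> U \<oplus>\<^bsub>tensor L L\<^esub> V \<in> alternating"

lemma alternating_closed: "U \<in> alternating \<Longrightarrow> U \<in> carrier (tensor L L)"
  by (induction rule: alternating.induct) (simp_all add: wedge_closed vspace_tensor2)

lemma alternating_smult: "U \<in> alternating \<Longrightarrow> c \<odot>\<^bsub>tensor L L\<^esub> U \<in> alternating"
proof (induction rule: alternating.induct)
  case (wedge x y)
  then show ?case using alternating.wedge[of "c \<odot>\<^bsub>L\<^esub> x" y] by (simp add: wedge_bilinear lie_vspace)
next
  case (add U V)
  interpret T: Module.module field_ring "tensor L L" by (rule vspace_tensor2)
  show ?case
    using add alternating.add T.smult_r_distr[of c U V] by (simp add: alternating_closed)
qed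

lemma alternating_zero: "\<zero>\<^bsub>tensor L L\<^esub> \<in> alternating"
  using alternating_smult[OF alternating.wedge[of "\<zero>\<^bsub>L\<^esub>" "\<zero>\<^bsub>L\<^esub>"], of 0]
  by (simp add: lie_vspace vs_smult_zero wedge_closed vspace_tensor2)

lemma alternating_diff:
  assumes "U \<in> alternating" "V \<in> alternating"
  shows "U \<ominus>\<^bsub>tensor L L\<^esub> V \<in> alternating"
proof -
  have "U \<ominus>\<^bsub>tensor L L\<^esub> V = U \<oplus>\<^bsub>tensor L L\<^esub> (- 1) \<odot>\<^bsub>tensor L L\<^esub> V"
    using assms by (intro vs_eqI[OF vspace_tensor2]) (simp_all add: alternating_closed vspace_tensor2 emb_simps)
  then show ?thesis using assms by (simp add: alternating.add alternating_smult)
qed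

lemma alternating_ad: "U \<in> alternating \<Longrightarrow> x \<in> carrier L \<Longrightarrow> tensor_ad L x U \<in> alternating"
  by (induction rule: alternating.induct)
    (simp_all add: tensor_ad_wedge tensor_ad_linear alternating_closed alternating.intros bracket_closed)

lemma alternating_flip: "U \<in> alternating \<Longrightarrow> tensor_flip L U = \<ominus>\<^bsub>tensor L L\<^esub> U"
proof (induction rule: alternating.induct)
  case (wedge x y)
  then show ?case
    using mod_hom_diff[OF vspace_tensor2 vspace_tensor2 tensor_flip_hom,
        of "pure_tensor L L x y" "pure_tensor L L y x"]
    by (intro vs_eqI[OF vspace_tensor2]) (simp_all add: wedge_def lie_vspace tensor_flip_pure emb_simps)
next
  case (add U V)
  then show ?case
    using mod_hom_add[OF tensor_flip_hom, of U V]
    by (intro vs_eqI[OF vspace_tensor2]) (simp_all add: alternating_closed vspace_tensor2 emb_simps)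
qed

end

section \<open>The co-Jacobi identity\<close>

lemma tensor_ad_zero:
  assumes "lie_algebra L" "x \<in> carrier L"
  shows "tensor_ad L x \<zero>\<^bsub>tensor L L\<^esub> = \<zero>\<^bsub>tensor L L\<^esub>"
  by (rule mod_hom_zero[OF vspace_tensor2 vspace_tensor2 tensor_ad_hom]; rule assms)

context
  fixes L :: "('k::field, 'a, 'm) lie_scheme"
  assumes L: "lie_algebra L"
begin

lemma vspace_tensor3: "vspace (tensor3 L)"
  by (simp add: lie_vspace L vspace_tensor2)

lemmas tensor3_rules = tensor_rules[OF L] vspace_tensor2[OF L] vspace_tensor3 wedge_closed[OF L]
  tensor_ad_closed[OF L] tensor_ad_linear[OF L] tensor_ad_pure[OF L] tensor_ad_add_left[OF L]
  tensor_ad_smult_left[OF L] pure_tensor_bilinear[OF vspace_tensor2[OF L] lie_vspace[OF L]]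
  pure_tensor_group[OF vspace_tensor2[OF L] lie_vspace[OF L]]
  pure_tensor_closed[OF vspace_tensor2[OF L] lie_vspace[OF L]] pure_tensor_closed[OF lie_vspace[OF L] lie_vspace[OF L]]

lemma pure_tensor3_closed:
  "a \<in> carrier L \<Longrightarrow> b \<in> carrier L \<Longrightarrow> c \<in> carrier L \<Longrightarrow> pure_tensor3 L a b c \<in> carrier (tensor3 L)"
  by (simp add: pure_tensor3_def tensor3_rules)

lemma tensor3_induct [consumes 1, case_names pure add]:
  assumes W: "W \<in> carrier (tensor3 L)"
    and pure: "\<And>a b c. a \<in> carrier L \<Longrightarrow> b \<in> carrier L \<Longrightarrow> c \<in> carrier L \<Longrightarrow> Q (pure_tensor3 L a b c)"
    and add: "\<And>U V. U \<in> carrier (tensor3 L) \<Longrightarrow> V \<in> carrier (tensor3 L) \<Longrightarrow> Q U \<Longrightarrow> Q V \<Longrightarrow> Q (U \<oplus>\<^bsub>tensor3 L\<^esub> V)"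
  shows "Q W"
  using W
proof (induction rule: tensor_induct[OF vspace_tensor2[OF L] lie_vspace[OF L], consumes 1, case_names pure add])
  case (pure u c)
  from pure(1) show ?case
  proof (induction rule: tensor_induct[OF lie_vspace[OF L] lie_vspace[OF L], consumes 1, case_names pure add])
    case (pure a b)
    then show ?case using assms(2)[of a b c] \<open>c \<in> carrier L\<close> by (simp add: pure_tensor3_def)
  next
    case (add u v)
    then show ?case using assms(3) \<open>c \<in> carrier L\<close> by (simp add: tensor3_rules)
  qed
qed (use add in blast)

lemma tensor3_cycle_inner:
  assumes c: "c \<in> carrier L"
  shows "bilinear_on L L (tensor3 L) (\<lambda>a b. pure_tensor3 L b c a)"
  by (rule bilinear_onI) (simp_all add: pure_tensor3_def tensor3_rules c)

text \<open>The inner lift depends on c through the map being lifted, not through its argument;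
  linearity in c is therefore an induction over u.\<close>

lemma tensor3_cycle_bilinear:
  "bilinear_on (tensor L L) L (tensor3 L) (\<lambda>u c. tensor_lift L L (tensor3 L) (\<lambda>a b. pure_tensor3 L b c a) u)"
proof -
  note LL = lie_vspace[OF L] lie_vspace[OF L]
  note hom = tensor_lift_hom[OF LL vspace_tensor3 tensor3_cycle_inner]
  note pure = tensor_lift_pure[OF LL vspace_tensor3 tensor3_cycle_inner]
  note ind = tensor_induct[OF LL, consumes 1, case_names pure add]
  have pure3: "b \<in> carrier L \<Longrightarrow> c \<in> carrier L \<Longrightarrow> a \<in> carrier L \<Longrightarrow> c' \<in> carrier L \<Longrightarrow>
      pure_tensor3 L b (c \<oplus>\<^bsub>L\<^esub> c') a = pure_tensor3 L b c a \<oplus>\<^bsub>tensor3 L\<^esub> pure_tensor3 L b c' a"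
    "b \<in> carrier L \<Longrightarrow> c \<in> carrier L \<Longrightarrow> a \<in> carrier L \<Longrightarrow>
      pure_tensor3 L b (d \<odot>\<^bsub>L\<^esub> c) a = d \<odot>\<^bsub>tensor3 L\<^esub> pure_tensor3 L b c a" for a b c c' d
    by (simp_all add: pure_tensor3_def tensor3_rules)
  show ?thesis
  proof (rule bilinear_onI)
    fix u c c' assume u: "u \<in> carrier (tensor L L)" and c: "c \<in> carrier L" "c' \<in> carrier L"
    from u show "tensor_lift L L (tensor3 L) (\<lambda>a b. pure_tensor3 L b (c \<oplus>\<^bsub>L\<^esub> c') a) u =
      tensor_lift L L (tensor3 L) (\<lambda>a b. pure_tensor3 L b c a) u \<oplus>\<^bsub>tensor3 L\<^esub> tensor_lift L L (tensor3 L) (\<lambda>a b. pure_tensor3 L b c' a) u"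
      by (induction rule: ind; intro vs_eqI[OF vspace_tensor3])
        (simp_all add: c LL pure pure3 mod_hom_add[OF hom] mod_hom_closed[OF hom] emb_simps vspace_tensor3 vspace_tensor2[OF L]
          pure_tensor3_closed)
  next
    fix d u c assume u: "u \<in> carrier (tensor L L)" and c: "c \<in> carrier L"
    from u show "tensor_lift L L (tensor3 L) (\<lambda>a b. pure_tensor3 L b (d \<odot>\<^bsub>L\<^esub> c) a) u =
      d \<odot>\<^bsub>tensor3 L\<^esub> tensor_lift L L (tensor3 L) (\<lambda>a b. pure_tensor3 L b c a) u"
      by (induction rule: ind; intro vs_eqI[OF vspace_tensor3])
        (simp_all add: c LL pure pure3 mod_hom_add[OF hom] mod_hom_closed[OF hom] emb_simps vspace_tensor3 vspace_tensor2[OF L]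
          pure_tensor3_closed free.scale_right_distrib)
  qed (use mod_hom_add[OF hom] mod_hom_smult[OF hom] mod_hom_closed[OF hom] in auto)
qed

lemma tensor3_cycle_hom: "tensor3_cycle L \<in> mod_hom (tensor3 L) (tensor3 L)"
  unfolding tensor3_cycle_def
  by (rule tensor_lift_hom[OF vspace_tensor2[OF L] lie_vspace[OF L] vspace_tensor3 tensor3_cycle_bilinear])

lemma tensor3_cycle_pure:
  assumes "a \<in> carrier L" "b \<in> carrier L" "c \<in> carrier L"
  shows "tensor3_cycle L (pure_tensor3 L a b c) = pure_tensor3 L b c a"
proof -
  have "tensor3_cycle L (pure_tensor3 L a b c) =
      tensor_lift L L (tensor3 L) (\<lambda>a b. pure_tensor3 L b c a) (pure_tensor L L a b)"
    using tensor_lift_pure[OF vspace_tensor2[OF L] lie_vspace[OF L] vspace_tensor3 tensor3_cycle_bilinear,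
        of "pure_tensor L L a b" c] assms
    by (simp add: tensor3_cycle_def pure_tensor3_def tensor3_rules)
  also have "\<dots> = pure_tensor3 L b c a"
    by (rule tensor_lift_pure[OF lie_vspace[OF L] lie_vspace[OF L] vspace_tensor3 tensor3_cycle_inner])
      (use assms in auto)
  finally show ?thesis .
qed

text \<open>The action on the tensor cube, as a derivation on two factors of which the first is the
  tensor square, in keeping with the left nesting of \<open>tensor3\<close>.\<close>

definition tensor3_ad :: "'a \<Rightarrow> _ \<Rightarrow> _" where
  "tensor3_ad x = tensor_lift (tensor L L) L (tensor3 L)
     (\<lambda>u c. pure_tensor (tensor L L) L (tensor_ad L x u) c \<oplus>\<^bsub>tensor3 L\<^esub> pure_tensor (tensor L L) L u (bracket L x c))"

lemma tensor3_ad_bilinear: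
  "x \<in> carrier L \<Longrightarrow> bilinear_on (tensor L L) L (tensor3 L)
    (\<lambda>u c. pure_tensor (tensor L L) L (tensor_ad L x u) c \<oplus>\<^bsub>tensor3 L\<^esub> pure_tensor (tensor L L) L u (bracket L x c))"
  by (rule bilinear_onI; (rule vs_eqI[OF vspace_tensor3])?)
    (simp_all add: tensor3_rules emb_simps free.scale_right_distrib)

lemma tensor3_ad_hom: "x \<in> carrier L \<Longrightarrow> tensor3_ad x \<in> mod_hom (tensor3 L) (tensor3 L)"
  unfolding tensor3_ad_def
  by (rule tensor_lift_hom[OF vspace_tensor2[OF L] lie_vspace[OF L] vspace_tensor3 tensor3_ad_bilinear])

lemma tensor3_ad_pure:
  "x \<in> carrier L \<Longrightarrow> u \<in> carrier (tensor L L) \<Longrightarrow> c \<in> carrier L \<Longrightarrow> tensor3_ad x (pure_tensor (tensor L L) L u c) =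
    pure_tensor (tensor L L) L (tensor_ad L x u) c \<oplus>\<^bsub>tensor3 L\<^esub> pure_tensor (tensor L L) L u (bracket L x c)"
  unfolding tensor3_ad_def
  by (rule tensor_lift_pure[OF vspace_tensor2[OF L] lie_vspace[OF L] vspace_tensor3 tensor3_ad_bilinear])

lemma tensor3_ad_pure3:
  assumes "x \<in> carrier L" "a \<in> carrier L" "b \<in> carrier L" "c \<in> carrier L"
  shows "tensor3_ad x (pure_tensor3 L a b c) = pure_tensor3 L (bracket L x a) b c \<oplus>\<^bsub>tensor3 L\<^esub>
    pure_tensor3 L a (bracket L x b) c \<oplus>\<^bsub>tensor3 L\<^esub> pure_tensor3 L a b (bracket L x c)"
  using assms unfolding pure_tensor3_def by (simp add: tensor3_ad_pure tensor3_rules)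

text \<open>The action treats the three slots alike, so rotating them does not affect it.\<close>

lemma tensor3_cycle_ad:
  assumes "W \<in> carrier (tensor3 L)" "x \<in> carrier L"
  shows "tensor3_cycle L (tensor3_ad x W) = tensor3_ad x (tensor3_cycle L W)"
  using assms(1)
  by (induction rule: tensor3_induct; intro vs_eqI[OF vspace_tensor3])
    (simp_all add: assms tensor3_ad_pure3 tensor3_cycle_pure pure_tensor3_closed bracket_closed L
      vspace_tensor3 emb_simps mod_hom_add[OF tensor3_cycle_hom] mod_hom_add[OF tensor3_ad_hom]
      mod_hom_closed[OF tensor3_cycle_hom] mod_hom_closed[OF tensor3_ad_hom])

definition cyclic_sum :: "_ \<Rightarrow> _" where
  "cyclic_sum W = W \<oplus>\<^bsub>tensor3 L\<^esub> tensor3_cycle L W \<oplus>\<^bsub>tensor3 L\<^esub> tensor3_cycle L (tensor3_cycle L W)"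

lemma cyclic_sum_hom: "cyclic_sum \<in> mod_hom (tensor3 L) (tensor3 L)"
  unfolding cyclic_sum_def
  by (rule mod_homI; (rule vs_eqI[OF vspace_tensor3])?)
    (simp_all add: vspace_tensor3 mod_hom_closed[OF tensor3_cycle_hom] mod_hom_add[OF tensor3_cycle_hom]
      mod_hom_smult[OF tensor3_cycle_hom] emb_simps free.scale_right_distrib)

lemma cyclic_sum_ad:
  "W \<in> carrier (tensor3 L) \<Longrightarrow> x \<in> carrier L \<Longrightarrow> cyclic_sum (tensor3_ad x W) = tensor3_ad x (cyclic_sum W)"
  unfolding cyclic_sum_def
  by (simp add: vspace_tensor3 tensor3_cycle_ad mod_hom_add[OF tensor3_ad_hom]
      mod_hom_closed[OF tensor3_cycle_hom] mod_hom_closed[OF tensor3_ad_hom])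

text \<open>\<open>cobracket_left\<close> with a free map in place of the cobracket. It is also
  applied to a \<mapsto> ad_a(U), the form of the defect in \<open>left_map_ad\<close>.\<close>

definition left_map :: "('a \<Rightarrow> _) \<Rightarrow> _ \<Rightarrow> _" where
  "left_map \<delta> = tensor_lift L L (tensor3 L) (\<lambda>a b. pure_tensor (tensor L L) L (\<delta> a) b)"

lemma left_map_bilinear:
  "\<delta> \<in> mod_hom L (tensor L L) \<Longrightarrow> bilinear_on L L (tensor3 L) (\<lambda>a b. pure_tensor (tensor L L) L (\<delta> a) b)"
  by (rule bilinear_onI)
    (simp_all add: tensor3_rules mod_hom_closed mod_hom_add mod_hom_smult)

lemma left_map_hom: "\<delta> \<in> mod_hom L (tensor L L) \<Longrightarrow> left_map \<delta> \<in> mod_hom (tensor L L) (tensor3 L)"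
  unfolding left_map_def
  by (rule tensor_lift_hom[OF lie_vspace[OF L] lie_vspace[OF L] vspace_tensor3 left_map_bilinear])

lemma left_map_pure:
  "\<delta> \<in> mod_hom L (tensor L L) \<Longrightarrow> a \<in> carrier L \<Longrightarrow> b \<in> carrier L \<Longrightarrow>
    left_map \<delta> (pure_tensor L L a b) = pure_tensor (tensor L L) L (\<delta> a) b"
  unfolding left_map_def
  by (rule tensor_lift_pure[OF lie_vspace[OF L] lie_vspace[OF L] vspace_tensor3 left_map_bilinear])

text \<open>On a \<otimes> b the cocycle rule replaces \<delta>[x,a] by ad_x(\<delta>(a)) -
  ad_a(\<delta>(x)). The first part belongs to the action on the cube; the second is the defect from
  equivariance.\<close>

lemma left_map_ad:
  assumes \<delta>: "\<delta> \<in> mod_hom L (tensor L L)"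
    and cocycle: "\<And>x y. x \<in> carrier L \<Longrightarrow> y \<in> carrier L \<Longrightarrow>
      \<delta> (bracket L x y) = tensor_ad L x (\<delta> y) \<ominus>\<^bsub>tensor L L\<^esub> tensor_ad L y (\<delta> x)"
    and x: "x \<in> carrier L" and U: "U \<in> carrier (tensor L L)"
  shows "left_map \<delta> (tensor_ad L x U) =
    tensor3_ad x (left_map \<delta> U) \<ominus>\<^bsub>tensor3 L\<^esub> left_map (\<lambda>a. tensor_ad L a (\<delta> x)) U"
proof -
  have ad: "(\<lambda>a. tensor_ad L a (\<delta> x)) \<in> mod_hom L (tensor L L)"
    using mod_hom_closed[OF \<delta> x] by (rule tensor_ad_left_hom[OF L])
  note homs = left_map_hom[OF \<delta>] left_map_hom[OF ad]
  from U show ?thesis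
    by (induction rule: tensor_induct[OF lie_vspace[OF L] lie_vspace[OF L], consumes 1];
        intro vs_eqI[OF vspace_tensor3])
      (simp_all add: x \<delta> ad cocycle tensor3_rules left_map_pure tensor3_ad_pure mod_hom_closed[OF \<delta>]
        mod_hom_add[OF homs(1)] mod_hom_add[OF homs(2)] mod_hom_closed[OF homs(1)]
        mod_hom_closed[OF homs(2)] mod_hom_add[OF tensor3_ad_hom] mod_hom_closed[OF tensor3_ad_hom]
        emb_simps)
qed

text \<open>Linearity in the tensor that is acted on; \<open>left_map_hom\<close> gives linearity in
  V, and together they reduce \<open>cyclic_sum_swap\<close> to wedges.\<close>

lemma left_map_ad_left_hom:
  assumes "V \<in> carrier (tensor L L)"
  shows "(\<lambda>U. left_map (\<lambda>a. tensor_ad L a U) V) \<in> mod_hom (tensor L L) (tensor3 L)"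
proof -
  note homs = tensor_ad_left_hom[OF L] left_map_hom[OF tensor_ad_left_hom[OF L]]
  note closed = mod_hom_closed[OF homs(2)]
  note add = mod_hom_add[OF homs(2)]
  show ?thesis
  proof (rule mod_homI)
    fix U U' assume U: "U \<in> carrier (tensor L L)" "U' \<in> carrier (tensor L L)"
    from assms show "left_map (\<lambda>a. tensor_ad L a (U \<oplus>\<^bsub>tensor L L\<^esub> U')) V =
      left_map (\<lambda>a. tensor_ad L a U) V \<oplus>\<^bsub>tensor3 L\<^esub> left_map (\<lambda>a. tensor_ad L a U') V"
      by (induction rule: tensor_induct[OF lie_vspace[OF L] lie_vspace[OF L], consumes 1];
          intro vs_eqI[OF vspace_tensor3])
        (simp_all add: U tensor3_rules left_map_pure homs(1) closed add emb_simps)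
  next
    fix c U assume U: "U \<in> carrier (tensor L L)"
    from assms show "left_map (\<lambda>a. tensor_ad L a (c \<odot>\<^bsub>tensor L L\<^esub> U)) V =
      c \<odot>\<^bsub>tensor3 L\<^esub> left_map (\<lambda>a. tensor_ad L a U) V"
      by (induction rule: tensor_induct[OF lie_vspace[OF L] lie_vspace[OF L], consumes 1];
          intro vs_eqI[OF vspace_tensor3])
        (simp_all add: U tensor3_rules left_map_pure homs(1) closed add emb_simps free.scale_right_distrib)
  qed (use closed assms in auto)
qed

text \<open>Both sides expand into tensors containing one bracket of a or b with c or d, and these
  match up to rotation. For instance [c,a] \<otimes> b \<otimes> d on the left is a rotation of d
  \<otimes> [c,a] \<otimes> b = - d \<otimes> [a,c] \<otimes> b on the right, where the sign is that
  of the wedge.\<close>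

lemma cyclic_sum_swap_wedge:
  assumes "a \<in> carrier L" "b \<in> carrier L" "c \<in> carrier L" "d \<in> carrier L"
  shows "cyclic_sum (left_map (\<lambda>x. tensor_ad L x (wedge L a b)) (wedge L c d)) =
    cyclic_sum (left_map (\<lambda>x. tensor_ad L x (wedge L c d)) (wedge L a b))"
proof -
  have diff: "left_map (\<lambda>x. tensor_ad L x U) (wedge L x y) = left_map (\<lambda>x. tensor_ad L x U) (pure_tensor L L x y)
      \<ominus>\<^bsub>tensor3 L\<^esub> left_map (\<lambda>x. tensor_ad L x U) (pure_tensor L L y x)"
    if "U \<in> carrier (tensor L L)" "x \<in> carrier L" "y \<in> carrier L" for U x y
    using mod_hom_diff[OF vspace_tensor2[OF L] vspace_tensor3 left_map_hom[OF tensor_ad_left_hom[OF L that(1)]]] that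
    unfolding wedge_def by (simp add: tensor3_rules)
  have pure: "left_map (\<lambda>x. tensor_ad L x (wedge L u v)) (pure_tensor L L x y) =
      pure_tensor3 L (bracket L x u) v y \<oplus>\<^bsub>tensor3 L\<^esub> pure_tensor3 L u (bracket L x v) y
      \<ominus>\<^bsub>tensor3 L\<^esub> (pure_tensor3 L (bracket L x v) u y \<oplus>\<^bsub>tensor3 L\<^esub> pure_tensor3 L v (bracket L x u) y)"
    if "u \<in> carrier L" "v \<in> carrier L" "x \<in> carrier L" "y \<in> carrier L" for u v x y
    using that by (simp add: left_map_pure tensor_ad_left_hom[OF L] tensor3_rules)
      (simp add: wedge_def tensor3_rules pure_tensor3_def)
  have anti: "pure_tensor3 L (\<ominus>\<^bsub>L\<^esub> u) v y = \<ominus>\<^bsub>tensor3 L\<^esub> pure_tensor3 L u v y"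
    "pure_tensor3 L v (\<ominus>\<^bsub>L\<^esub> u) y = \<ominus>\<^bsub>tensor3 L\<^esub> pure_tensor3 L v u y"
    if "u \<in> carrier L" "v \<in> carrier L" "y \<in> carrier L" for u v y
    using that by (simp_all add: pure_tensor3_def tensor3_rules)
  \<comment> \<open>All brackets are brought to the order with a or b in front, so that the terms of
    the two sides can meet.\<close>
  have brackets: "bracket L c a = \<ominus>\<^bsub>L\<^esub> bracket L a c" "bracket L c b = \<ominus>\<^bsub>L\<^esub> bracket L b c"
    "bracket L d a = \<ominus>\<^bsub>L\<^esub> bracket L a d" "bracket L d b = \<ominus>\<^bsub>L\<^esub> bracket L b d"
    by (rule bracket_anti[OF L]; rule assms)+
  note cyc = tensor3_cycle_pure mod_hom_add[OF tensor3_cycle_hom]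
    mod_hom_diff[OF vspace_tensor3 vspace_tensor3 tensor3_cycle_hom]
    mod_hom_minus[OF vspace_tensor3 vspace_tensor3 tensor3_cycle_hom] mod_hom_closed[OF tensor3_cycle_hom]
  show ?thesis
    by (rule vs_eqI[OF vspace_tensor3])
      (simp_all add: cyclic_sum_def diff pure brackets anti wedge_closed[OF L] bracket_closed[OF L]
        pure_tensor3_closed vspace_tensor3 cyc emb_simps assms lie_vspace[OF L])
qed

text \<open>Both sides are additive in U and in V, so an induction over each argument leaves the
  case of two wedges.\<close>

lemma cyclic_sum_swap:
  assumes "U \<in> alternating L" "V \<in> alternating L"
  shows "cyclic_sum (left_map (\<lambda>x. tensor_ad L x U) V) = cyclic_sum (left_map (\<lambda>x. tensor_ad L x V) U)"
proof -
  note closed = alternating_closed[OF L]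
  note homs = left_map_hom[OF tensor_ad_left_hom[OF L]] left_map_ad_left_hom
  have add: "cyclic_sum (left_map (\<lambda>x. tensor_ad L x U) (V \<oplus>\<^bsub>tensor L L\<^esub> V')) =
      cyclic_sum (left_map (\<lambda>x. tensor_ad L x U) V) \<oplus>\<^bsub>tensor3 L\<^esub> cyclic_sum (left_map (\<lambda>x. tensor_ad L x U) V')"
    "cyclic_sum (left_map (\<lambda>x. tensor_ad L x (V \<oplus>\<^bsub>tensor L L\<^esub> V')) U) =
      cyclic_sum (left_map (\<lambda>x. tensor_ad L x V) U) \<oplus>\<^bsub>tensor3 L\<^esub> cyclic_sum (left_map (\<lambda>x. tensor_ad L x V') U)"
    if "U \<in> carrier (tensor L L)" "V \<in> carrier (tensor L L)" "V' \<in> carrier (tensor L L)" for U V V'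
    using that mod_hom_add[OF homs(1)] mod_hom_add[OF homs(2)] mod_hom_closed[OF homs(1)]
      mod_hom_add[OF cyclic_sum_hom] by simp_all
  have wedge: "cyclic_sum (left_map (\<lambda>x. tensor_ad L x (wedge L a b)) V) =
      cyclic_sum (left_map (\<lambda>x. tensor_ad L x V) (wedge L a b))"
    if "V \<in> alternating L" "a \<in> carrier L" "b \<in> carrier L" for V a b
    using that
    by (induction rule: alternating.induct[OF L, consumes 1])
      (simp_all add: cyclic_sum_swap_wedge add closed wedge_closed[OF L])
  from assms(1) show ?thesis
    by (induction rule: alternating.induct[OF L, consumes 1]) (simp_all add: wedge add closed assms(2))
qed

definition co_jacobiator :: "('a \<Rightarrow> _) \<Rightarrow> 'a \<Rightarrow> _" where
  "co_jacobiator \<delta> x = cyclic_sum (left_map \<delta> (\<delta> x))"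

lemma co_jacobiator_hom:
  assumes \<delta>: "\<delta> \<in> mod_hom L (tensor L L)"
  shows "co_jacobiator \<delta> \<in> mod_hom L (tensor3 L)"
  unfolding co_jacobiator_def
  by (rule mod_homI)
    (simp_all add: mod_hom_closed[OF \<delta>] mod_hom_add[OF \<delta>] mod_hom_smult[OF \<delta>]
      mod_hom_closed[OF left_map_hom[OF \<delta>]] mod_hom_add[OF left_map_hom[OF \<delta>]]
      mod_hom_smult[OF left_map_hom[OF \<delta>]] mod_hom_closed[OF cyclic_sum_hom]
      mod_hom_add[OF cyclic_sum_hom] mod_hom_smult[OF cyclic_sum_hom])

text \<open>Applying \<open>left_map\<close> to ad_x(\<delta>(y)) - ad_y(\<delta>(x)) produces, by
  \<open>left_map_ad\<close>, two defects of opposite sign; \<open>cyclic_sum_swap\<close> makes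
  their cyclic sums equal, so only the action on the cube is left.\<close>

lemma co_jacobiator_bracket:
  assumes \<delta>: "\<delta> \<in> mod_hom L (tensor L L)" and alt: "\<And>x. x \<in> carrier L \<Longrightarrow> \<delta> x \<in> alternating L"
    and cocycle: "\<And>x y. x \<in> carrier L \<Longrightarrow> y \<in> carrier L \<Longrightarrow>
      \<delta> (bracket L x y) = tensor_ad L x (\<delta> y) \<ominus>\<^bsub>tensor L L\<^esub> tensor_ad L y (\<delta> x)"
    and x: "x \<in> carrier L" and y: "y \<in> carrier L"
  shows "co_jacobiator \<delta> (bracket L x y) =
    tensor3_ad x (co_jacobiator \<delta> y) \<ominus>\<^bsub>tensor3 L\<^esub> tensor3_ad y (co_jacobiator \<delta> x)"
proof -
  note c = mod_hom_closed[OF \<delta>]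
  note homs = left_map_hom[OF \<delta>] left_map_hom[OF tensor_ad_left_hom[OF L]]
  note diffs = mod_hom_diff[OF vspace_tensor2[OF L] vspace_tensor3 homs(1)]
    mod_hom_diff[OF vspace_tensor3 vspace_tensor3 cyclic_sum_hom]
  show ?thesis
    unfolding co_jacobiator_def
    by (rule vs_eqI[OF vspace_tensor3])
      (simp_all add: cocycle x y diffs c tensor_ad_closed[OF L] left_map_ad[OF \<delta> cocycle]
        mod_hom_closed[OF homs(1)] mod_hom_closed[OF homs(2)] mod_hom_closed[OF tensor3_ad_hom]
        mod_hom_closed[OF cyclic_sum_hom] vspace_tensor3 emb_simps cyclic_sum_ad
        cyclic_sum_swap[OF alt[OF x] alt[OF y]])
qed

end

section \<open>Iterated brackets and changes of record type\<close>

context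
  fixes L :: "('k::field, 'a, 'm) lie_scheme"
  assumes L: "lie_algebra L"
begin

lemma wedge_group:
  assumes "x \<in> carrier L"
  shows "wedge L x \<zero>\<^bsub>L\<^esub> = \<zero>\<^bsub>tensor L L\<^esub>" "wedge L \<zero>\<^bsub>L\<^esub> x = \<zero>\<^bsub>tensor L L\<^esub>"
    and "y \<in> carrier L \<Longrightarrow> wedge L x (\<ominus>\<^bsub>L\<^esub> y) = \<ominus>\<^bsub>tensor L L\<^esub> wedge L x y"
    and "y \<in> carrier L \<Longrightarrow> wedge L (\<ominus>\<^bsub>L\<^esub> y) x = \<ominus>\<^bsub>tensor L L\<^esub> wedge L y x"
  by (rule vs_eqI[OF vspace_tensor2[OF L]];
      simp add: assms wedge_def tensor3_rules[OF L] emb_simps)+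

lemma left_map_cong:
  assumes "\<delta> \<in> mod_hom L (tensor L L)" "\<delta>' \<in> mod_hom L (tensor L L)"
    and "\<And>x. x \<in> carrier L \<Longrightarrow> \<delta> x = \<delta>' x" and "U \<in> carrier (tensor L L)"
  shows "left_map L \<delta> U = left_map L \<delta>' U"
  using left_map_hom[OF L assms(1)] left_map_hom[OF L assms(2)] _ assms(4)
  by (rule tensor_hom_eqI[OF lie_vspace[OF L] lie_vspace[OF L]])
    (simp add: left_map_pure[OF L] assms)

text \<open>For cobrackets that are known on the carrier only: \<open>co_jacobiator\<close> uses
  \<delta> also inside \<open>left_map\<close>, where agreement is argued on pure tensors.\<close>

lemma co_jacobiator_cong:
  assumes "\<delta> \<in> mod_hom L (tensor L L)" "\<delta>' \<in> mod_hom L (tensor L L)"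
    and "\<And>x. x \<in> carrier L \<Longrightarrow> \<delta> x = \<delta>' x" and "x \<in> carrier L"
  shows "co_jacobiator L \<delta> x = co_jacobiator L \<delta>' x"
  unfolding co_jacobiator_def[OF L]
  using left_map_cong[OF assms(1-3)] assms mod_hom_closed[OF assms(2)] by simp

lemma co_jacobiator_zero:
  assumes "\<delta> \<in> mod_hom L (tensor L L)" "\<delta> x = \<zero>\<^bsub>tensor L L\<^esub>"
  shows "co_jacobiator L \<delta> x = \<zero>\<^bsub>tensor3 L\<^esub>"
  unfolding co_jacobiator_def[OF L] assms(2)
  using mod_hom_zero[OF vspace_tensor2[OF L] vspace_tensor3[OF L] left_map_hom[OF L assms(1)]]
    mod_hom_zero[OF vspace_tensor3[OF L] vspace_tensor3[OF L] cyclic_sum_hom[OF L]]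
  by simp

text \<open>As \<delta>(t) is zero, only - \<delta>(x) \<otimes> t survives, that is x \<otimes> t
  \<otimes> t - t \<otimes> x \<otimes> t, and these two tensors are rotations of each
  other.\<close>

lemma co_jacobiator_wedge:
  assumes \<delta>: "\<delta> \<in> mod_hom L (tensor L L)" and t: "\<delta> t = \<zero>\<^bsub>tensor L L\<^esub>" and x: "\<delta> x = wedge L t x"
    and "t \<in> carrier L" "x \<in> carrier L"
  shows "co_jacobiator L \<delta> x = \<zero>\<^bsub>tensor3 L\<^esub>"
proof -
  note hom = left_map_hom[OF L \<delta>]
  have "left_map L \<delta> (wedge L t x) = left_map L \<delta> (pure_tensor L L t x) \<ominus>\<^bsub>tensor3 L\<^esub> left_map L \<delta> (pure_tensor L L x t)"
    unfolding wedge_def using assms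
    by (intro mod_hom_diff[OF vspace_tensor2[OF L] vspace_tensor3[OF L] hom]) (simp_all add: lie_vspace[OF L])
  also have "left_map L \<delta> (pure_tensor L L t x) = \<zero>\<^bsub>tensor3 L\<^esub>"
    using assms by (simp add: left_map_pure[OF L] tensor3_rules[OF L])
  also have "left_map L \<delta> (pure_tensor L L x t) = pure_tensor3 L t x t \<ominus>\<^bsub>tensor3 L\<^esub> pure_tensor3 L x t t"
    using assms by (simp add: left_map_pure[OF L] tensor3_rules[OF L])
      (simp add: wedge_def pure_tensor3_def tensor3_rules[OF L])
  finally have *: "left_map L \<delta> (wedge L t x) =
    \<zero>\<^bsub>tensor3 L\<^esub> \<ominus>\<^bsub>tensor3 L\<^esub> (pure_tensor3 L t x t \<ominus>\<^bsub>tensor3 L\<^esub> pure_tensor3 L x t t)" .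
  note cyc = tensor3_cycle_pure[OF L] mod_hom_closed[OF tensor3_cycle_hom[OF L]]
    mod_hom_diff[OF vspace_tensor3[OF L] vspace_tensor3[OF L] tensor3_cycle_hom[OF L]]
    mod_hom_zero[OF vspace_tensor3[OF L] vspace_tensor3[OF L] tensor3_cycle_hom[OF L]]
  show ?thesis
    unfolding co_jacobiator_def[OF L] x * cyclic_sum_def[OF L]
    by (rule vs_eqI[OF vspace_tensor3[OF L]])
      (simp_all add: assms cyc pure_tensor3_closed[OF L] vspace_tensor3[OF L] emb_simps)
qed

text \<open>By the Jacobi identity ad(S) is a derivation, so every application of ad(e) adds the
  weight a.\<close>

lemma weight_iterate:
  assumes "S \<in> carrier L" "e \<in> carrier L" "x \<in> carrier L"
    and "bracket L S e = a \<odot>\<^bsub>L\<^esub> e" "bracket L S x = b \<odot>\<^bsub>L\<^esub> x"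
  shows "(bracket L e ^^ n) x \<in> carrier L \<and>
    bracket L S ((bracket L e ^^ n) x) = (of_nat n * a + b) \<odot>\<^bsub>L\<^esub> (bracket L e ^^ n) x"
proof (induction n)
  case (Suc n)
  define y where "y = (bracket L e ^^ n) x"
  have y: "y \<in> carrier L" "bracket L S y = (of_nat n * a + b) \<odot>\<^bsub>L\<^esub> y"
    using Suc by (auto simp: y_def)
  have "bracket L S (bracket L e y) = bracket L (bracket L S e) y \<oplus>\<^bsub>L\<^esub> bracket L e (bracket L S y)"
    using assms y(1) bracket_jacobi[OF L, of S e y]
    by (intro vs_eqI[OF lie_vspace[OF L]]) (simp_all add: bracket_closed[OF L] lie_vspace[OF L] emb_simps)
  also have "\<dots> = (of_nat (Suc n) * a + b) \<odot>\<^bsub>L\<^esub> bracket L e y"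
    using assms y
    by (intro vs_eqI[OF lie_vspace[OF L]])
      (simp_all add: bracket_closed[OF L] bracket_bilinear[OF L] lie_vspace[OF L] emb_simps free.scale_left_distrib algebra_simps)
  finally show ?case using assms y by (simp add: y_def[symmetric] bracket_closed[OF L])
qed (use assms in simp)

text \<open>
  With \<open>(S, T) = (T\<^sub>i\<^sup>\<plusminus>, T\<^sub>j\<^sup>\<plusminus>)\<close>, the coefficient \<open>n a + b + c\<close> vanishes for \<open>n = - a\<^sub>i\<^sub>j\<close>: this is why the
  cobracket is compatible with the Serre relations.
\<close>

lemma cocycle_iterate:
  fixes G :: "nat \<Rightarrow> ('a \<times> 'a \<Rightarrow>\<^sub>0 'k) set"
  assumes carr: "S \<in> carrier L" "T \<in> carrier L" "e \<in> carrier L" "x \<in> carrier L"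
    and wt: "bracket L S e = a \<odot>\<^bsub>L\<^esub> e" "bracket L S x = b \<odot>\<^bsub>L\<^esub> x" "bracket L T e = c \<odot>\<^bsub>L\<^esub> e"
    and G: "G 0 = wedge L T x" "\<And>n. G (Suc n) =
      tensor_ad L e (G n) \<ominus>\<^bsub>tensor L L\<^esub> tensor_ad L ((bracket L e ^^ n) x) (wedge L S e)"
  shows "G (Suc n) = wedge L (of_nat (Suc n) \<odot>\<^bsub>L\<^esub> S \<oplus>\<^bsub>L\<^esub> T) ((bracket L e ^^ Suc n) x) \<oplus>\<^bsub>tensor L L\<^esub>
    (- (of_nat (Suc n) * (of_nat n * a + b + c))) \<odot>\<^bsub>tensor L L\<^esub> wedge L e ((bracket L e ^^ n) x)"
proof -
  note V = vspace_tensor2[OF L] and v = lie_vspace[OF L]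
  define X where "X n = (bracket L e ^^ n) x" for n
  have X: "X n \<in> carrier L" "bracket L S (X n) = (of_nat n * a + b) \<odot>\<^bsub>L\<^esub> X n" for n
    using weight_iterate[OF carr(1,3,4) wt(1,2)] by (simp_all add: X_def)
  have X_Suc: "bracket L e (X n) = X (Suc n)" for n by (simp add: X_def)
  have rev: "bracket L e S = \<ominus>\<^bsub>L\<^esub> (a \<odot>\<^bsub>L\<^esub> e)" "bracket L e T = \<ominus>\<^bsub>L\<^esub> (c \<odot>\<^bsub>L\<^esub> e)"
    "bracket L (X n) S = \<ominus>\<^bsub>L\<^esub> ((of_nat n * a + b) \<odot>\<^bsub>L\<^esub> X n)" "bracket L (X n) e = \<ominus>\<^bsub>L\<^esub> X (Suc n)" for n
    using bracket_anti[OF L carr(3,1)] bracket_anti[OF L carr(3,2)] bracket_anti[OF L X(1) carr(1)]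
      bracket_anti[OF L X(1) carr(3)] wt X by (simp_all add: X_Suc)
  have self: "bracket L e e = \<zero>\<^bsub>L\<^esub>" using L carr by (simp add: lie_algebra_def)
  have X_e: "emb (tensor L L) (wedge L (X n) e) = - emb (tensor L L) (wedge L e (X n))" for n
    using wedge_anti[OF L, of e "X n"] carr X by (simp add: emb_minus V wedge_closed[OF L])
  note rules = carr X(1) V v wedge_closed[OF L] tensor_ad_wedge[OF L] wedge_bilinear[OF L] wedge_group
    bracket_closed[OF L] tensor_ad_closed[OF L] tensor_ad_linear[OF L] bracket_bilinear[OF L]
  have "G (Suc n) = wedge L (of_nat (Suc n) \<odot>\<^bsub>L\<^esub> S \<oplus>\<^bsub>L\<^esub> T) (X (Suc n)) \<oplus>\<^bsub>tensor L L\<^esub>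
    (- (of_nat (Suc n) * (of_nat n * a + b + c))) \<odot>\<^bsub>tensor L L\<^esub> wedge L e (X n)"
  \<comment> \<open>The base case concerns \<open>G 1\<close>: the second wedge contains the iterate
    before the current one, which \<open>G 0\<close> does not have.\<close>
  proof (induction n)
    case 0
    show ?case
      unfolding G(2) G(1) X_def[symmetric] using X_Suc[of 0] rev(3,4)[of 0] X_e[of 0]
      by (intro vs_eqI[OF V])
        (simp_all add: X_def[of 0, simplified, symmetric] rules rev emb_simps vs_one_smult free.scale_left_distrib algebra_simps)
  next
    case (Suc n)
    \<comment> \<open>With k = \<open>Suc n\<close>, the factor of - e \<and> x_k grows by 2ka + b +
      c: ad(e) on k S + T gives ka + c, and [x_k, S] gives ka + b. This leads from k((k - 1)a + b +
      c) to (k + 1)(ka + b + c).\<close>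
    show ?case
      unfolding G(2)[of "Suc n"] X_def[symmetric] Suc
      by (intro vs_eqI[OF V])
        (simp_all add: rules rev X_Suc X_e self emb_simps free.scale_left_distrib free.scale_right_distrib
          free.scale_left_diff_distrib free.scale_right_diff_distrib algebra_simps,
        simp add: poly_mapping_eq_iff fun_eq_iff lookup_add algebra_simps)
  qed
  then show ?thesis by (simp add: X_def)
qed

end

text \<open>The flip condition is replaced by membership in \<open>alternating\<close>, the form in
  which antisymmetry is propagated and used.\<close>

lemma lie_bialgebraI:
  fixes L :: "('k::field, 'a, 'm) lie_bialg_scheme"
  assumes L: "lie_algebra L" and \<delta>: "cobracket L \<in> mod_hom L (tensor L L)"
    and "\<And>x. x \<in> carrier L \<Longrightarrow> cobracket L x \<in> alternating L"
    and "\<And>x. x \<in> carrier L \<Longrightarrow> co_jacobiator L (cobracket L) x = \<zero>\<^bsub>tensor3 L\<^esub>"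
    and "\<And>x y. x \<in> carrier L \<Longrightarrow> y \<in> carrier L \<Longrightarrow> cobracket L (bracket L x y) =
      tensor_ad L x (cobracket L y) \<ominus>\<^bsub>tensor L L\<^esub> tensor_ad L y (cobracket L x)"
  shows "lie_bialgebra L"
  using assms alternating_flip[OF L]
  by (simp add: lie_bialgebra_def Let_def co_jacobiator_def[OF L] cyclic_sum_def[OF L]
      left_map_def[OF L] cobracket_left_def)

section \<open>Transport between records that share the Lie algebra operations\<close>

lemma vspace_cong:
  fixes M :: "('k::field, 'a, 'm) module_scheme" and M' :: "('k, 'a, 'n) module_scheme"
  assumes M: "vspace M" and "carrier M' = carrier M" "zero M' = zero M" "add M' = add M" "smult M' = smult M"
  shows "vspace M'"
proof -
  note * = assms(2-)
  show ?thesis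
    by (rule vspaceI; unfold *; (rule vs_eqI[OF M])?)
      (simp_all add: M emb_simps free.scale_left_distrib free.scale_right_distrib algebra_simps)
qed

context
  fixes L :: "('k::field, 'a, 'm) lie_scheme" and L' :: "('k, 'a, 'n) lie_scheme"
  assumes eq: "carrier L' = carrier L" "zero L' = zero L" "add L' = add L" "smult L' = smult L"
    "bracket L' = bracket L"
begin

text \<open>\<open>mp_lie\<close>, \<open>mp_with\<close> and \<open>twist_bialgebra\<close> give
  one Lie algebra in different records. The tensor constructions read the shared fields only, hence
  literal equalities.\<close>

lemma tensor_cong: "tensor L' L' = tensor L L" and pure_tensor_cong: "pure_tensor L' L' = pure_tensor L L"
proof -
  have *: "tensor_kernel L' L' = tensor_kernel L L"
    by (simp add: tensor_kernel_def tensor_relators_def eq)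
  show "tensor L' L' = tensor L L" "pure_tensor L' L' = pure_tensor L L"
    by (simp_all add: tensor_def pure_tensor_def fun_eq_iff * eq)
qed

lemma wedge_cong: "wedge L' = wedge L"
  by (simp add: fun_eq_iff wedge_def tensor_cong pure_tensor_cong)

lemma tensor_lift_cong: "tensor_lift L' L' = tensor_lift L L"
  by (simp add: fun_eq_iff tensor_lift_def)

lemma tensor_ad_cong: "tensor_ad L' = tensor_ad L"
  by (simp add: fun_eq_iff tensor_ad_def tensor_cong pure_tensor_cong eq tensor_lift_cong)

lemma tensor3_cong: "tensor3 L' = tensor3 L"
  and pure_tensor_left_cong: "pure_tensor (tensor L' L') L' = pure_tensor (tensor L L) L"
proof -
  have *: "tensor_kernel (tensor L L) L' = tensor_kernel (tensor L L) L"
    by (simp add: tensor_kernel_def tensor_relators_def eq)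
  show "tensor3 L' = tensor3 L" "pure_tensor (tensor L' L') L' = pure_tensor (tensor L L) L"
    unfolding tensor_cong
    by (simp_all add: tensor_def[of "tensor L L"] pure_tensor_def[of "tensor L L"] fun_eq_iff * eq)
qed

lemma mod_hom_cong: "mod_hom L' = mod_hom L"
  by (simp add: fun_eq_iff mod_hom_def eq)

lemma lie_algebra_cong:
  assumes "lie_algebra L"
  shows "lie_algebra L'"
  using assms vspace_cong[OF lie_vspace[OF assms] eq(1-4)]
  by (simp add: lie_algebra_def eq mod_hom_def)

text \<open>The inductive set takes the record as a parameter, so the equality is an induction in
  each direction.\<close>

lemma alternating_cong:
  assumes "lie_algebra L"
  shows "alternating L' = alternating L"
proof -
  note L' = lie_algebra_cong[OF assms]
  have "U \<in> alternating L" if "U \<in> alternating L'" for U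
    using that
    by (induction rule: alternating.induct[OF L', consumes 1])
      (simp_all add: wedge_cong tensor_cong alternating.intros[OF assms] eq)
  moreover have "U \<in> alternating L'" if "U \<in> alternating L" for U
    using that
    by (induction rule: alternating.induct[OF assms, consumes 1])
      (simp_all add: alternating.intros[OF L', unfolded wedge_cong tensor_cong eq])
  ultimately show ?thesis by blast
qed

lemma co_jacobiator_cong_lie:
  assumes "lie_algebra L"
  shows "co_jacobiator L' = co_jacobiator L"
proof -
  note L' = lie_algebra_cong[OF assms]
  have lift3: "tensor_lift (tensor L L) L' = tensor_lift (tensor L L) L"
    by (simp add: fun_eq_iff tensor_lift_def)
  have p3: "pure_tensor3 L' = pure_tensor3 L"
    by (simp add: fun_eq_iff pure_tensor3_def pure_tensor_left_cong pure_tensor_cong)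
  have cyc: "tensor3_cycle L' = tensor3_cycle L"
    unfolding tensor3_cycle_def tensor3_cong p3 tensor_lift_cong by (simp add: tensor_cong lift3)
  show ?thesis
    unfolding fun_eq_iff co_jacobiator_def[OF assms] co_jacobiator_def[OF L']
      cyclic_sum_def[OF assms] cyclic_sum_def[OF L'] left_map_def[OF assms] left_map_def[OF L']
      tensor3_cong cyc pure_tensor_left_cong tensor_lift_cong by simp
qed

end

section \<open>The cobracket of a multiparameter Lie bialgebra\<close>

context
  fixes A :: "int^'n^'n" and d :: "'n::finite \<Rightarrow> nat"
    and R :: "('k::field_char_0, 'h::ab_group_add, 'n) realization"
begin

lemma mp_class_eq_iff: "mp_class A d R x = mp_class A d R y \<longleftrightarrow> mp_eq A d R x y"
  unfolding mp_class_def using mp_eq.refl mp_eq.sym mp_eq.trans by blast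

lemmas mp_classI = mp_class_eq_iff[THEN iffD2]

lemma mem_mp_class: "y \<in> mp_class A d R x \<longleftrightarrow> mp_class A d R y = mp_class A d R x"
  unfolding mp_class_eq_iff using mp_eq.sym by (auto simp: mp_class_def)

text \<open>The operations on classes are unions over all representatives; by the congruence clauses
  of \<open>mp_eq\<close> every member of such a union is the same class.\<close>

lemma mp_lie_simps:
  "carrier (mp_lie A d R) = range (mp_class A d R)"
  "\<zero>\<^bsub>mp_lie A d R\<^esub> = mp_class A d R Zero"
  "mp_class A d R x \<oplus>\<^bsub>mp_lie A d R\<^esub> mp_class A d R y = mp_class A d R (Plus x y)"
  "c \<odot>\<^bsub>mp_lie A d R\<^esub> mp_class A d R x = mp_class A d R (Scal c x)"
  "bracket (mp_lie A d R) (mp_class A d R x) (mp_class A d R y) = mp_class A d R (Brk x y)"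
proof -
  have mem: "x \<in> mp_class A d R x" for x by (simp add: mem_mp_class)
  have plus: "mp_class A d R (Plus x' y') = mp_class A d R (Plus x y)"
    and brk: "mp_class A d R (Brk x' y') = mp_class A d R (Brk x y)"
    and scal: "mp_class A d R (Scal c x') = mp_class A d R (Scal c x)"
    if "x' \<in> mp_class A d R x" "y' \<in> mp_class A d R y" for x x' y y' c
    using that unfolding mem_mp_class mp_class_eq_iff
    by (auto intro: mp_eq.plus_cong mp_eq.brk_cong mp_eq.scal_cong)
  have ne: "mp_class A d R x \<noteq> {}" for x using mem by blast
  have "(\<Union>x' \<in> mp_class A d R x. \<Union>y' \<in> mp_class A d R y. mp_class A d R (Plus x' y')) =
      (\<Union>x' \<in> mp_class A d R x. \<Union>y' \<in> mp_class A d R y. mp_class A d R (Plus x y))"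
    by (intro SUP_cong HOL.refl plus)
  then show "mp_class A d R x \<oplus>\<^bsub>mp_lie A d R\<^esub> mp_class A d R y = mp_class A d R (Plus x y)"
    by (simp add: mp_lie_def ne)
  have "(\<Union>x' \<in> mp_class A d R x. \<Union>y' \<in> mp_class A d R y. mp_class A d R (Brk x' y')) =
      (\<Union>x' \<in> mp_class A d R x. \<Union>y' \<in> mp_class A d R y. mp_class A d R (Brk x y))"
    by (intro SUP_cong HOL.refl brk)
  then show "bracket (mp_lie A d R) (mp_class A d R x) (mp_class A d R y) = mp_class A d R (Brk x y)"
    by (simp add: mp_lie_def ne)
  have "(\<Union>x' \<in> mp_class A d R x. mp_class A d R (Scal c x')) =
      (\<Union>x' \<in> mp_class A d R x. mp_class A d R (Scal c x))"
    by (intro SUP_cong HOL.refl scal[OF _ mem])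
  then show "c \<odot>\<^bsub>mp_lie A d R\<^esub> mp_class A d R x = mp_class A d R (Scal c x)"
    by (simp add: mp_lie_def ne)
qed (simp_all add: mp_lie_def)

lemma lie_algebra_mp_lie: "lie_algebra (mp_lie A d R)"
proof -
  \<comment> \<open>Clauses 7 to 20 of \<open>mp_eq\<close> are the vector space and Lie algebra
    laws; clause 13, \<open>scal_scal\<close>, is added in reverse, which is how the module axiom
    reads.\<close>
  note laws = mp_eq.intros(7-20) mp_eq.intros(13)[THEN mp_eq.sym]
  have "vspace (mp_lie A d R)"
    by (rule vspaceI; (unfold mp_lie_simps)?; (elim rangeE)?; hypsubst?; (unfold mp_lie_simps)?;
        (rule rangeI | rule mp_classI, rule laws))
  moreover have "bracket (mp_lie A d R) X \<in> mod_hom (mp_lie A d R) (mp_lie A d R)"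
    "(\<lambda>Y. bracket (mp_lie A d R) Y X) \<in> mod_hom (mp_lie A d R) (mp_lie A d R)"
    if X: "X \<in> carrier (mp_lie A d R)" for X
  proof -
    obtain x where x: "X = mp_class A d R x" using X by (auto simp: mp_lie_simps)
    show "bracket (mp_lie A d R) X \<in> mod_hom (mp_lie A d R) (mp_lie A d R)"
      by (rule mod_homI) (clarsimp simp: mp_lie_simps x; (rule mp_classI, rule laws)?)+
    show "(\<lambda>Y. bracket (mp_lie A d R) Y X) \<in> mod_hom (mp_lie A d R) (mp_lie A d R)"
      by (rule mod_homI) (clarsimp simp: mp_lie_simps x; (rule mp_classI, rule laws)?)+
  qed
  moreover have "bracket (mp_lie A d R) X X = \<zero>\<^bsub>mp_lie A d R\<^esub>"
    if "X \<in> carrier (mp_lie A d R)" for X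
    using that by (clarsimp simp: mp_lie_simps) (rule mp_classI, rule laws)
  moreover have "bracket (mp_lie A d R) X (bracket (mp_lie A d R) Y Z) \<oplus>\<^bsub>mp_lie A d R\<^esub>
      bracket (mp_lie A d R) Y (bracket (mp_lie A d R) Z X) \<oplus>\<^bsub>mp_lie A d R\<^esub>
      bracket (mp_lie A d R) Z (bracket (mp_lie A d R) X Y) = \<zero>\<^bsub>mp_lie A d R\<^esub>"
    if "X \<in> carrier (mp_lie A d R)" "Y \<in> carrier (mp_lie A d R)" "Z \<in> carrier (mp_lie A d R)" for X Y Z
    using that by (clarsimp simp: mp_lie_simps) (rule mp_classI, rule laws)
  ultimately show ?thesis unfolding lie_algebra_def by blast
qed

lemma mp_class_closed [simp]: "mp_class A d R x \<in> carrier (mp_lie A d R)"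
  by (simp add: mp_lie_simps)

lemma el_closed [simp]:
  "elT A d R T \<in> carrier (mp_lie A d R)" "elE A d R i \<in> carrier (mp_lie A d R)"
  "elF A d R i \<in> carrier (mp_lie A d R)"
  by (simp_all add: elT_def elE_def elF_def)

lemma mp_relations:
  "elT A d R (S + T) = elT A d R S \<oplus>\<^bsub>mp_lie A d R\<^esub> elT A d R T"
  "elT A d R (hscale R c T) = c \<odot>\<^bsub>mp_lie A d R\<^esub> elT A d R T"
  "bracket (mp_lie A d R) (elT A d R S) (elT A d R T) = \<zero>\<^bsub>mp_lie A d R\<^esub>"
  "bracket (mp_lie A d R) (elT A d R T) (elE A d R j) = root R j T \<odot>\<^bsub>mp_lie A d R\<^esub> elE A d R j"
  "bracket (mp_lie A d R) (elT A d R T) (elF A d R j) = (- root R j T) \<odot>\<^bsub>mp_lie A d R\<^esub> elF A d R j"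
  "bracket (mp_lie A d R) (elE A d R i) (elF A d R i) = (1 / (2 * of_nat (d i))) \<odot>\<^bsub>mp_lie A d R\<^esub>
     (elT A d R (coroot_plus R i) \<oplus>\<^bsub>mp_lie A d R\<^esub> elT A d R (coroot_minus R i))"
  "i \<noteq> j \<Longrightarrow> bracket (mp_lie A d R) (elE A d R i) (elF A d R j) = \<zero>\<^bsub>mp_lie A d R\<^esub>"
  unfolding elT_def elE_def elF_def mp_lie_simps
  by (rule mp_classI; (rule mp_eq.intros(21-27))?; assumption?)+

lemma iterated_bracket:
  "(bracket (mp_lie A d R) (mp_class A d R x) ^^ n) (mp_class A d R y) = mp_class A d R ((Brk x ^^ n) y)"
  by (induction n) (simp_all add: mp_lie_simps)

lemma mp_serre:
  assumes "i \<noteq> j"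
  shows "(bracket (mp_lie A d R) (elE A d R i) ^^ nat (1 - A $ i $ j)) (elE A d R j) = \<zero>\<^bsub>mp_lie A d R\<^esub>"
    and "(bracket (mp_lie A d R) (elF A d R i) ^^ nat (1 - A $ i $ j)) (elF A d R j) = \<zero>\<^bsub>mp_lie A d R\<^esub>"
  unfolding elE_def elF_def iterated_bracket mp_lie_simps
  by (rule mp_classI, rule mp_eq.serre_E, rule assms)
    (rule mp_classI, rule mp_eq.serre_F, rule assms)

text \<open>The values lie in the tensor square of the quotient, on which the Lie algebra acts
  before any cobracket exists; what is left to prove is that equivalent terms get equal
  values.\<close>

primrec term_cobracket ::
    "('k, 'h, 'n) lie_term \<Rightarrow> (('k, 'h, 'n) mp_elem \<times> ('k, 'h, 'n) mp_elem \<Rightarrow>\<^sub>0 'k) set" where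
  "term_cobracket (GenT T) = \<zero>\<^bsub>tensor (mp_lie A d R) (mp_lie A d R)\<^esub>"
| "term_cobracket (GenE i) = wedge (mp_lie A d R) (elT A d R (coroot_plus R i)) (elE A d R i)"
| "term_cobracket (GenF i) = wedge (mp_lie A d R) (elT A d R (coroot_minus R i)) (elF A d R i)"
| "term_cobracket Zero = \<zero>\<^bsub>tensor (mp_lie A d R) (mp_lie A d R)\<^esub>"
| "term_cobracket (Plus x y) =
    term_cobracket x \<oplus>\<^bsub>tensor (mp_lie A d R) (mp_lie A d R)\<^esub> term_cobracket y"
| "term_cobracket (Scal c x) = c \<odot>\<^bsub>tensor (mp_lie A d R) (mp_lie A d R)\<^esub> term_cobracket x"
| "term_cobracket (Brk x y) =
    tensor_ad (mp_lie A d R) (mp_class A d R x) (term_cobracket y)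
    \<ominus>\<^bsub>tensor (mp_lie A d R) (mp_lie A d R)\<^esub> tensor_ad (mp_lie A d R) (mp_class A d R y) (term_cobracket x)"

text \<open>Each clause preserves sums of wedges, the one for \<open>Brk\<close> because they are
  stable under the action. The argument is on terms and so precedes well-definedness.\<close>

lemma term_cobracket_alternating: "term_cobracket x \<in> alternating (mp_lie A d R)"
  using lie_algebra_mp_lie
  by (induction x) (simp_all add: alternating_zero alternating.intros alternating_smult
      alternating_diff alternating_ad)

lemma term_cobracket_closed: "term_cobracket x \<in> carrier (tensor (mp_lie A d R) (mp_lie A d R))"
  using alternating_closed[OF lie_algebra_mp_lie term_cobracket_alternating] .

end

context
  fixes A :: "int^'n^'n" and d :: "'n::finite \<Rightarrow> nat"
    and P :: "'k::field_char_0^'n^'n"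
    and R :: "('k, 'h::ab_group_add, 'n) realization"
  assumes A: "gen_cartan_matrix A" and P: "cartan_type A d P" and R: "is_realization P R"
begin

lemma cartan_type_entries: "P $ i $ j + P $ j $ i = 2 * (of_nat (d i) * of_int (A $ i $ j))"
  using P by (simp add: cartan_type_def vec_eq_iff transpose_def)

lemma cartan_type_diag: "P $ i $ i = 2 * of_nat (d i)"
  using cartan_type_entries[of i i] A by (simp add: gen_cartan_matrix_def)

lemma root_coroot: "root R j (coroot_plus R i) = P $ i $ j" "root R j (coroot_minus R i) = P $ j $ i"
  using R by (simp_all add: is_realization_def)

text \<open>ad(E_i) sends T_j^- to - p_ij E_i and ad(F_j) sends T_i^+ to p_ij F_j, so the multiples
  of E_i \<and> F_j cancel and (T_i^+ + T_j^-) \<and> [E_i,F_j] remains. For i \<noteq> j the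
  bracket is zero; for i = j both factors are multiples of T_i^+ + T_i^-.\<close>

lemma term_cobracket_EF:
  "term_cobracket A d R (Brk (GenE i) (GenF j)) = \<zero>\<^bsub>tensor (mp_lie A d R) (mp_lie A d R)\<^esub>"
proof -
  note LL = lie_algebra_mp_lie[of A d R] and V = lie_vspace[OF lie_algebra_mp_lie[of A d R]]
  have rev: "bracket (mp_lie A d R) (elE A d R i) (elT A d R T) = \<ominus>\<^bsub>mp_lie A d R\<^esub> (root R i T \<odot>\<^bsub>mp_lie A d R\<^esub> elE A d R i)"
    "bracket (mp_lie A d R) (elF A d R j) (elT A d R T) = \<ominus>\<^bsub>mp_lie A d R\<^esub> ((- root R j T) \<odot>\<^bsub>mp_lie A d R\<^esub> elF A d R j)"
    "bracket (mp_lie A d R) (elF A d R j) (elE A d R i) = \<ominus>\<^bsub>mp_lie A d R\<^esub> bracket (mp_lie A d R) (elE A d R i) (elF A d R j)" for T i j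
    using bracket_anti[OF LL, of "elE A d R i" "elT A d R T"] bracket_anti[OF LL, of "elF A d R j" "elT A d R T"]
      bracket_anti[OF LL, of "elF A d R j" "elE A d R i"] by (simp_all add: mp_relations)
  have anti: "emb (tensor (mp_lie A d R) (mp_lie A d R)) (wedge (mp_lie A d R) x y) = - emb (tensor (mp_lie A d R) (mp_lie A d R)) (wedge (mp_lie A d R) y x)"
    if "x \<in> carrier (mp_lie A d R)" "y \<in> carrier (mp_lie A d R)" for x y
    using wedge_anti[OF LL that(2,1)] that by (simp add: emb_minus wedge_closed[OF LL] V)
  have self: "wedge (mp_lie A d R) x x = \<zero>\<^bsub>tensor (mp_lie A d R) (mp_lie A d R)\<^esub>" if "x \<in> carrier (mp_lie A d R)" for x
    using that by (intro vs_eqI[OF vspace_tensor2[OF LL]]) (simp_all add: wedge_def V emb_simps)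
  show ?thesis
    unfolding term_cobracket.simps elE_def[symmetric] elF_def[symmetric]
    using anti[of "elF A d R j" "elE A d R i"] anti[of "elT A d R (coroot_plus R i)" "elT A d R (coroot_minus R i)"]
    by (cases "i = j"; intro vs_eqI[OF vspace_tensor2[OF LL]])
      (simp_all add: tensor_ad_wedge[OF LL] rev mp_relations root_coroot wedge_bilinear[OF LL] wedge_group[OF LL]
        wedge_closed[OF LL] V emb_simps bracket_closed[OF LL] tensor_ad_closed[OF LL] self free.scale_right_distrib)
qed

text \<open>In the formula of \<open>cocycle_iterate\<close> the first wedge has the Serre element
  itself as a factor, which is already zero in the quotient; Cartan type takes care of the
  coefficient of the second.\<close>

lemma term_cobracket_serre:
  assumes "i \<noteq> j"
  shows "term_cobracket A d R ((Brk (GenE i) ^^ nat (1 - A $ i $ j)) (GenE j)) = \<zero>\<^bsub>tensor (mp_lie A d R) (mp_lie A d R)\<^esub>"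
    and "term_cobracket A d R ((Brk (GenF i) ^^ nat (1 - A $ i $ j)) (GenF j)) = \<zero>\<^bsub>tensor (mp_lie A d R) (mp_lie A d R)\<^esub>"
proof -
  note LL = lie_algebra_mp_lie[of A d R] and V = lie_vspace[OF lie_algebra_mp_lie[of A d R]]
  \<comment> \<open>Off the diagonal a_ij is at most 0; with n = - a_ij the exponent 1 - a_ij is
    \<open>Suc n\<close>.\<close>
  obtain n where n: "A $ i $ j = - int n"
    using A assms nonpos_int_cases unfolding gen_cartan_matrix_def by metis
  then have m: "nat (1 - A $ i $ j) = Suc n" by simp
  have coeff: "of_nat n * P $ i $ i + P $ i $ j + P $ j $ i = 0"
    unfolding add.assoc cartan_type_entries cartan_type_diag n by (simp add: algebra_simps)
  \<comment> \<open>On the F_i the weights change sign, and passing from T_i^+ to T_i^- exchanges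
    p_ij and p_ji; the sum is the negative of the previous one.\<close>
  have coeff': "of_nat n * (- P $ i $ i) + (- P $ j $ i) + (- P $ i $ j) = 0"
  proof -
    have "of_nat n * (- P $ i $ i) + (- P $ j $ i) + (- P $ i $ j) = - (of_nat n * P $ i $ i + P $ i $ j + P $ j $ i)"
      by (simp add: algebra_simps)
    then show ?thesis unfolding coeff by simp
  qed
  have vanish: "wedge (mp_lie A d R) U \<zero>\<^bsub>mp_lie A d R\<^esub> \<oplus>\<^bsub>tensor (mp_lie A d R) (mp_lie A d R)\<^esub>
      (- (k * z)) \<odot>\<^bsub>tensor (mp_lie A d R) (mp_lie A d R)\<^esub> wedge (mp_lie A d R) e X = \<zero>\<^bsub>tensor (mp_lie A d R) (mp_lie A d R)\<^esub>"
    if "U \<in> carrier (mp_lie A d R)" "e \<in> carrier (mp_lie A d R)" "X \<in> carrier (mp_lie A d R)" "z = 0" for U e X k z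
    using that by (intro vs_eqI[OF vspace_tensor2[OF LL]])
      (simp_all add: wedge_group[OF LL] wedge_closed[OF LL] V emb_simps)
  have "term_cobracket A d R ((Brk (GenE i) ^^ Suc n) (GenE j)) =
    wedge (mp_lie A d R) (of_nat (Suc n) \<odot>\<^bsub>mp_lie A d R\<^esub> elT A d R (coroot_plus R i) \<oplus>\<^bsub>mp_lie A d R\<^esub> elT A d R (coroot_plus R j))
      ((bracket (mp_lie A d R) (elE A d R i) ^^ Suc n) (elE A d R j)) \<oplus>\<^bsub>tensor (mp_lie A d R) (mp_lie A d R)\<^esub>
    (- (of_nat (Suc n) * (of_nat n * P $ i $ i + P $ i $ j + P $ j $ i))) \<odot>\<^bsub>tensor (mp_lie A d R) (mp_lie A d R)\<^esub>
      wedge (mp_lie A d R) (elE A d R i) ((bracket (mp_lie A d R) (elE A d R i) ^^ n) (elE A d R j))"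
    by (rule cocycle_iterate[OF LL, where G = "\<lambda>n. term_cobracket A d R ((Brk (GenE i) ^^ n) (GenE j))"])
      (simp_all add: mp_relations root_coroot, simp_all add: elE_def iterated_bracket)
  also have "\<dots> = \<zero>\<^bsub>tensor (mp_lie A d R) (mp_lie A d R)\<^esub>"
    unfolding mp_serre(1)[OF assms, of A d R, unfolded m]
    by (rule vanish) (simp_all add: V coeff elE_def iterated_bracket del: funpow.simps)
  finally show "term_cobracket A d R ((Brk (GenE i) ^^ nat (1 - A $ i $ j)) (GenE j)) = \<zero>\<^bsub>tensor (mp_lie A d R) (mp_lie A d R)\<^esub>"
    unfolding m .
  have "term_cobracket A d R ((Brk (GenF i) ^^ Suc n) (GenF j)) =
    wedge (mp_lie A d R) (of_nat (Suc n) \<odot>\<^bsub>mp_lie A d R\<^esub> elT A d R (coroot_minus R i) \<oplus>\<^bsub>mp_lie A d R\<^esub> elT A d R (coroot_minus R j))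
      ((bracket (mp_lie A d R) (elF A d R i) ^^ Suc n) (elF A d R j)) \<oplus>\<^bsub>tensor (mp_lie A d R) (mp_lie A d R)\<^esub>
    (- (of_nat (Suc n) * (of_nat n * (- P $ i $ i) + (- P $ j $ i) + (- P $ i $ j)))) \<odot>\<^bsub>tensor (mp_lie A d R) (mp_lie A d R)\<^esub>
      wedge (mp_lie A d R) (elF A d R i) ((bracket (mp_lie A d R) (elF A d R i) ^^ n) (elF A d R j))"
    by (rule cocycle_iterate[OF LL, where G = "\<lambda>n. term_cobracket A d R ((Brk (GenF i) ^^ n) (GenF j))"])
      (simp_all add: mp_relations root_coroot, simp_all add: elF_def iterated_bracket)
  also have "\<dots> = \<zero>\<^bsub>tensor (mp_lie A d R) (mp_lie A d R)\<^esub>"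
    unfolding mp_serre(2)[OF assms, of A d R, unfolded m]
    by (rule vanish) (use coeff' in \<open>simp_all add: V elF_def iterated_bracket del: funpow.simps\<close>)
  finally show "term_cobracket A d R ((Brk (GenF i) ^^ nat (1 - A $ i $ j)) (GenF j)) = \<zero>\<^bsub>tensor (mp_lie A d R) (mp_lie A d R)\<^esub>"
    unfolding m .
qed

context
begin

private lemmas LL = lie_algebra_mp_lie[of A d R]
private lemmas V2 = vspace_tensor2[OF lie_algebra_mp_lie[of A d R]]
private lemmas eqI = vs_eqI[OF V2]
private lemmas rules = lie_vspace[OF LL] V2 emb_simps term_cobracket_closed tensor_ad_closed[OF LL] tensor_ad_linear[OF LL] tensor_ad_zero[OF LL]
    tensor_ad_add_left[OF LL] tensor_ad_smult_left[OF LL] tensor_ad_zero_left[OF LL] tensor_ad_bracket[OF LL]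
    mp_lie_simps(3-5)[symmetric] mp_lie_simps(2)[symmetric] wedge_closed[OF LL] bracket_closed[OF LL] tensor_ad_wedge[OF LL]
    elT_def[symmetric] elE_def[symmetric] elF_def[symmetric] wedge_bilinear[OF LL] wedge_group[OF LL]

text \<open>The vector space laws hold by linearity of the recursion, and \<open>jacobi\<close>
  because the tensor square is a representation. For \<open>rel_TE\<close> and
  \<open>rel_TF\<close>, a toral element kills the coroot in the wedge and scales the other
  factor.\<close>

lemma term_cobracket_cong: "mp_eq A d R x y \<Longrightarrow> term_cobracket A d R x = term_cobracket A d R y"
proof (induction rule: mp_eq.induct)
  \<comment> \<open>The clause for \<open>Brk\<close> acts through the classes of its arguments, so
    equivalent arguments act alike.\<close>
  case (brk_cong x x' y y')
  have "mp_class A d R x = mp_class A d R x'" "mp_class A d R y = mp_class A d R y'"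
    using brk_cong by (simp_all add: mp_class_eq_iff)
  with brk_cong show ?case by simp
next
  \<comment> \<open>Both sides vanish, the right one being a combination of toral
    generators.\<close>
  case (rel_EF_same i)
  show ?case
    unfolding term_cobracket_EF by (rule eqI) (simp_all add: rules)
next
  case (rel_EF_diff i j)
  show ?case unfolding term_cobracket_EF by simp
next
  case (serre_E i j)
  then show ?case by (simp add: term_cobracket_serre)
next
  case (serre_F i j)
  then show ?case by (simp add: term_cobracket_serre)
next
  case (jacobi x y z)
  let ?x = "mp_class A d R x" and ?y = "mp_class A d R y" and ?z = "mp_class A d R z"
  show ?case
    by (rule eqI) (simp_all add: rules)
next
  case (rel_TE T j)
  show ?case
    by (rule eqI) (simp_all add: rules mp_relations)
next
  case (rel_TF T j)
  show ?case
    by (rule eqI) (simp_all add: rules mp_relations)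
\<comment> \<open>The five plain \<open>simp\<close> calls take reflexivity, symmetry, transitivity
  and the congruences of \<open>Plus\<close> and \<open>Scal\<close>.\<close>
qed (simp, simp, simp, simp, simp, (rule eqI; simp add: rules free.scale_left_distrib free.scale_right_distrib algebra_simps)+)

end

end

section \<open>Cocycles with values in the tensor square\<close>

lemma mod_hom_finsum:
  assumes "vspace M" "vspace N" "f \<in> mod_hom M N" "finite I" "\<And>i. i \<in> I \<Longrightarrow> g i \<in> carrier M"
  shows "f (finsum M g I) = (\<Oplus>\<^bsub>N\<^esub>i \<in> I. f (g i))"
proof -
  interpret M: Module.module field_ring M by fact
  interpret N: Module.module field_ring N by fact
  from assms(4,5) show ?thesis
  proof (induction I rule: finite_induct)
    case (insert i I)
    then show ?case
      using assms(1,2) mod_hom_add[OF assms(3)] mod_hom_closed[OF assms(3)] by (simp add: Pi_def)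
  qed (use assms in \<open>simp add: mod_hom_zero\<close>)
qed

lemma mp_with_simps:
  "carrier (mp_with A d R \<delta>) = carrier (mp_lie A d R)" "zero (mp_with A d R \<delta>) = zero (mp_lie A d R)"
  "add (mp_with A d R \<delta>) = add (mp_lie A d R)" "smult (mp_with A d R \<delta>) = smult (mp_lie A d R)"
  "bracket (mp_with A d R \<delta>) = bracket (mp_lie A d R)" "cobracket (mp_with A d R \<delta>) = \<delta>"
  by (simp_all add: mp_with_def lie.defs lie_bialg.defs)

lemma twist_bialgebra_simps:
  "carrier (twist_bialgebra L c) = carrier L" "zero (twist_bialgebra L c) = zero L"
  "add (twist_bialgebra L c) = add L" "smult (twist_bialgebra L c) = smult L"
  "bracket (twist_bialgebra L c) = bracket L"
  "cobracket (twist_bialgebra L c) x = cobracket L x \<ominus>\<^bsub>tensor L L\<^esub> tensor_ad L x c"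
  by (simp_all add: twist_bialgebra_def)

definition cocycle :: "('k::field, 'a, 'm) lie_scheme \<Rightarrow> ('a \<Rightarrow> ('a \<times> 'a \<Rightarrow>\<^sub>0 'k) set) \<Rightarrow> bool" where
  "cocycle L \<delta> \<longleftrightarrow> \<delta> \<in> mod_hom L (tensor L L) \<and> (\<forall>x \<in> carrier L. \<forall>y \<in> carrier L.
     \<delta> (bracket L x y) = tensor_ad L x (\<delta> y) \<ominus>\<^bsub>tensor L L\<^esub> tensor_ad L y (\<delta> x))"

lemma cocycleD:
  assumes "cocycle L \<delta>"
  shows "\<delta> \<in> mod_hom L (tensor L L)"
    and "x \<in> carrier L \<Longrightarrow> y \<in> carrier L \<Longrightarrow>
      \<delta> (bracket L x y) = tensor_ad L x (\<delta> y) \<ominus>\<^bsub>tensor L L\<^esub> tensor_ad L y (\<delta> x)"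
  using assms by (simp_all add: cocycle_def)

text \<open>x \<mapsto> ad_x(c) is a coboundary: for every tensor c its cocycle rule is
  \<open>tensor_ad_bracket\<close>.\<close>

lemma cocycle_twist:
  assumes L: "lie_algebra L" and \<delta>: "cocycle L \<delta>" and c: "c \<in> carrier (tensor L L)"
  shows "cocycle L (\<lambda>x. \<delta> x \<ominus>\<^bsub>tensor L L\<^esub> tensor_ad L x c)"
proof -
  note V = vspace_tensor2[OF L]
  note rules = V lie_vspace[OF L] emb_simps mod_hom_closed[OF cocycleD(1)[OF \<delta>]] mod_hom_add[OF cocycleD(1)[OF \<delta>]]
    mod_hom_smult[OF cocycleD(1)[OF \<delta>]] cocycleD(2)[OF \<delta>] c tensor_ad_closed[OF L] tensor_ad_linear[OF L]
    tensor_ad_add_left[OF L] tensor_ad_smult_left[OF L] tensor_ad_bracket[OF L] bracket_closed[OF L]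
    free.scale_right_diff_distrib
  show ?thesis
    unfolding cocycle_def
    by (intro conjI ballI mod_homI; (rule vs_eqI[OF V])?) (simp_all add: rules)
qed

lemma tensor_map_id:
  assumes "lie_algebra L" "U \<in> carrier (tensor L L)"
  shows "tensor_map L L (\<lambda>x. x) U = U"
proof -
  note V = lie_vspace[OF assms(1)] lie_vspace[OF assms(1)]
  note \<beta> = vspace_tensor[OF V] bilinear_pure_tensor[OF V]
  have "tensor_map L L (\<lambda>x. x) \<in> mod_hom (tensor L L) (tensor L L)"
    unfolding tensor_map_def by (rule tensor_lift_hom[OF V \<beta>])
  moreover have "(\<lambda>U. U) \<in> mod_hom (tensor L L) (tensor L L)" by (simp add: mod_hom_def)
  moreover have "tensor_map L L (\<lambda>x. x) (pure_tensor L L x y) = pure_tensor L L x y"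
    if "x \<in> carrier L" "y \<in> carrier L" for x y
    unfolding tensor_map_def by (rule tensor_lift_pure[OF V \<beta> that])
  ultimately show ?thesis by (rule tensor_hom_eqI[OF V _ _ _ assms(2)])
qed

text \<open>Induction over a term that represents X: linearity and the cocycle rule carry agreement
  through the constructors, and the leaves are generators or zero.\<close>

lemma cocycle_eqI:
  assumes \<delta>: "cocycle (mp_lie A d R) \<delta>" and \<delta>': "cocycle (mp_lie A d R) \<delta>'"
    and gens: "\<And>T. \<delta> (elT A d R T) = \<delta>' (elT A d R T)" "\<And>i. \<delta> (elE A d R i) = \<delta>' (elE A d R i)"
      "\<And>i. \<delta> (elF A d R i) = \<delta>' (elF A d R i)"
    and X: "X \<in> carrier (mp_lie A d R)"
  shows "\<delta> X = \<delta>' X"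
proof -
  note LL = lie_algebra_mp_lie[of A d R]
  have "\<delta> (mp_class A d R x) = \<delta>' (mp_class A d R x)" for x
  proof (induction x)
    case Zero
    show ?case
      using mod_hom_zero[OF lie_vspace[OF LL] vspace_tensor2[OF LL] cocycleD(1)[OF \<delta>]]
        mod_hom_zero[OF lie_vspace[OF LL] vspace_tensor2[OF LL] cocycleD(1)[OF \<delta>']]
      by (simp add: mp_lie_simps)
  next
    case (Plus x y)
    then show ?case
      using mod_hom_add[OF cocycleD(1)[OF \<delta>], of "mp_class A d R x" "mp_class A d R y"]
        mod_hom_add[OF cocycleD(1)[OF \<delta>'], of "mp_class A d R x" "mp_class A d R y"]
      by (simp add: mp_lie_simps(3))
  next
    case (Scal c x)
    then show ?case
      using mod_hom_smult[OF cocycleD(1)[OF \<delta>], of "mp_class A d R x" c]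
        mod_hom_smult[OF cocycleD(1)[OF \<delta>'], of "mp_class A d R x" c]
      by (simp add: mp_lie_simps(4))
  next
    case (Brk x y)
    then show ?case
      using cocycleD(2)[OF \<delta>, of "mp_class A d R x" "mp_class A d R y"]
        cocycleD(2)[OF \<delta>', of "mp_class A d R x" "mp_class A d R y"]
      by (simp add: mp_lie_simps(5))
  qed (use gens in \<open>simp_all add: elT_def elE_def elF_def\<close>)
  with X show ?thesis by (auto simp: mp_lie_simps)
qed

text \<open>The restriction makes it extensional, as the description in \<open>mplba\<close> demands
  in order to single out one function.\<close>

definition mp_cobracket where
  "mp_cobracket A d R =
    restrict (\<lambda>X. term_cobracket A d R (SOME x. x \<in> X)) (carrier (mp_lie A d R))"

context
  fixes A :: "int^'n^'n" and d :: "'n::finite \<Rightarrow> nat"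
    and P :: "'k::field_char_0^'n^'n"
    and R :: "('k, 'h::ab_group_add, 'n) realization"
  assumes A: "gen_cartan_matrix A" and P: "cartan_type A d P" and R: "is_realization P R"
begin

lemma mp_cobracket_class: "mp_cobracket A d R (mp_class A d R x) = term_cobracket A d R x"
proof -
  have "(SOME y. y \<in> mp_class A d R x) \<in> mp_class A d R x"
    by (rule someI[of _ x]) (simp add: mp_class_def mp_eq.refl)
  then have "term_cobracket A d R x = term_cobracket A d R (SOME y. y \<in> mp_class A d R x)"
    by (intro term_cobracket_cong[OF A P R]) (simp add: mp_class_def)
  then show ?thesis by (simp add: mp_cobracket_def)
qed

lemma mp_cobracket_generators:
  "mp_cobracket A d R (elT A d R T) = \<zero>\<^bsub>tensor (mp_lie A d R) (mp_lie A d R)\<^esub>"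
  "mp_cobracket A d R (elE A d R i) = wedge (mp_lie A d R) (elT A d R (coroot_plus R i)) (elE A d R i)"
  "mp_cobracket A d R (elF A d R i) = wedge (mp_lie A d R) (elT A d R (coroot_minus R i)) (elF A d R i)"
  unfolding elT_def[of _ _ _ T] elE_def[of _ _ _ i] elF_def[of _ _ _ i] mp_cobracket_class
  by (simp_all add: elE_def elF_def)

lemma mp_cobracket_cocycle: "cocycle (mp_lie A d R) (mp_cobracket A d R)"
  unfolding cocycle_def
proof (intro conjI ballI mod_homI)
  fix X Y assume "X \<in> carrier (mp_lie A d R)" "Y \<in> carrier (mp_lie A d R)"
  then obtain x y where "X = mp_class A d R x" "Y = mp_class A d R y" by (auto simp: mp_lie_simps)
  then show "mp_cobracket A d R (X \<oplus>\<^bsub>mp_lie A d R\<^esub> Y) =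
      mp_cobracket A d R X \<oplus>\<^bsub>tensor (mp_lie A d R) (mp_lie A d R)\<^esub> mp_cobracket A d R Y"
    "mp_cobracket A d R (bracket (mp_lie A d R) X Y) =
      tensor_ad (mp_lie A d R) X (mp_cobracket A d R Y) \<ominus>\<^bsub>tensor (mp_lie A d R) (mp_lie A d R)\<^esub>
      tensor_ad (mp_lie A d R) Y (mp_cobracket A d R X)"
    by (simp_all add: mp_lie_simps mp_cobracket_class)
next
  fix X c assume "X \<in> carrier (mp_lie A d R)"
  then obtain x where "X = mp_class A d R x" by (auto simp: mp_lie_simps)
  then show "mp_cobracket A d R X \<in> carrier (tensor (mp_lie A d R) (mp_lie A d R))"
    "mp_cobracket A d R (c \<odot>\<^bsub>mp_lie A d R\<^esub> X) =
      c \<odot>\<^bsub>tensor (mp_lie A d R) (mp_lie A d R)\<^esub> mp_cobracket A d R X"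
    by (simp_all add: mp_lie_simps mp_cobracket_class term_cobracket_closed)
qed

lemma mp_cobracket_alternating:
  "X \<in> carrier (mp_lie A d R) \<Longrightarrow> mp_cobracket A d R X \<in> alternating (mp_lie A d R)"
  by (auto simp: mp_lie_simps mp_cobracket_class term_cobracket_alternating)

lemma mp_co_jacobi:
  assumes "X \<in> carrier (mp_lie A d R)"
  shows "co_jacobiator (mp_lie A d R) (mp_cobracket A d R) X = \<zero>\<^bsub>tensor3 (mp_lie A d R)\<^esub>"
proof -
  note LL = lie_algebra_mp_lie[of A d R]
  note V = lie_vspace[OF LL] and V3 = vspace_tensor3[OF LL]
  note hom = cocycleD(1)[OF mp_cobracket_cocycle] and brk = cocycleD(2)[OF mp_cobracket_cocycle]
  note J = co_jacobiator_hom[OF LL hom]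
  \<comment> \<open>E_i and F_i both have a cobracket of the shape t \<and> x with t toral, and
    toral elements have cobracket zero.\<close>
  note wedge = co_jacobiator_wedge[OF LL hom mp_cobracket_generators(1)]
  have "co_jacobiator (mp_lie A d R) (mp_cobracket A d R) (mp_class A d R x) = \<zero>\<^bsub>tensor3 (mp_lie A d R)\<^esub>" for x
  proof (induction x)
    case (GenT T)
    show ?case
      using co_jacobiator_zero[OF LL hom mp_cobracket_generators(1)] by (simp add: elT_def)
  next
    case (GenE i)
    show ?case using wedge[OF mp_cobracket_generators(2)] by (simp add: elE_def)
  next
    case (GenF i)
    show ?case using wedge[OF mp_cobracket_generators(3)] by (simp add: elF_def)
  next
    case Zero
    show ?case using mod_hom_zero[OF V V3 J] by (simp add: mp_lie_simps)
  next
    case (Plus x y)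
    then show ?case
      using mod_hom_add[OF J, of "mp_class A d R x" "mp_class A d R y"]
      by (intro vs_eqI[OF V3]) (simp_all add: mp_lie_simps(3) V3 emb_simps)
  next
    case (Scal c x)
    then show ?case
      using mod_hom_smult[OF J, of "mp_class A d R x" c] by (simp add: mp_lie_simps(4) V3 vs_zero_smult)
  next
    case (Brk x y)
    have "co_jacobiator (mp_lie A d R) (mp_cobracket A d R)
        (bracket (mp_lie A d R) (mp_class A d R x) (mp_class A d R y)) = \<zero>\<^bsub>tensor3 (mp_lie A d R)\<^esub>"
    proof (subst co_jacobiator_bracket[OF LL hom])
      show "tensor3_ad (mp_lie A d R) (mp_class A d R x) (co_jacobiator (mp_lie A d R) (mp_cobracket A d R) (mp_class A d R y))
          \<ominus>\<^bsub>tensor3 (mp_lie A d R)\<^esub>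
          tensor3_ad (mp_lie A d R) (mp_class A d R y) (co_jacobiator (mp_lie A d R) (mp_cobracket A d R) (mp_class A d R x)) =
          \<zero>\<^bsub>tensor3 (mp_lie A d R)\<^esub>"
        unfolding Brk mod_hom_zero[OF V3 V3 tensor3_ad_hom[OF LL mp_class_closed]]
        by (rule vs_eqI[OF V3]) (simp_all add: V3 emb_simps)
    qed (simp_all add: mp_cobracket_alternating brk)
    then show ?case by (simp add: mp_lie_simps(5))
  qed
  with assms show ?thesis by (auto simp: mp_lie_simps)
qed

text \<open>Formulated for any record and with agreement on the carrier only, so as to cover the
  candidate for \<open>mplba\<close> as well as a twisted record, whose cobracket is given by
  another formula.\<close>

lemma mp_lie_bialgebraI:
  fixes B :: "('k, ('k, 'h, 'n) mp_elem, 'm) lie_bialg_scheme"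
  assumes B: "carrier B = carrier (mp_lie A d R)" "zero B = zero (mp_lie A d R)"
    "add B = add (mp_lie A d R)" "smult B = smult (mp_lie A d R)" "bracket B = bracket (mp_lie A d R)"
    and \<delta>: "\<And>X. X \<in> carrier (mp_lie A d R) \<Longrightarrow> cobracket B X = mp_cobracket A d R X"
  shows "lie_bialgebra B"
proof (rule lie_bialgebraI)
  note LL = lie_algebra_mp_lie[of A d R]
  note cong = tensor_cong[OF B] tensor3_cong[OF B] tensor_ad_cong[OF B] mod_hom_cong[OF B]
    alternating_cong[OF B LL] co_jacobiator_cong_lie[OF B LL]
  note hom = cocycleD(1)[OF mp_cobracket_cocycle]
  have hom': "cobracket B \<in> mod_hom (mp_lie A d R) (tensor (mp_lie A d R) (mp_lie A d R))"
    using hom lie_vspace[OF LL] by (auto simp: mod_hom_def \<delta>)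
  show "lie_algebra B" by (rule lie_algebra_cong[OF B LL])
  show "cobracket B \<in> mod_hom B (tensor B B)" unfolding cong by (rule hom')
  show "cobracket B X \<in> alternating B" if "X \<in> carrier B" for X
    using that mp_cobracket_alternating by (simp add: cong \<delta> B)
  show "co_jacobiator B (cobracket B) X = \<zero>\<^bsub>tensor3 B\<^esub>" if "X \<in> carrier B" for X
    using that co_jacobiator_cong[OF LL hom' hom \<delta>] mp_co_jacobi unfolding cong(2) by (simp add: cong B)
  show "cobracket B (bracket B X Y) =
      tensor_ad B X (cobracket B Y) \<ominus>\<^bsub>tensor B B\<^esub> tensor_ad B Y (cobracket B X)"
    if "X \<in> carrier B" "Y \<in> carrier B" for X Y
    using that cocycleD(2)[OF mp_cobracket_cocycle] bracket_closed[OF LL] by (simp add: cong B \<delta>)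
qed

text \<open>Existence is \<open>mp_lie_bialgebraI\<close>. Any other candidate is a cocycle, as part
  of being a Lie bialgebra, so \<open>cocycle_eqI\<close> gives agreement on the carrier and
  extensionality settles the rest.\<close>

lemma mplba_eq: "mplba A d R = mp_with A d R (mp_cobracket A d R)"
proof -
  have ext: "mp_cobracket A d R \<in> extensional (carrier (mp_lie A d R))"
    by (simp add: mp_cobracket_def)
  have "(THE \<delta>. \<delta> \<in> extensional (carrier (mp_lie A d R)) \<and> lie_bialgebra (mp_with A d R \<delta>) \<and>
     (\<forall>T. \<delta> (elT A d R T) = \<zero>\<^bsub>tensor (mp_lie A d R) (mp_lie A d R)\<^esub>) \<and>
     (\<forall>i. \<delta> (elE A d R i) = wedge (mp_lie A d R) (elT A d R (coroot_plus R i)) (elE A d R i)) \<and>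
     (\<forall>i. \<delta> (elF A d R i) = wedge (mp_lie A d R) (elT A d R (coroot_minus R i)) (elF A d R i))) =
     mp_cobracket A d R"
  proof (rule the_equality, intro conjI allI)
    show "lie_bialgebra (mp_with A d R (mp_cobracket A d R))"
      by (rule mp_lie_bialgebraI) (simp_all add: mp_with_simps)
  next
    fix \<delta> assume *: "\<delta> \<in> extensional (carrier (mp_lie A d R)) \<and> lie_bialgebra (mp_with A d R \<delta>) \<and>
     (\<forall>T. \<delta> (elT A d R T) = \<zero>\<^bsub>tensor (mp_lie A d R) (mp_lie A d R)\<^esub>) \<and>
     (\<forall>i. \<delta> (elE A d R i) = wedge (mp_lie A d R) (elT A d R (coroot_plus R i)) (elE A d R i)) \<and>
     (\<forall>i. \<delta> (elF A d R i) = wedge (mp_lie A d R) (elT A d R (coroot_minus R i)) (elF A d R i))"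
    note eq = mp_with_simps(1-5)[of A d R \<delta>]
    have \<delta>: "cocycle (mp_lie A d R) \<delta>"
      using * unfolding lie_bialgebra_def cocycle_def
      by (simp add: mp_with_simps tensor_cong[OF eq] tensor_ad_cong[OF eq] mod_hom_cong[OF eq])
    show "\<delta> = mp_cobracket A d R"
    proof (rule extensionalityI)
      show "\<delta> X = mp_cobracket A d R X" if "X \<in> carrier (mp_lie A d R)" for X
        by (rule cocycle_eqI[OF \<delta> mp_cobracket_cocycle _ _ _ that])
          (simp_all add: * mp_cobracket_generators)
    qed (use * ext in blast)+
  qed (use ext in \<open>simp_all add: mp_cobracket_generators\<close>)
  then show ?thesis by (simp add: mplba_def)
qed

end

text \<open>Only the clause for [E_i,F_i] mentions coroots. Its right side contains a formal
  \<open>Plus\<close> of two generators, which \<open>gen_plus\<close> turns into the generator of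
  the sum, and this sum is common to R and R'.\<close>

lemma mp_eq_mono:
  assumes "hscale R' = hscale R" "root R' = root R"
    and "\<And>i. coroot_plus R' i + coroot_minus R' i = coroot_plus R i + coroot_minus R i"
    and "mp_eq A d R x y"
  shows "mp_eq A d R' x y"
  using assms(4)
proof (induction rule: mp_eq.induct)
  case (rel_EF_same i)
  have "mp_eq A d R' (Plus (GenT (coroot_plus R' i)) (GenT (coroot_minus R' i)))
      (Plus (GenT (coroot_plus R i)) (GenT (coroot_minus R i)))"
    using mp_eq.gen_plus[of A d R' "coroot_plus R' i" "coroot_minus R' i"]
      mp_eq.gen_plus[of A d R' "coroot_plus R i" "coroot_minus R i"] assms(3)[of i]
    by (auto intro: mp_eq.trans mp_eq.sym)
  then show ?case
    using mp_eq.trans[OF mp_eq.rel_EF_same mp_eq.scal_cong] by blast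
next
  case (gen_scal c T)
  show ?case using mp_eq.gen_scal[of A d R' c T] by (simp add: assms)
next
  case (rel_TE T j)
  show ?case using mp_eq.rel_TE[of A d R' T j] by (simp add: assms)
next
  case (rel_TF T j)
  show ?case using mp_eq.rel_TF[of A d R' T j] by (simp add: assms)
qed (rule mp_eq.intros(1-21,23,27-29); assumption)+

section \<open>Toral twists\<close>

context
  fixes A :: "int^'n^'n" and d :: "'n::finite \<Rightarrow> nat"
    and P :: "'k::field_char_0^'n^'n"
    and R :: "('k, 'h::ab_group_add, 'n) realization"
    and H :: "'g::finite \<Rightarrow> 'h" and \<Theta> :: "'k^'g^'g"
  assumes P: "cartan_type A d P" and R: "is_realization P R" and \<Theta>: "transpose \<Theta> = - \<Theta>"
begin

lemma antisymmetric_entries: "\<Theta> $ k $ g = - \<Theta> $ g $ k"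
  using arg_cong[OF \<Theta>, of "\<lambda>M. M $ g $ k"] by (simp add: transpose_def)

lemma antisymmetric_product:
  "root R i (H g) * \<Theta> $ k $ g * root R j (H k) = - (root R i (H g) * \<Theta> $ g $ k * root R j (H k))"
  using antisymmetric_entries[of k g] by simp

lemma root_coroot_shift:
  "root R j (coroot_shift R H \<Theta> i) = (\<Sum>g \<in> UNIV. \<Sum>k \<in> UNIV. root R i (H g) * \<Theta> $ k $ g * root R j (H k))"
proof -
  interpret Vector_Spaces.linear "hscale R" "(*)" "root R j"
    using R by (simp add: is_realization_def)
  show ?thesis by (simp add: coroot_shift_def sum scale)
qed

lemma twist_matrix_entries:
  "twist_matrix R H \<Theta> P $ i $ j = P $ i $ j -
    (\<Sum>g \<in> UNIV. \<Sum>k \<in> UNIV. root R i (H g) * \<Theta> $ g $ k * root R j (H k))"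
proof -
  have "(\<Sum>k \<in> UNIV. (\<Sum>g \<in> UNIV. root R i (H g) * \<Theta> $ g $ k) * root R j (H k)) =
    (\<Sum>g \<in> UNIV. \<Sum>k \<in> UNIV. root R i (H g) * \<Theta> $ g $ k * root R j (H k))"
    unfolding sum_distrib_right by (rule sum.swap)
  then show ?thesis
    by (simp add: twist_matrix_def matrix_matrix_mult_def root_matrix_def transpose_def)
qed

text \<open>The correction to P is antisymmetric along with \<Theta>, so it drops out of P +
  P^T.\<close>

lemma cartan_type_twist: "cartan_type A d (twist_matrix R H \<Theta> P)"
proof -
  have swap: "(\<Sum>g \<in> UNIV. \<Sum>k \<in> UNIV. root R j (H g) * \<Theta> $ g $ k * root R i (H k)) =
    - (\<Sum>g \<in> UNIV. \<Sum>k \<in> UNIV. root R i (H g) * \<Theta> $ g $ k * root R j (H k))" for i j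
    unfolding sum_negf[symmetric]
    by (subst sum.swap) (intro sum.cong HOL.refl, subst antisymmetric_product[symmetric], simp add: mult_ac)
  have "twist_matrix R H \<Theta> P $ i $ j + twist_matrix R H \<Theta> P $ j $ i = P $ i $ j + P $ j $ i" for i j
    using swap[of j i] unfolding twist_matrix_entries by simp
  with P show ?thesis by (simp add: cartan_type_def vec_eq_iff transpose_def)
qed

lemma twist_realization_simps:
  "hscale (twist_realization R H \<Theta>) = hscale R" "root (twist_realization R H \<Theta>) = root R"
  "coroot_plus (twist_realization R H \<Theta>) i = coroot_plus R i + coroot_shift R H \<Theta> i"
  "coroot_minus (twist_realization R H \<Theta>) i = coroot_minus R i - coroot_shift R H \<Theta> i"
  "coroot_mean (twist_realization R H \<Theta>) = coroot_mean R"
  by (simp_all add: twist_realization_def coroot_mean_def fun_eq_iff algebra_simps)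

text \<open>Scalars, roots and coroot means are those of R, so only the values of the roots on the
  shifted coroots have to be computed.\<close>

lemma is_realization_twist: "is_realization (twist_matrix R H \<Theta> P) (twist_realization R H \<Theta>)"
proof -
  have lin: "Vector_Spaces.linear (hscale R) (*) (root R j)" for j
    using R by (simp add: is_realization_def)
  have "root R j (coroot_plus R i + coroot_shift R H \<Theta> i) = twist_matrix R H \<Theta> P $ i $ j" for i j
  proof -
    interpret Vector_Spaces.linear "hscale R" "(*)" "root R j" by (rule lin)
    \<comment> \<open>\<open>coroot_shift\<close> contains \<theta>_kg and the matrix product
      \<theta>_gk, so antisymmetry supplies the sign.\<close>
    have "(\<Sum>g \<in> UNIV. \<Sum>k \<in> UNIV. root R i (H g) * \<Theta> $ k $ g * root R j (H k)) =
      - (\<Sum>g \<in> UNIV. \<Sum>k \<in> UNIV. root R i (H g) * \<Theta> $ g $ k * root R j (H k))"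
      unfolding sum_negf[symmetric]
      by (intro sum.cong HOL.refl antisymmetric_product)
    then show ?thesis
      using R by (simp add: add root_coroot_shift twist_matrix_entries is_realization_def)
  qed
  moreover have "root R j (coroot_minus R i - coroot_shift R H \<Theta> i) = twist_matrix R H \<Theta> P $ j $ i" for i j
  proof -
    interpret Vector_Spaces.linear "hscale R" "(*)" "root R j" by (rule lin)
    \<comment> \<open>Here i and j are exchanged as well, so renaming the summation indices is
      enough and no sign appears.\<close>
    have "(\<Sum>g \<in> UNIV. \<Sum>k \<in> UNIV. root R i (H g) * \<Theta> $ k $ g * root R j (H k)) =
      (\<Sum>g \<in> UNIV. \<Sum>k \<in> UNIV. root R j (H g) * \<Theta> $ g $ k * root R i (H k))"
      by (subst sum.swap) (simp add: mult_ac)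
    then show ?thesis
      using R by (simp add: diff root_coroot_shift twist_matrix_entries is_realization_def)
  qed
  ultimately show ?thesis
    using R unfolding is_realization_def twist_realization_simps by blast
qed

lemma mp_eq_twist: "mp_eq A d (twist_realization R H \<Theta>) = mp_eq A d R"
  by (intro ext iffI; erule mp_eq_mono[rotated -1]) (simp_all add: twist_realization_simps)

lemma mp_class_twist: "mp_class A d (twist_realization R H \<Theta>) = mp_class A d R"
  by (simp add: fun_eq_iff mp_class_def mp_eq_twist)

lemma mp_lie_twist:
  "mp_lie A d (twist_realization R H \<Theta>) = mp_lie A d R"
  "elT A d (twist_realization R H \<Theta>) = elT A d R"
  "elE A d (twist_realization R H \<Theta>) = elE A d R"
  "elF A d (twist_realization R H \<Theta>) = elF A d R"
  by (simp_all add: mp_lie_def fun_eq_iff elT_def elE_def elF_def mp_class_twist)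

text \<open>\<open>toral_twist\<close> written over \<open>mp_lie\<close>, where the computations
  take place, instead of over the record \<open>mplba\<close>.\<close>

definition mp_twist where
  "mp_twist = (\<Oplus>\<^bsub>tensor (mp_lie A d R) (mp_lie A d R)\<^esub>p \<in> UNIV.
     (\<Theta> $ fst p $ snd p) \<odot>\<^bsub>tensor (mp_lie A d R) (mp_lie A d R)\<^esub>
     pure_tensor (mp_lie A d R) (mp_lie A d R) (elT A d R (H (fst p))) (elT A d R (H (snd p))))"

lemma mp_twist_closed: "mp_twist \<in> carrier (tensor (mp_lie A d R) (mp_lie A d R))"
  unfolding mp_twist_def using lie_vspace[OF lie_algebra_mp_lie[of A d R]] by simp

text \<open>H_g \<otimes> H_k contributes - s \<alpha>_l(H_g) X \<otimes> H_k - s \<alpha>_l(H_k)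
  H_g \<otimes> X, and antisymmetry of \<Theta> assembles the two kinds of terms into a wedge. The
  sign s is 1 for X = E_l and -1 for X = F_l.\<close>

lemma ad_mp_twist:
  assumes X: "X \<in> carrier (mp_lie A d R)"
    and wt: "\<And>T. bracket (mp_lie A d R) (elT A d R T) X = (s * root R l T) \<odot>\<^bsub>mp_lie A d R\<^esub> X"
  shows "tensor_ad (mp_lie A d R) X mp_twist =
    (- s) \<odot>\<^bsub>tensor (mp_lie A d R) (mp_lie A d R)\<^esub>
      wedge (mp_lie A d R) (elT A d R (coroot_shift R H \<Theta> l)) X"
proof -
  note LL = lie_algebra_mp_lie[of A d R]
  note V = lie_vspace[OF LL] and V2 = vspace_tensor2[OF LL]
  let ?L = "mp_lie A d R" and ?e = "emb (tensor (mp_lie A d R) (mp_lie A d R))"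
  have rev: "bracket ?L X (elT A d R T) = \<ominus>\<^bsub>?L\<^esub> ((s * root R l T) \<odot>\<^bsub>?L\<^esub> X)" for T
    using bracket_anti[OF LL X, of "elT A d R T"] wt by simp
  define a where "a k = ?e (pure_tensor ?L ?L (elT A d R (H k)) X)" for k
  define b where "b k = ?e (pure_tensor ?L ?L X (elT A d R (H k)))" for k
  \<comment> \<open>\<phi> is linear in T, so its value at \<open>coroot_shift\<close> unfolds into
    the double sum that the calculation reaches.\<close>
  define \<phi> where "\<phi> T = ?e (wedge ?L (elT A d R T) X)" for T
  have \<phi>_add: "\<phi> (S + T) = \<phi> S + \<phi> T" and \<phi>_scale: "\<phi> (hscale R c T) = free_scale c (\<phi> T)" for S T c
    by (simp_all add: \<phi>_def mp_relations wedge_bilinear[OF LL] wedge_closed[OF LL] X V emb_simps)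
  have \<phi>_zero: "\<phi> 0 = 0" using \<phi>_add[of 0 0] by simp
  have \<phi>_sum: "\<phi> (sum f I) = (\<Sum>i \<in> I. \<phi> (f i))" for f :: "'g \<Rightarrow> 'h" and I
    by (induction I rule: infinite_finite_induct) (simp_all add: \<phi>_zero \<phi>_add)
  have \<phi>_H: "\<phi> (H k) = a k - b k" for k
    by (simp add: \<phi>_def a_def b_def wedge_def X V emb_simps)
  have antisymmetric_scale: "- free_scale (\<Theta> $ g $ k * c) v = free_scale (\<Theta> $ k $ g * c) v"
    for g k c and v :: "_ \<Rightarrow>\<^sub>0 'k"
    using antisymmetric_entries[of k g] by simp
  have "?e (tensor_ad ?L X mp_twist) = (\<Sum>p \<in> UNIV. ?e (tensor_ad ?L X
      ((\<Theta> $ fst p $ snd p) \<odot>\<^bsub>tensor ?L ?L\<^esub> pure_tensor ?L ?L (elT A d R (H (fst p))) (elT A d R (H (snd p))))))"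
    unfolding mp_twist_def
    by (subst mod_hom_finsum[OF V2 V2 tensor_ad_hom[OF LL X]])
      (simp_all add: V X emb_finsum tensor_ad_closed[OF LL])
  also have "\<dots> = (\<Sum>p \<in> UNIV. - free_scale (\<Theta> $ fst p $ snd p * (s * root R l (H (fst p)))) (b (snd p))
      - free_scale (\<Theta> $ fst p $ snd p * (s * root R l (H (snd p)))) (a (fst p)))"
    by (intro sum.cong HOL.refl)
      (simp add: V X tensor_ad_linear[OF LL] tensor_ad_pure[OF LL] rev tensor_rules[OF LL] emb_simps a_def b_def
        free.scale_right_diff_distrib)
  also have "\<dots> = (\<Sum>g \<in> UNIV. \<Sum>k \<in> UNIV. - free_scale (\<Theta> $ g $ k * (s * root R l (H g))) (b k)
      - free_scale (\<Theta> $ g $ k * (s * root R l (H k))) (a g))"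
    by (simp add: sum.cartesian_product case_prod_beta flip: UNIV_Times_UNIV)
  also have "\<dots> = (\<Sum>g \<in> UNIV. \<Sum>k \<in> UNIV. - free_scale (\<Theta> $ g $ k * (s * root R l (H g))) (b k))
      - (\<Sum>g \<in> UNIV. \<Sum>k \<in> UNIV. free_scale (\<Theta> $ g $ k * (s * root R l (H k))) (a g))"
    by (simp add: sum_subtractf)
  \<comment> \<open>Exchanging g and k puts \<theta>_kg and \<alpha>_l(H_g) in front of H_k
    \<otimes> X, as in \<open>coroot_shift\<close>.\<close>
  also have "(\<Sum>g \<in> UNIV. \<Sum>k \<in> UNIV. free_scale (\<Theta> $ g $ k * (s * root R l (H k))) (a g)) =
      (\<Sum>g \<in> UNIV. \<Sum>k \<in> UNIV. free_scale (\<Theta> $ k $ g * (s * root R l (H g))) (a k))"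
    by (rule sum.swap)
  \<comment> \<open>For the terms X \<otimes> H_k the same coefficient is obtained by antisymmetry,
    which absorbs the sign.\<close>
  also have "(\<Sum>g \<in> UNIV. \<Sum>k \<in> UNIV. - free_scale (\<Theta> $ g $ k * (s * root R l (H g))) (b k)) =
      (\<Sum>g \<in> UNIV. \<Sum>k \<in> UNIV. free_scale (\<Theta> $ k $ g * (s * root R l (H g))) (b k))"
    by (intro sum.cong HOL.refl antisymmetric_scale)
  also have "(\<Sum>g \<in> UNIV. \<Sum>k \<in> UNIV. free_scale (\<Theta> $ k $ g * (s * root R l (H g))) (b k)) -
      (\<Sum>g \<in> UNIV. \<Sum>k \<in> UNIV. free_scale (\<Theta> $ k $ g * (s * root R l (H g))) (a k)) =
      free_scale (- s) (\<phi> (coroot_shift R H \<Theta> l))"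
    by (simp add: coroot_shift_def \<phi>_sum \<phi>_scale \<phi>_H free.scale_sum_right free.scale_right_diff_distrib
        sum_negf[symmetric] sum_subtractf[symmetric] mult_ac)
  finally show ?thesis
    by (intro vs_eqI[OF V2])
      (simp_all add: \<phi>_def X V mp_twist_closed tensor_ad_closed[OF LL] wedge_closed[OF LL] emb_simps)
qed

text \<open>Toral elements commute, so every summand of the twist is killed.\<close>

lemma ad_mp_twist_toral: "tensor_ad (mp_lie A d R) (elT A d R T) mp_twist = \<zero>\<^bsub>tensor (mp_lie A d R) (mp_lie A d R)\<^esub>"
proof -
  note LL = lie_algebra_mp_lie[of A d R]
  note V = lie_vspace[OF LL] and V2 = vspace_tensor2[OF LL]
  interpret V2: Module.module field_ring "tensor (mp_lie A d R) (mp_lie A d R)" by (rule V2)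
  show ?thesis
    unfolding mp_twist_def
    by (subst mod_hom_finsum[OF V2 V2 tensor_ad_hom[OF LL]])
      (simp_all add: V V2 tensor_ad_linear[OF LL] tensor_ad_pure[OF LL] mp_relations tensor_rules[OF LL] vs_zero_smult)
qed

text \<open>Subtracting ad_x(j_\<Theta>) adds the shift to T_i^+ at E_i, where s = 1, and removes it
  from T_i^- at F_i, where s = -1: the signs of \<open>twist_realization\<close>.\<close>

lemma twisted_cobracket:
  assumes A: "gen_cartan_matrix A" and X: "X \<in> carrier (mp_lie A d R)"
  shows "mp_cobracket A d R X \<ominus>\<^bsub>tensor (mp_lie A d R) (mp_lie A d R)\<^esub> tensor_ad (mp_lie A d R) X mp_twist =
    mp_cobracket A d (twist_realization R H \<Theta>) X"
proof (rule cocycle_eqI[OF _ _ _ _ _ X])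
  note LL = lie_algebra_mp_lie[of A d R]
  note V = lie_vspace[OF LL] and V2 = vspace_tensor2[OF LL]
  note gens = mp_cobracket_generators[OF A P R]
    mp_cobracket_generators[OF A cartan_type_twist is_realization_twist, unfolded mp_lie_twist]
  show "cocycle (mp_lie A d R) (\<lambda>X. mp_cobracket A d R X
      \<ominus>\<^bsub>tensor (mp_lie A d R) (mp_lie A d R)\<^esub> tensor_ad (mp_lie A d R) X mp_twist)"
    by (rule cocycle_twist[OF LL mp_cobracket_cocycle[OF A P R] mp_twist_closed])
  show "cocycle (mp_lie A d R) (mp_cobracket A d (twist_realization R H \<Theta>))"
    using mp_cobracket_cocycle[OF A cartan_type_twist is_realization_twist] by (simp add: mp_lie_twist)
  show "mp_cobracket A d R (elT A d R T) \<ominus>\<^bsub>tensor (mp_lie A d R) (mp_lie A d R)\<^esub>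
      tensor_ad (mp_lie A d R) (elT A d R T) mp_twist = mp_cobracket A d (twist_realization R H \<Theta>) (elT A d R T)" for T
    by (rule vs_eqI[OF V2]) (simp_all add: gens ad_mp_twist_toral V2 emb_simps)
  note rules = gens V V2 emb_simps twist_realization_simps mp_relations wedge_bilinear[OF LL] wedge_closed[OF LL]
  show "mp_cobracket A d R (elE A d R i) \<ominus>\<^bsub>tensor (mp_lie A d R) (mp_lie A d R)\<^esub>
      tensor_ad (mp_lie A d R) (elE A d R i) mp_twist = mp_cobracket A d (twist_realization R H \<Theta>) (elE A d R i)" for i
    using ad_mp_twist[of "elE A d R i" 1 i]
    by (intro vs_eqI[OF V2]) (simp_all add: rules)
  show "mp_cobracket A d R (elF A d R i) \<ominus>\<^bsub>tensor (mp_lie A d R) (mp_lie A d R)\<^esub>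
      tensor_ad (mp_lie A d R) (elF A d R i) mp_twist = mp_cobracket A d (twist_realization R H \<Theta>) (elF A d R i)" for i
  proof -
    \<comment> \<open>\<open>mp_relations\<close> has the additivity of \<open>elT\<close>, so the
      difference is treated by writing T_i^- as a sum.\<close>
    have "coroot_minus R i = (coroot_minus R i - coroot_shift R H \<Theta> i) + coroot_shift R H \<Theta> i" by simp
    then have "elT A d R (coroot_minus R i) =
        elT A d R (coroot_minus R i - coroot_shift R H \<Theta> i) \<oplus>\<^bsub>mp_lie A d R\<^esub> elT A d R (coroot_shift R H \<Theta> i)"
      by (metis mp_relations(1))
    then show ?thesis
      using ad_mp_twist[of "elF A d R i" "- 1" i]
      by (intro vs_eqI[OF V2]) (simp_all add: rules)
  qed
qed

text \<open>The two records share carrier and operations, and their cobrackets are compared on the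
  carrier; this yields the identity as an isomorphism instead of an equation between
  records.\<close>

lemma mplba_twist_iso:
  assumes A: "gen_cartan_matrix A"
  shows "lie_bialgebra_iso (\<lambda>x. x) (mplba A d (twist_realization R H \<Theta>))
    (twist_bialgebra (mplba A d R) (toral_twist A d R H \<Theta>))"
    (is "lie_bialgebra_iso _ ?B' ?B")
proof -
  note LL = lie_algebra_mp_lie[of A d R]
  note A' = A cartan_type_twist is_realization_twist
  note B'_eq = mplba_eq[OF A']
  note eq = mp_with_simps(1-5)[of A d R "mp_cobracket A d R"]
  have B': "carrier ?B' = carrier (mp_lie A d R)" "zero ?B' = zero (mp_lie A d R)"
    "add ?B' = add (mp_lie A d R)" "smult ?B' = smult (mp_lie A d R)" "bracket ?B' = bracket (mp_lie A d R)"
    by (simp_all add: B'_eq mp_with_simps mp_lie_twist)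
  have B: "carrier ?B = carrier (mp_lie A d R)" "zero ?B = zero (mp_lie A d R)"
    "add ?B = add (mp_lie A d R)" "smult ?B = smult (mp_lie A d R)" "bracket ?B = bracket (mp_lie A d R)"
    by (simp_all add: mplba_eq[OF A P R] twist_bialgebra_simps mp_with_simps)
  have twist: "toral_twist A d R H \<Theta> = mp_twist"
    unfolding toral_twist_def mp_twist_def Let_def mplba_eq[OF A P R] tensor_cong[OF eq] pure_tensor_cong[OF eq] ..
  have \<delta>: "cobracket ?B X = mp_cobracket A d (twist_realization R H \<Theta>) X" if "X \<in> carrier (mp_lie A d R)" for X
    unfolding twist_bialgebra_simps twist mplba_eq[OF A P R] tensor_cong[OF eq] tensor_ad_cong[OF eq] mp_with_simps
    by (rule twisted_cobracket[OF A that])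
  have \<delta>': "cobracket ?B' = mp_cobracket A d (twist_realization R H \<Theta>)"
    by (simp add: B'_eq mp_with_simps)
  \<comment> \<open>The criterion is applied at the twisted realization, whose cobracket the twist
    has on the carrier.\<close>
  have "lie_bialgebra ?B"
    by (rule mp_lie_bialgebraI[OF A']) (simp_all only: mp_lie_twist B \<delta>)
  moreover have bi': "lie_bialgebra ?B'"
    by (rule mp_lie_bialgebraI[OF A']) (simp_all only: mp_lie_twist B' \<delta>')
  moreover have "(\<lambda>x. x) \<in> mod_hom ?B' ?B"
    by (simp add: mod_hom_def B B')
  moreover have "cobracket ?B X = tensor_map ?B' ?B (\<lambda>x. x) (cobracket ?B' X)" if "X \<in> carrier ?B'" for X
  proof -
    have X: "X \<in> carrier (mp_lie A d R)" using that by (simp add: B')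
    have "mp_cobracket A d (twist_realization R H \<Theta>) X \<in> carrier (tensor (mp_lie A d R) (mp_lie A d R))"
      using mod_hom_closed[OF cocycleD(1)[OF mp_cobracket_cocycle[OF A'], unfolded mp_lie_twist] X] .
    from tensor_map_id[OF LL this] show ?thesis
      unfolding tensor_map_def tensor_lift_cong[OF B'] tensor_cong[OF B] pure_tensor_cong[OF B] \<delta>' \<delta>[OF X]
      by simp
  qed
  ultimately show ?thesis
    by (simp add: lie_bialgebra_iso_def B B' bij_betw_def)
qed

end

text \<open>One witness serves all the class statements: \<open>twist_realization\<close> with the
  identity map. Its scalars and roots are those of R, which gives rank and straightness; smallness
  is decided by \<open>small_twist_iff\<close>.\<close>

theorem theorem3p3p3:
  fixes A :: "int^'n^'n" and d :: "'n::finite \<Rightarrow> nat"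
    and P :: "'k::field_char_0^'n^'n"
    and R :: "('k, 'h::ab_group_add, 'n) realization"
    and t :: nat
    and H :: "'g::finite \<Rightarrow> 'h" and \<Theta> :: "'k^'g^'g"
  assumes "gen_cartan_matrix A" and "symmetrizer A d"
    and "cartan_type A d P"
    and "is_realization P R" and "realization_rank R = t"
    and "basis_family R H"
    and "transpose \<Theta> = - \<Theta>"
  shows "let P\<^sub>\<Theta> = twist_matrix R H \<Theta> P;
             R\<^sub>\<Theta> = twist_realization R H \<Theta>;
             L = twist_bialgebra (mplba A d R) (toral_twist A d R H \<Theta>)
    in (cartan_type A d P\<^sub>\<Theta> \<and> is_realization P\<^sub>\<Theta> R\<^sub>\<Theta>) \<and>
       (\<exists>f. lie_bialgebra_iso f (mplba A d R\<^sub>\<Theta>) L \<and>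
          (\<forall>i. f (elE A d R\<^sub>\<Theta> i) = elE A d R i) \<and>
          (\<forall>T. f (elT A d R\<^sub>\<Theta> T) = elT A d R T) \<and>
          (\<forall>i. f (elF A d R\<^sub>\<Theta> i) = elF A d R i)) \<and>
       in_mplba_class A d t (\<lambda>_. True) L \<and>
       (straight R \<longrightarrow> in_mplba_class A d t straight L) \<and>
       (small R \<and>
          (\<forall>l. coroot_shift R H \<Theta> l \<in> module.span (hscale R) (range (coroot_mean R)))
        \<longrightarrow> in_mplba_class A d t small L)"
proof -
  let ?R = "twist_realization R H \<Theta>" and ?P = "twist_matrix R H \<Theta> P"
  let ?L = "twist_bialgebra (mplba A d R) (toral_twist A d R H \<Theta>)"
  note A = assms(1) and PR = assms(3,4,7)
  have real: "cartan_type A d ?P" "is_realization ?P ?R"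
    using cartan_type_twist[OF PR] is_realization_twist[OF PR] by blast+
  have iso: "lie_bialgebra_iso (\<lambda>x. x) (mplba A d ?R) ?L"
    by (rule mplba_twist_iso[OF PR A])
  have rank: "realization_rank ?R = t"
    using assms(5) by (simp add: realization_rank_def twist_realization_def)
  have in_class: "in_mplba_class A d t Q ?L" if "Q ?R" for Q
    unfolding in_mplba_class_def using real rank iso that by blast
  have "straight ?R" if "straight R"
    using that by (simp add: straight_def twist_realization_def)
  moreover have "small ?R" if "small R"
    "\<forall>l. coroot_shift R H \<Theta> l \<in> module.span (hscale R) (range (coroot_mean R))"
    using that small_twist_iff[of R H \<Theta>] assms(4) by (simp add: is_realization_def)
  ultimately show ?thesis
    unfolding Let_def using real iso mp_lie_twist[OF PR] in_class by (intro conjI impI exI[of _ "\<lambda>x. x"]) auto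
qed

end
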